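(* Let $M$ be an $n|m$-dimensional supermanifold with an odd symplectic structure whose odd Poisson bracket is specified by a master Hamiltonian $S=S^{ij}p_jp_i$ by $[f,g]=(-1)^{\tilde f}((S,f),g)$, and with a projective class $\Pi^k_{ij}$. The corresponding canonical bracket on densities defines an odd Poisson bracket if and only if there is a local volume form $\rho$ such that $$S^{jk}\Pi^i_{kj}=-\left(\partial_jS^{ji}+\frac{n-m+3}{n-m+1}\,S^{ij}\partial_j\log\rho\right),$$ $$S^{ij}B_{ji}=-\partial_j\left(S^{ji}\partial_i\log\rho\right)-\frac{n-m+2}{n-m+1}\,S^{ij}\,\partial_i\log\rho\,\partial_j\log\rho\,(-1)^{\tilde\jmath},$$ where $$B_{kj}=\frac{n-m+1}{n-m-1}\left(\partial_q\Pi^q_{kj}+\Pi^p_{qk}\Pi^q_{pj}\right)(-1)^{\tilde q(1+\tilde k+\tilde\jmath)}.$$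
   Context: Local coordinates on $M$ are $x^i$, $\tilde\imath$ is the parity of $x^i$, $\tilde f$ the parity of $f$, $\partial_i=\partial/\partial x^i$, repeated indices are summed, and $p_i$ are the momenta on $T^*M$ conjugate to $x^i$. In coordinates a local volume form is $\rho(x)|Dx|$, with $|Dx|$ the coordinate Berezin volume element; $\log\rho$ is the logarithm of its coefficient. Projective class: for a symmetric linear connection with coefficients $\Gamma^k_{ij}$ on an $n|m$-dimensional supermanifold put $$\Pi^k_{ji}=\Gamma^k_{ji}-\frac{1}{n-m+1}\left(\Gamma^s_{js}\delta^k_i(-1)^{\tilde s}+\Gamma^s_{is}\delta^k_j(-1)^{\tilde\imath\tilde\jmath+\tilde s}\right).$$ Two symmetric connections define the same projective class if their $\Pi^k_{ji}$ coincide; the projective class is identified with the $\Pi^k_{ji}$. The odd master Hamiltonian $S=S^{ij}p_jp_i\in C^\infty(T^*M)$ specifies the odd symmetric bracket $$\{f,g\}=((S,f),g)=S^{ij}\partial_jf\,\partial_ig\,(-1)^{\tilde\imath(\tilde f+1)},$$ where $(\cdot,\cdot)$ is the canonical even Poisson bracket on $T^*M$, and $[f,g]=(-1)^{\tilde f}\{f,g\}$. An odd Poisson bracket is an odd bilinear map satisfying $[a,b]=-(-1)^{(\tilde a+1)(\tilde b+1)}[b,a]$, $[a,[b,c]]=[[a,b],c]+(-1)^{(\tilde a+1)(\tilde b+1)}[b,[a,c]]$ and $[a,bc]=[a,b]c+(-1)^{(\tilde a+1)\tilde b}b[a,c]$. The structure is odd symplectic when $[\cdot,\cdot]$ is an odd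 Poisson bracket and the matrix $S^{ij}$ is non-degenerate. An odd symmetric biderivation $\{\cdot,\cdot\}$ defines an odd Poisson bracket if $[a,b]:=(-1)^{\tilde a}\{a,b\}$ is one. Densities: $\mathfrak V(M)=\bigoplus_{\mu\in\mathbb R}\mathfrak V_\mu(M)$, where elements of $\mathfrak V_\mu(M)$ are locally $\phi(x)|Dx|^\mu$, with product $\phi|Dx|^\lambda\cdot\psi|Dx|^\mu=\phi\psi|Dx|^{\lambda+\mu}$. The canonical bracket on densities corresponding to $S^{ij}$ and $\Pi^k_{ij}$ is the odd symmetric biderivation of $\mathfrak V(M)$ of weight $0$ with components $\{x^i,x^j\}=S^{ij}$, $\{x^i,|Dx|\}=\gamma^i|Dx|$, $\{|Dx|,|Dx|\}=\theta|Dx|^2$, where (for odd $S$) $$\gamma^i=\frac{n-m+1}{n-m+3}\left(\partial_jS^{ji}+S^{jk}\Pi^i_{kj}\right),\qquad \theta=\frac{n-m+1}{n-m+2}\left(\partial_k\gamma^k-S^{kj}B_{jk}\right).$$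
   Formalization: In the last term of the second equation the sign (-1)^{j̃} is replaced by (-1)^{ĩj̃}, so that the term is {log ρ, log ρ}; with the printed sign the equivalence is false, and {f,g} is taken as ((S,f),g), whose coordinate sign is (-1)^{ĩf̃}. *)

theory Defs
  imports
    "HOL-Analysis.Analysis"
    "HOL-Library.Function_Algebras"
    "HOL-Library.Poly_Mapping"
begin

section \<open>The Grassmann algebra\<close>

text \<open>
  Exterior algebra over the reals on odd generators indexed by \<open>nat\<close>. An element is given by its
  coefficients at the monomials \<open>\<xi>\<^sub>I\<close>, the product of the \<open>\<xi>\<^sub>a\<close>, \<open>a \<in> I\<close>, in increasing order,
  for finite \<open>I\<close>. Functions on an \<open>n|m\<close>-dimensional superdomain only involve the generators with
  index below \<open>m\<close>.
\<close>

typedef grassmann = "{f :: nat set \<Rightarrow> real. \<forall>I. infinite I \<longrightarrow> f I = 0}"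
  morphisms coeff Abs_grassmann
  by (rule exI[of _ "\<lambda>_. 0"]) simp

setup_lifting type_definition_grassmann

text \<open>The sign in \<open>\<xi>\<^sub>J \<xi>\<^sub>K = \<plusminus> \<xi>\<^bsub>J \<union> K\<^esub>\<close> for disjoint \<open>J\<close> and \<open>K\<close>.\<close>

definition shuffle_sign :: "nat set \<Rightarrow> nat set \<Rightarrow> real" where
  "shuffle_sign J K = (-1) ^ card {(j, k). j \<in> J \<and> k \<in> K \<and> k < j}"

lemma shuffle_sign_empty [simp]: "shuffle_sign {} K = 1" "shuffle_sign J {} = 1"
  by (simp_all add: shuffle_sign_def)

lemma finite_inversions:
  fixes J K :: "nat set"
  assumes "finite J" "finite K"
  shows "finite {(j, k). j \<in> J \<and> k \<in> K \<and> k < j}"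
  by (rule finite_subset[of _ "J \<times> K"]) (use assms in auto)

lemma shuffle_sign_Un_left:
  assumes "finite J" "finite K" "finite L" "J \<inter> K = {}"
  shows "shuffle_sign (J \<union> K) L = shuffle_sign J L * shuffle_sign K L"
proof -
  have "{(j, k). j \<in> J \<union> K \<and> k \<in> L \<and> k < j}
      = {(j, k). j \<in> J \<and> k \<in> L \<and> k < j} \<union> {(j, k). j \<in> K \<and> k \<in> L \<and> k < j}" by auto
  moreover have "card ({(j, k). j \<in> J \<and> k \<in> L \<and> k < j} \<union> {(j, k). j \<in> K \<and> k \<in> L \<and> k < j})
      = card {(j, k). j \<in> J \<and> k \<in> L \<and> k < j} + card {(j, k). j \<in> K \<and> k \<in> L \<and> k < j}"
    by (rule card_Un_disjoint) (use assms finite_inversions in auto)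
  ultimately show ?thesis by (simp add: shuffle_sign_def power_add)
qed

lemma shuffle_sign_Un_right:
  assumes "finite J" "finite K" "finite L" "K \<inter> L = {}"
  shows "shuffle_sign J (K \<union> L) = shuffle_sign J K * shuffle_sign J L"
proof -
  have "{(j, k). j \<in> J \<and> k \<in> K \<union> L \<and> k < j}
      = {(j, k). j \<in> J \<and> k \<in> K \<and> k < j} \<union> {(j, k). j \<in> J \<and> k \<in> L \<and> k < j}" by auto
  moreover have "card ({(j, k). j \<in> J \<and> k \<in> K \<and> k < j} \<union> {(j, k). j \<in> J \<and> k \<in> L \<and> k < j})
      = card {(j, k). j \<in> J \<and> k \<in> K \<and> k < j} + card {(j, k). j \<in> J \<and> k \<in> L \<and> k < j}"
    by (rule card_Un_disjoint) (use assms finite_inversions in auto)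
  ultimately show ?thesis by (simp add: shuffle_sign_def power_add)
qed

instantiation grassmann :: ring_1
begin

lift_definition zero_grassmann :: grassmann is "\<lambda>_. 0" by simp

lift_definition one_grassmann :: grassmann is "\<lambda>I. if I = {} then 1 else 0" by auto

lift_definition plus_grassmann :: "grassmann \<Rightarrow> grassmann \<Rightarrow> grassmann"
  is "\<lambda>a b I. a I + b I" by simp

lift_definition minus_grassmann :: "grassmann \<Rightarrow> grassmann \<Rightarrow> grassmann"
  is "\<lambda>a b I. a I - b I" by simp

lift_definition uminus_grassmann :: "grassmann \<Rightarrow> grassmann"
  is "\<lambda>a I. - a I" by simp

lift_definition times_grassmann :: "grassmann \<Rightarrow> grassmann \<Rightarrow> grassmann"
  is "\<lambda>a b I. if finite I then \<Sum>J\<in>Pow I. shuffle_sign J (I - J) * a J * b (I - J) else 0"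
  by simp

instance
proof
  fix a b c :: grassmann
  show "a * b * c = a * (b * c)"
  proof (transfer, rule ext)
    fix a b c :: "nat set \<Rightarrow> real" and I :: "nat set"
    let ?s = shuffle_sign
    let ?t = "\<lambda>J K L. ?s J K * ?s J L * ?s K L * a J * b K * c L"
    let ?m = "\<lambda>(a :: nat set \<Rightarrow> real) b I.
                if finite I then \<Sum>J\<in>Pow I. ?s J (I - J) * a J * b (I - J) else 0"
    show "?m (?m a b) c I = ?m a (?m b c) I"
    proof (cases "finite I")
      case True
      have l: "?m (?m a b) c I = (\<Sum>(A, J)\<in>(SIGMA A:Pow I. Pow A). ?t J (A - J) (I - A))"
      proof -
        have "?m (?m a b) c I
            = (\<Sum>A\<in>Pow I. \<Sum>J\<in>Pow A. ?s A (I - A) * (?s J (A - J) * a J * b (A - J)) * c (I - A))"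
          using True by (auto intro!: sum.cong dest: finite_subset
              simp: sum_distrib_left sum_distrib_right)
        also have "\<dots> = (\<Sum>A\<in>Pow I. \<Sum>J\<in>Pow A. ?t J (A - J) (I - A))"
        proof (intro sum.cong refl)
          fix A J assume A: "A \<in> Pow I" "J \<in> Pow A"
          with True have "finite A" "finite J" by (auto dest: finite_subset)
          with A True have "?s (J \<union> (A - J)) (I - A) = ?s J (I - A) * ?s (A - J) (I - A)"
            by (intro shuffle_sign_Un_left) auto
          moreover have "J \<union> (A - J) = A" using A by auto
          ultimately show "?s A (I - A) * (?s J (A - J) * a J * b (A - J)) * c (I - A)
              = ?t J (A - J) (I - A)" by simp
        qed
        also have "\<dots> = (\<Sum>(A, J)\<in>(SIGMA A:Pow I. Pow A). ?t J (A - J) (I - A))"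
          using True by (subst sum.Sigma) (auto dest: finite_subset)
        finally show ?thesis .
      qed
      have r: "?m a (?m b c) I = (\<Sum>(J, K)\<in>(SIGMA J:Pow I. Pow (I - J)). ?t J K (I - J - K))"
      proof -
        have "?m a (?m b c) I
            = (\<Sum>J\<in>Pow I. \<Sum>K\<in>Pow (I - J). ?s J (I - J) * a J * (?s K (I - J - K) * b K * c (I - J - K)))"
          using True by (auto intro!: sum.cong simp: sum_distrib_left)
        also have "\<dots> = (\<Sum>J\<in>Pow I. \<Sum>K\<in>Pow (I - J). ?t J K (I - J - K))"
        proof (intro sum.cong refl)
          fix J K assume J: "J \<in> Pow I" "K \<in> Pow (I - J)"
          with True have "finite J" "finite K" by (auto dest: finite_subset)
          with J True have "?s J (K \<union> (I - J - K)) = ?s J K * ?s J (I - J - K)"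
            by (intro shuffle_sign_Un_right) auto
          moreover have "K \<union> (I - J - K) = I - J" using J by auto
          ultimately show "?s J (I - J) * a J * (?s K (I - J - K) * b K * c (I - J - K))
              = ?t J K (I - J - K)" by simp
        qed
        also have "\<dots> = (\<Sum>(J, K)\<in>(SIGMA J:Pow I. Pow (I - J)). ?t J K (I - J - K))"
          using True by (subst sum.Sigma) auto
        finally show ?thesis .
      qed
      have "(\<Sum>(A, J)\<in>(SIGMA A:Pow I. Pow A). ?t J (A - J) (I - A))
          = (\<Sum>(J, K)\<in>(SIGMA J:Pow I. Pow (I - J)). ?t J K (I - J - K))"
      proof (rule sum.reindex_bij_witness
            [of _ "\<lambda>(J, K). (J \<union> K, J)" "\<lambda>(A, J). (J, A - J)"])
        fix x assume "x \<in> (SIGMA A:Pow I. Pow A)"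
        then obtain A J where x: "x = (A, J)" "A \<subseteq> I" "J \<subseteq> A" by auto
        then have "I - J - (A - J) = I - A" by auto
        with x show "(case (case x of (A, J) \<Rightarrow> (J, A - J)) of (J, K) \<Rightarrow> ?t J K (I - J - K))
            = (case x of (A, J) \<Rightarrow> ?t J (A - J) (I - A))" by simp
      qed auto
      with l r show ?thesis by simp
    qed simp
  qed
  show "1 * a = a"
  proof (transfer, rule ext)
    fix a :: "nat set \<Rightarrow> real" and I
    assume a: "\<forall>I. infinite I \<longrightarrow> a I = 0"
    have "(\<Sum>J\<in>Pow I. shuffle_sign J (I - J) * (if J = {} then 1 else 0) * a (I - J)) = a I"
      if "finite I"
      using that sum.delta[of "Pow I" "{}" "\<lambda>J. shuffle_sign J (I - J) * a (I - J)"]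
      by (simp add: if_distrib if_distribR cong: if_cong)
    with a show "(if finite I then \<Sum>J\<in>Pow I. shuffle_sign J (I - J)
        * (if J = {} then 1 else 0) * a (I - J) else 0) = a I" by simp
  qed
  show "a * 1 = a"
  proof (transfer, rule ext)
    fix a :: "nat set \<Rightarrow> real" and I
    assume a: "\<forall>I. infinite I \<longrightarrow> a I = 0"
    have "(\<Sum>J\<in>Pow I. shuffle_sign J (I - J) * a J * (if I - J = {} then 1 else 0)) = a I"
      if "finite I"
    proof -
      have "(\<Sum>J\<in>Pow I. shuffle_sign J (I - J) * a J * (if I - J = {} then 1 else 0))
          = (\<Sum>J\<in>Pow I. if J = I then shuffle_sign J (I - J) * a J else 0)"
        by (intro sum.cong) auto
      also have "\<dots> = a I"
        using that sum.delta[of "Pow I" I "\<lambda>J. shuffle_sign J (I - J) * a J"] by simp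
      finally show ?thesis .
    qed
    with a show "(if finite I then \<Sum>J\<in>Pow I. shuffle_sign J (I - J) * a J
        * (if I - J = {} then 1 else 0) else 0) = a I" by simp
  qed
  show "(a + b) * c = a * c + b * c"
    by transfer (auto simp: algebra_simps sum.distrib)
  show "a * (b + c) = a * b + a * c"
    by transfer (auto simp: algebra_simps sum.distrib)
  show "a + b + c = a + (b + c)" by transfer auto
  show "a + b = b + a" by transfer auto
  show "0 + a = a" by transfer auto
  show "- a + a = 0" by transfer auto
  show "a - b = a + - b" by transfer auto
  show "(0 :: grassmann) \<noteq> 1" by transfer (auto dest: fun_cong[of _ _ "{}"])
qed

end

lift_definition gconst :: "real \<Rightarrow> grassmann" is "\<lambda>r I. if I = {} then r else 0" by auto

lift_definition ggen :: "nat \<Rightarrow> grassmann" is "\<lambda>a I. if I = {a} then 1 else 0" by auto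

text \<open>The grading involution \<open>z \<mapsto> (-1)\<^bsup>z\<^esup> z\<close> and the left derivative along the generator \<open>\<xi>\<^sub>a\<close>.\<close>

lift_definition ginv :: "grassmann \<Rightarrow> grassmann" is "\<lambda>z I. (-1) ^ card I * z I" by simp

lift_definition gderiv :: "nat \<Rightarrow> grassmann \<Rightarrow> grassmann"
  is "\<lambda>a z I. if a \<in> I then 0 else (-1) ^ card {b \<in> I. b < a} * z (insert a I)" by auto

definition body :: "grassmann \<Rightarrow> real" where
  "body z = coeff z {}"

text \<open>
  The logarithm of an even element with positive body: the Taylor series of \<open>ln\<close> at the body. For
  elements involving \<open>m\<close> odd generators all terms of order above \<open>m\<close> vanish.
\<close>

definition gln :: "nat \<Rightarrow> grassmann \<Rightarrow> grassmann" where
  "gln m z = gconst (ln (body z))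
     + (\<Sum>k=1..m. gconst ((-1) ^ (k + 1) / real k) * (gconst (1 / body z) * (z - gconst (body z))) ^ k)"


section \<open>Functions on a superdomain\<close>

text \<open>
  Points of \<open>\<real>\<^sup>n\<close> are the points of \<^term>\<open>Euclidean_space n\<close>, that is, sequences vanishing from index
  \<open>n\<close> on. The algebra structure on \<open>superfun\<close> is the pointwise one. Coordinates of an
  \<open>n|m\<close>-dimensional superdomain are numbered by \<open>i < n + m\<close>, the even ones first.
  Only the values on the domain matter, so equality of functions over \<open>U\<close> is \<open>eq_on U\<close>.
\<close>

type_synonym superfun = "(nat \<Rightarrow> real) \<Rightarrow> grassmann"

definition eq_on :: "(nat \<Rightarrow> real) set \<Rightarrow> superfun \<Rightarrow> superfun \<Rightarrow> bool" where
  "eq_on U f g \<longleftrightarrow> (\<forall>x\<in>U. f x = g x)"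

definition par :: "nat \<Rightarrow> nat \<Rightarrow> nat" where
  "par n i = (if i < n then 0 else 1)"

definition coord :: "nat \<Rightarrow> nat \<Rightarrow> superfun" where
  "coord n i = (if i < n then (\<lambda>x. gconst (x i)) else (\<lambda>x. ggen (i - n)))"

definition const :: "real \<Rightarrow> superfun" where
  "const r = (\<lambda>x. gconst r)"

definition rpd :: "nat \<Rightarrow> ((nat \<Rightarrow> real) \<Rightarrow> real) \<Rightarrow> (nat \<Rightarrow> real) \<Rightarrow> real" where
  "rpd i g x = deriv (\<lambda>t. g (x(i := t))) (x i)"

definition smooth_fun :: "nat \<Rightarrow> (nat \<Rightarrow> real) set \<Rightarrow> ((nat \<Rightarrow> real) \<Rightarrow> real) \<Rightarrow> bool" where
  "smooth_fun n U g \<longleftrightarrow>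
     (\<forall>is. set is \<subseteq> {..<n} \<longrightarrow>
        continuous_on U (foldr rpd is g) \<and>
        (\<forall>i<n. \<forall>x\<in>U. (\<lambda>t. foldr rpd is g (x(i := t))) differentiable (at (x i))))"

definition SF :: "nat \<Rightarrow> nat \<Rightarrow> (nat \<Rightarrow> real) set \<Rightarrow> superfun set" where
  "SF n m U = {f. (\<forall>I. smooth_fun n U (\<lambda>x. coeff (f x) I)) \<and>
                  (\<forall>x\<in>U. \<forall>I. coeff (f x) I \<noteq> 0 \<longrightarrow> I \<subseteq> {..<m})}"

definition SF_hom :: "nat \<Rightarrow> nat \<Rightarrow> (nat \<Rightarrow> real) set \<Rightarrow> nat \<Rightarrow> superfun set" where
  "SF_hom n m U p = {f \<in> SF n m U. \<forall>x\<in>U. \<forall>I. coeff (f x) I \<noteq> 0 \<longrightarrow> even (card I + p)}"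

definition pd :: "nat \<Rightarrow> nat \<Rightarrow> superfun \<Rightarrow> superfun" where
  "pd n i f = (\<lambda>x. if i < n then Abs_grassmann (\<lambda>I. if finite I then rpd i (\<lambda>y. coeff (f y) I) x else 0)
                   else gderiv (i - n) (f x))"

text \<open>\<open>sgn_pow k f\<close> is \<open>(-1)\<^bsup>k f\<^esup> f\<close>, extended linearly from homogeneous \<open>f\<close>.\<close>

definition sgn_pow :: "nat \<Rightarrow> superfun \<Rightarrow> superfun" where
  "sgn_pow k f = (\<lambda>x. if even k then f x else ginv (f x))"

definition slog :: "nat \<Rightarrow> superfun \<Rightarrow> superfun" where
  "slog m f = (\<lambda>x. gln m (f x))"


section \<open>Supermanifolds\<close>

text \<open>
  A supermanifold is given by an atlas on its underlying space: the chart \<open>c\<close> has domain \<open>cdom M c\<close>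
  and body coordinates \<open>cmap M c\<close>, and \<open>trans M c d\<close> is the change of coordinates, taking the
  expression of a function in the chart \<open>d\<close> to its expression in the chart \<open>c\<close>.
\<close>

record ('a, 'c) smfd =
  space :: "'a topology"
  charts :: "'c set"
  cdom :: "'c \<Rightarrow> 'a set"
  cmap :: "'c \<Rightarrow> 'a \<Rightarrow> (nat \<Rightarrow> real)"
  trans :: "'c \<Rightarrow> 'c \<Rightarrow> superfun \<Rightarrow> superfun"

abbreviation cimg :: "('a, 'c) smfd \<Rightarrow> 'c \<Rightarrow> (nat \<Rightarrow> real) set" where
  "cimg M c \<equiv> cmap M c ` cdom M c"

abbreviation overlap :: "('a, 'c) smfd \<Rightarrow> 'c \<Rightarrow> 'c \<Rightarrow> (nat \<Rightarrow> real) set" where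
  "overlap M c d \<equiv> cmap M c ` (cdom M c \<inter> cdom M d)"

text \<open>
  A morphism of superdomains, as an even unital algebra homomorphism \<open>T\<close> from functions over \<open>V\<close> to
  functions over \<open>U\<close>.
\<close>

definition superalgebra_hom ::
  "nat \<Rightarrow> nat \<Rightarrow> (nat \<Rightarrow> real) set \<Rightarrow> (nat \<Rightarrow> real) set \<Rightarrow> (superfun \<Rightarrow> superfun) \<Rightarrow> bool" where
  "superalgebra_hom n m V U T \<longleftrightarrow>
     (\<forall>f\<in>SF n m V. T f \<in> SF n m U) \<and>
     (\<forall>p. \<forall>f\<in>SF_hom n m V p. T f \<in> SF_hom n m U p) \<and>
     (\<forall>f\<in>SF n m V. \<forall>g\<in>SF n m V. eq_on V f g \<longrightarrow> eq_on U (T f) (T g)) \<and>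
     (\<forall>r. eq_on U (T (const r)) (const r)) \<and>
     (\<forall>f\<in>SF n m V. \<forall>g\<in>SF n m V.
        eq_on U (T (f + g)) (T f + T g) \<and> eq_on U (T (f * g)) (T f * T g))"

definition supermanifold :: "nat \<Rightarrow> nat \<Rightarrow> ('a, 'c) smfd \<Rightarrow> bool" where
  "supermanifold n m M \<longleftrightarrow>
     Hausdorff_space (space M) \<and> second_countable (space M) \<and>
     (\<Union>c\<in>charts M. cdom M c) = topspace (space M) \<and>
     (\<forall>c\<in>charts M.
        openin (space M) (cdom M c) \<and> openin (Euclidean_space n) (cimg M c) \<and>
        homeomorphic_map (subtopology (space M) (cdom M c))
          (subtopology (Euclidean_space n) (cimg M c)) (cmap M c)) \<and>
     (\<forall>c\<in>charts M. \<forall>d\<in>charts M. \<forall>W. openin (space M) W \<and> W \<subseteq> cdom M c \<inter> cdom M d \<longrightarrow>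
        superalgebra_hom n m (cmap M d ` W) (cmap M c ` W) (trans M c d) \<and>
        (\<forall>f\<in>SF n m (cmap M d ` W). \<forall>w\<in>W.
           body (trans M c d f (cmap M c w)) = body (f (cmap M d w)))) \<and>
     (\<forall>c\<in>charts M. \<forall>W. openin (space M) W \<and> W \<subseteq> cdom M c \<longrightarrow>
        (\<forall>f\<in>SF n m (cmap M c ` W). eq_on (cmap M c ` W) (trans M c c f) f)) \<and>
     (\<forall>b\<in>charts M. \<forall>c\<in>charts M. \<forall>d\<in>charts M. \<forall>W.
        openin (space M) W \<and> W \<subseteq> cdom M b \<inter> cdom M c \<inter> cdom M d \<longrightarrow>
        (\<forall>f\<in>SF n m (cmap M d ` W).
           eq_on (cmap M b ` W) (trans M b c (trans M c d f)) (trans M b d f)))"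


section \<open>Odd Poisson brackets\<close>

text \<open>
  Stated for an algebra with homogeneous parts \<open>H p\<close>, constants \<open>cst\<close> and equality \<open>eq\<close>, so that it
  applies both to functions and to densities. Parities are natural numbers modulo 2.
\<close>

definition odd_poisson ::
  "('r::ring_1 \<Rightarrow> 'r \<Rightarrow> bool) \<Rightarrow> (real \<Rightarrow> 'r) \<Rightarrow> 'r set \<Rightarrow> (nat \<Rightarrow> 'r set) \<Rightarrow> ('r \<Rightarrow> 'r \<Rightarrow> 'r) \<Rightarrow> bool"
where
  "odd_poisson eq cst A H br \<longleftrightarrow>
     (\<forall>a\<in>A. \<forall>b\<in>A. \<forall>c\<in>A. \<forall>s t.
        eq (br (cst s * a + cst t * b) c) (cst s * br a c + cst t * br b c) \<and>
        eq (br c (cst s * a + cst t * b)) (cst s * br c a + cst t * br c b)) \<and>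
     (\<forall>p q. \<forall>a\<in>H p. \<forall>b\<in>H q. br a b \<in> H (p + q + 1)) \<and>
     (\<forall>p q. \<forall>a\<in>H p. \<forall>b\<in>H q. eq (br a b) (- ((-1) ^ ((p + 1) * (q + 1)) * br b a))) \<and>
     (\<forall>p q r. \<forall>a\<in>H p. \<forall>b\<in>H q. \<forall>c\<in>H r.
        eq (br a (br b c)) (br (br a b) c + (-1) ^ ((p + 1) * (q + 1)) * br b (br a c))) \<and>
     (\<forall>p q r. \<forall>a\<in>H p. \<forall>b\<in>H q. \<forall>c\<in>H r.
        eq (br a (b * c)) (br a b * c + (-1) ^ ((p + 1) * q) * (b * br a c)))"


section \<open>Master Hamiltonians and odd symplectic structures\<close>

text \<open>
  The cotangent bundle of an \<open>n|m\<close>-dimensional superdomain is a superdomain of dimension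
  \<open>2n|2m\<close>. Its even coordinates are the even \<open>x\<^sup>i\<close> followed by their momenta, its odd coordinates the
  odd \<open>x\<^sup>i\<close> followed by their momenta; \<open>xidx\<close> and \<open>pidx\<close> give the positions of \<open>x\<^sup>i\<close> and \<open>p\<^sub>i\<close>.
\<close>

definition xidx :: "nat \<Rightarrow> nat \<Rightarrow> nat" where
  "xidx n i = (if i < n then i else n + i)"

definition pidx :: "nat \<Rightarrow> nat \<Rightarrow> nat \<Rightarrow> nat" where
  "pidx n m i = (if i < n then n + i else n + m + i)"

definition mom :: "nat \<Rightarrow> nat \<Rightarrow> nat \<Rightarrow> superfun" where
  "mom n m i = coord (2 * n) (pidx n m i)"

text \<open>
  Pullback along the bundle projection. Odd coordinates keep their generators, so only the even
  momenta have to be dropped.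
\<close>

definition lift_T :: "nat \<Rightarrow> superfun \<Rightarrow> superfun" where
  "lift_T n f = (\<lambda>z. f (\<lambda>i. if i < n then z i else 0))"

text \<open>
  The canonical even Poisson bracket, normalised by \<open>(p\<^sub>i, x\<^sup>j) = \<delta>\<^sub>i\<^sup>j\<close>:
  \<open>(F, G) = (-1)\<^bsup>i (F + 1)\<^esup> \<partial>F/\<partial>p\<^sub>i \<partial>G/\<partial>x\<^sup>i - (-1)\<^bsup>i F\<^esup> \<partial>F/\<partial>x\<^sup>i \<partial>G/\<partial>p\<^sub>i\<close>.
\<close>

definition can_bracket_T :: "nat \<Rightarrow> nat \<Rightarrow> superfun \<Rightarrow> superfun \<Rightarrow> superfun" where
  "can_bracket_T n m F G =
     (\<Sum>i<n + m.
        (-1) ^ par n i * (pd (2 * n) (pidx n m i) (sgn_pow (par n i) F) * pd (2 * n) (xidx n i) G)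
        - pd (2 * n) (xidx n i) (sgn_pow (par n i) F) * pd (2 * n) (pidx n m i) G)"

definition hamiltonian :: "nat \<Rightarrow> nat \<Rightarrow> (nat \<Rightarrow> nat \<Rightarrow> superfun) \<Rightarrow> superfun" where
  "hamiltonian n m S = (\<Sum>i<n + m. \<Sum>j<n + m. lift_T n (S i j) * mom n m j * mom n m i)"

text \<open>
  The derived bracket \<open>((S, f), g)\<close>. It does not depend on the momenta and is read off on the zero
  section, which is \<open>\<real>\<^sup>n\<close> inside \<open>\<real>\<^bsup>2n\<^esup>\<close>. In coordinates it is
  \<open>2 S\<^bsup>ij\<^esup> \<partial>\<^sub>j f \<partial>\<^sub>i g (-1)\<^bsup>i f\<^esup>\<close>, so for even \<open>f\<close> half of the bracket of \<open>f\<close> with itself is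
  \<open>S\<^bsup>ij\<^esup> \<partial>\<^sub>i f \<partial>\<^sub>j f (-1)\<^bsup>ij\<^esup>\<close>.
\<close>

definition derived_bracket ::
  "nat \<Rightarrow> nat \<Rightarrow> (nat \<Rightarrow> nat \<Rightarrow> superfun) \<Rightarrow> superfun \<Rightarrow> superfun \<Rightarrow> superfun" where
  "derived_bracket n m S f g =
     (\<lambda>x. can_bracket_T n m (can_bracket_T n m (hamiltonian n m S) (lift_T n f)) (lift_T n g) x)"

text \<open>
  \<open>S c i j\<close> is the coefficient \<open>S\<^bsup>ij\<^esup>\<close> in the chart \<open>c\<close>. A Hamiltonian quadratic in the momenta is
  determined by its derived bracket, so naturality of the latter says that the local expressions
  \<open>S\<^bsup>ij\<^esup> p\<^sub>j p\<^sub>i\<close> define one function on the cotangent bundle.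
\<close>

definition odd_master_hamiltonian ::
  "nat \<Rightarrow> nat \<Rightarrow> ('a, 'c) smfd \<Rightarrow> ('c \<Rightarrow> nat \<Rightarrow> nat \<Rightarrow> superfun) \<Rightarrow> bool" where
  "odd_master_hamiltonian n m M S \<longleftrightarrow>
     (\<forall>c\<in>charts M. \<forall>i<n + m. \<forall>j<n + m.
        S c i j \<in> SF_hom n m (cimg M c) (par n i + par n j + 1) \<and>
        eq_on (cimg M c) (S c i j) ((-1) ^ (par n i * par n j) * S c j i)) \<and>
     (\<forall>c\<in>charts M. \<forall>d\<in>charts M.
        \<forall>f\<in>SF n m (overlap M d c). \<forall>g\<in>SF n m (overlap M d c).
          eq_on (overlap M c d)
            (trans M c d (derived_bracket n m (S d) f g))
            (derived_bracket n m (S c) (trans M c d f) (trans M c d g)))"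

definition nondegenerate ::
  "nat \<Rightarrow> nat \<Rightarrow> (nat \<Rightarrow> real) set \<Rightarrow> (nat \<Rightarrow> nat \<Rightarrow> superfun) \<Rightarrow> bool" where
  "nondegenerate n m U S \<longleftrightarrow>
     (\<exists>T. (\<forall>i<n + m. \<forall>j<n + m. T i j \<in> SF n m U) \<and>
          (\<forall>i<n + m. \<forall>k<n + m.
             eq_on U (\<Sum>j<n + m. S i j * T j k) (const (if i = k then 1 else 0)) \<and>
             eq_on U (\<Sum>j<n + m. T i j * S j k) (const (if i = k then 1 else 0))))"

definition odd_symplectic ::
  "nat \<Rightarrow> nat \<Rightarrow> ('a, 'c) smfd \<Rightarrow> ('c \<Rightarrow> nat \<Rightarrow> nat \<Rightarrow> superfun) \<Rightarrow> bool" where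
  "odd_symplectic n m M S \<longleftrightarrow>
     odd_master_hamiltonian n m M S \<and>
     (\<forall>c\<in>charts M.
        odd_poisson (eq_on (cimg M c)) const (SF n m (cimg M c)) (SF_hom n m (cimg M c))
          (\<lambda>f g. derived_bracket n m (S c) (sgn_pow 1 f) g) \<and>
        nondegenerate n m (cimg M c) (S c))"


section \<open>Projective classes\<close>

text \<open>
  \<open>\<Gamma> c k i j\<close> is \<open>\<Gamma>\<^sup>k\<^sub>i\<^sub>j\<close> in the chart \<open>c\<close>, where \<open>\<nabla>\<^sub>i \<partial>\<^sub>j = \<Gamma>\<^sup>k\<^sub>i\<^sub>j \<partial>\<^sub>k\<close>. With \<open>y\<close> the coordinates of
  the chart \<open>d\<close>, the transformation law expresses \<open>\<nabla>\<^sub>i\<close> of \<open>\<partial>\<^sub>j = (\<partial>\<^sub>j y\<^sup>b) \<partial>/\<partial>y\<^sup>b\<close> in two ways.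
\<close>

definition symmetric_connection ::
  "nat \<Rightarrow> nat \<Rightarrow> ('a, 'c) smfd \<Rightarrow> ('c \<Rightarrow> nat \<Rightarrow> nat \<Rightarrow> nat \<Rightarrow> superfun) \<Rightarrow> bool" where
  "symmetric_connection n m M \<Gamma> \<longleftrightarrow>
     (\<forall>c\<in>charts M. \<forall>i<n + m. \<forall>j<n + m. \<forall>k<n + m.
        \<Gamma> c k i j \<in> SF_hom n m (cimg M c) (par n i + par n j + par n k) \<and>
        eq_on (cimg M c) (\<Gamma> c k i j) ((-1) ^ (par n i * par n j) * \<Gamma> c k j i)) \<and>
     (\<forall>c\<in>charts M. \<forall>d\<in>charts M. \<forall>i<n + m. \<forall>j<n + m. \<forall>l<n + m.
        (let y = (\<lambda>a. trans M c d (coord n a)) in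
         eq_on (overlap M c d)
           (\<Sum>k<n + m. \<Gamma> c k i j * pd n k (y l))
           (pd n i (pd n j (y l)) +
            (\<Sum>a<n + m. \<Sum>b<n + m.
               (-1) ^ (par n i * (par n j + par n b)) *
               (pd n j (y b) * pd n i (y a) * trans M c d (\<Gamma> d l a b))))))"

definition trace_free_part ::
  "nat \<Rightarrow> nat \<Rightarrow> (nat \<Rightarrow> nat \<Rightarrow> nat \<Rightarrow> superfun) \<Rightarrow> nat \<Rightarrow> nat \<Rightarrow> nat \<Rightarrow> superfun" where
  "trace_free_part n m \<Gamma> k j i =
     \<Gamma> k j i - const (1 / (real n - real m + 1)) *
       ((\<Sum>s<n + m. (-1) ^ par n s * \<Gamma> s j s) * const (if i = k then 1 else 0) +
        (\<Sum>s<n + m. (-1) ^ (par n i * par n j + par n s) * \<Gamma> s i s) * const (if j = k then 1 else 0))"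

definition projective_class ::
  "nat \<Rightarrow> nat \<Rightarrow> ('a, 'c) smfd \<Rightarrow> ('c \<Rightarrow> nat \<Rightarrow> nat \<Rightarrow> nat \<Rightarrow> superfun) \<Rightarrow> bool" where
  "projective_class n m M P \<longleftrightarrow>
     (\<exists>\<Gamma>. symmetric_connection n m M \<Gamma> \<and>
        (\<forall>c\<in>charts M. \<forall>k<n + m. \<forall>j<n + m. \<forall>i<n + m.
           eq_on (cimg M c) (P c k j i) (trace_free_part n m (\<Gamma> c) k j i)))"

text \<open>\<open>P k i j\<close> stands for \<open>\<Pi>\<^sup>k\<^sub>i\<^sub>j\<close>.\<close>

definition proj_B ::
  "nat \<Rightarrow> nat \<Rightarrow> (nat \<Rightarrow> nat \<Rightarrow> nat \<Rightarrow> superfun) \<Rightarrow> nat \<Rightarrow> nat \<Rightarrow> superfun" where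
  "proj_B n m P k j =
     const ((real n - real m + 1) / (real n - real m - 1)) *
     (\<Sum>q<n + m. (-1) ^ (par n q * (1 + par n k + par n j)) *
        (pd n q (P q k j) + (\<Sum>p<n + m. P p q k * P q p j)))"


section \<open>The canonical bracket on densities\<close>

text \<open>
  A density over a coordinate domain is a finite sum of terms \<open>\<phi> |Dx|\<^sup>\<mu>\<close>, coded by its coefficients
  \<open>\<mu> \<mapsto> \<phi>\<close>; the ring structure on \<open>\<Rightarrow>\<^sub>0\<close> is the product of densities.
\<close>

type_synonym density = "real \<Rightarrow>\<^sub>0 superfun"

abbreviation lk :: "density \<Rightarrow> real \<Rightarrow> superfun" where
  "lk \<equiv> Poly_Mapping.lookup"

definition dens_eq :: "(nat \<Rightarrow> real) set \<Rightarrow> density \<Rightarrow> density \<Rightarrow> bool" where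
  "dens_eq U a b \<longleftrightarrow> (\<forall>\<mu>. eq_on U (lk a \<mu>) (lk b \<mu>))"

definition dens :: "nat \<Rightarrow> nat \<Rightarrow> (nat \<Rightarrow> real) set \<Rightarrow> density set" where
  "dens n m U = {a. \<forall>\<mu>. lk a \<mu> \<in> SF n m U}"

definition dens_hom :: "nat \<Rightarrow> nat \<Rightarrow> (nat \<Rightarrow> real) set \<Rightarrow> nat \<Rightarrow> density set" where
  "dens_hom n m U p = {a. \<forall>\<mu>. lk a \<mu> \<in> SF_hom n m U p}"

definition dens_gamma ::
  "nat \<Rightarrow> nat \<Rightarrow> (nat \<Rightarrow> nat \<Rightarrow> superfun) \<Rightarrow> (nat \<Rightarrow> nat \<Rightarrow> nat \<Rightarrow> superfun) \<Rightarrow> nat \<Rightarrow> superfun" where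
  "dens_gamma n m S P i =
     const ((real n - real m + 1) / (real n - real m + 3)) *
     ((\<Sum>j<n + m. pd n j (S j i)) + (\<Sum>j<n + m. \<Sum>k<n + m. S j k * P i k j))"

definition dens_theta ::
  "nat \<Rightarrow> nat \<Rightarrow> (nat \<Rightarrow> nat \<Rightarrow> superfun) \<Rightarrow> (nat \<Rightarrow> nat \<Rightarrow> nat \<Rightarrow> superfun) \<Rightarrow> superfun" where
  "dens_theta n m S P =
     const ((real n - real m + 1) / (real n - real m + 2)) *
     ((\<Sum>k<n + m. pd n k (dens_gamma n m S P k)) -
      (\<Sum>k<n + m. \<Sum>j<n + m. S k j * proj_B n m P j k))"

text \<open>
  The coefficient of \<open>{\<phi> |Dx|\<^sup>r, \<psi> |Dx|\<^sup>s}\<close> at \<open>|Dx|\<^bsup>r + s\<^esup>\<close> for the odd symmetric biderivation with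
  \<open>{x\<^sup>i, x\<^sup>j} = S\<^bsup>ij\<^esup>\<close>, \<open>{x\<^sup>i, |Dx|} = \<gamma>\<^sup>i |Dx|\<close> and \<open>{|Dx|, |Dx|} = \<theta> |Dx|\<^sup>2\<close>, where
  \<open>{a, |Dx|\<^sup>s} = s |Dx|\<^bsup>s-1\<^esup> {a, |Dx|}\<close>:
  \<open>S\<^bsup>ij\<^esup> \<partial>\<^sub>j\<phi> \<partial>\<^sub>i\<psi> (-1)\<^bsup>i \<phi>\<^esup> + (-1)\<^bsup>\<phi>\<^esup> r \<phi> \<gamma>\<^sup>i \<partial>\<^sub>i\<psi> + s \<gamma>\<^sup>i \<partial>\<^sub>i\<phi> \<psi> + (-1)\<^bsup>\<phi>\<^esup> r s \<phi> \<theta> \<psi>\<close>.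
\<close>

definition dens_coeff_bracket ::
  "nat \<Rightarrow> nat \<Rightarrow> (nat \<Rightarrow> nat \<Rightarrow> superfun) \<Rightarrow> (nat \<Rightarrow> superfun) \<Rightarrow> superfun \<Rightarrow>
   real \<Rightarrow> superfun \<Rightarrow> real \<Rightarrow> superfun \<Rightarrow> superfun" where
  "dens_coeff_bracket n m S \<gamma> \<theta> r \<phi> s \<psi> =
     (\<Sum>i<n + m. \<Sum>j<n + m. S i j * pd n j (sgn_pow (par n i) \<phi>) * pd n i \<psi>) +
     const r * (sgn_pow 1 \<phi> * (\<Sum>i<n + m. \<gamma> i * pd n i \<psi>)) +
     const s * ((\<Sum>i<n + m. \<gamma> i * pd n i \<phi>) * \<psi>) +
     const (r * s) * (sgn_pow 1 \<phi> * \<theta> * \<psi>)"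

definition dens_biderivation ::
  "nat \<Rightarrow> nat \<Rightarrow> (nat \<Rightarrow> nat \<Rightarrow> superfun) \<Rightarrow> (nat \<Rightarrow> superfun) \<Rightarrow> superfun \<Rightarrow>
   density \<Rightarrow> density \<Rightarrow> density" where
  "dens_biderivation n m S \<gamma> \<theta> a b =
     (\<Sum>r\<in>Poly_Mapping.keys a. \<Sum>s\<in>Poly_Mapping.keys b.
        Poly_Mapping.single (r + s) (dens_coeff_bracket n m S \<gamma> \<theta> r (lk a r) s (lk b s)))"

definition canonical_bracket ::
  "nat \<Rightarrow> nat \<Rightarrow> (nat \<Rightarrow> nat \<Rightarrow> superfun) \<Rightarrow> (nat \<Rightarrow> nat \<Rightarrow> nat \<Rightarrow> superfun) \<Rightarrow>
   density \<Rightarrow> density \<Rightarrow> density" where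
  "canonical_bracket n m S P =
     dens_biderivation n m S (dens_gamma n m S P) (dens_theta n m S P)"

definition dens_sgn :: "density \<Rightarrow> density" where
  "dens_sgn a = Poly_Mapping.map (sgn_pow 1) a"

text \<open>The bracket on densities is a local operation, so its identities are tested chart by chart.\<close>

definition canonical_bracket_is_odd_poisson ::
  "nat \<Rightarrow> nat \<Rightarrow> ('a, 'c) smfd \<Rightarrow> ('c \<Rightarrow> nat \<Rightarrow> nat \<Rightarrow> superfun) \<Rightarrow>
   ('c \<Rightarrow> nat \<Rightarrow> nat \<Rightarrow> nat \<Rightarrow> superfun) \<Rightarrow> bool" where
  "canonical_bracket_is_odd_poisson n m M S P \<longleftrightarrow>
     (\<forall>c\<in>charts M.
        odd_poisson (dens_eq (cimg M c)) (\<lambda>r. Poly_Mapping.single 0 (const r))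
          (dens n m (cimg M c)) (dens_hom n m (cimg M c))
          (\<lambda>a b. canonical_bracket n m (S c) (P c) (dens_sgn a) b))"

text \<open>The coefficient \<open>\<rho>\<close> of a volume form \<open>\<rho> |Dx|\<close> over a coordinate domain.\<close>

definition volume_form :: "nat \<Rightarrow> nat \<Rightarrow> (nat \<Rightarrow> real) set \<Rightarrow> superfun \<Rightarrow> bool" where
  "volume_form n m U \<rho> \<longleftrightarrow> \<rho> \<in> SF_hom n m U 0 \<and> (\<forall>x\<in>U. body (\<rho> x) > 0)"

end

theory Submission
  imports Defs "HOL-Computational_Algebra.Formal_Power_Series"
begin

text \<open>Modulo nilpotents the odd matrix \<open>S\<close> only pairs even with odd indices, so non-degeneracy forces
  \<open>n = m\<close> and none of the constants in the formulas is singular. Write \<open>\<gamma>\<^sup>i = - S\<^sup>i\<^sup>j A\<^sub>j\<close>. On densities of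
  weight \<open>r\<close> put \<open>\<nabla>\<^sub>i = \<partial>\<^sub>i - r A\<^sub>i\<close>; the canonical bracket is then \<open>S\<^sup>i\<^sup>j \<nabla>\<^sub>j f \<nabla>\<^sub>i g\<close>, up to signs, plus a
  term proportional to the weights of \<open>f\<close> and \<open>g\<close> and to an odd function \<open>\<Theta>\<close>, the difference of \<open>\<theta>\<close> and
  the square of \<open>A\<close> under \<open>S\<close>. Commutators of Hamiltonian vector fields are determined by their values on
  coordinates up to the curvature \<open>dA\<close>. As \<open>S\<close> is invertible, the Jacobi identity therefore holds if
  and only if \<open>dA = 0\<close> and \<open>\<Theta> = 0\<close>: it makes \<open>\<Theta>\<close> constant along the even and the odd coordinates, and an
  odd constant vanishes. By the Poincare lemma \<open>dA = 0\<close> means that locally \<open>A = d log \<rho>\<close>, and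
  the two displayed equations say that \<open>\<gamma>\<close> and \<open>\<theta>\<close> are the components belonging to such a \<open>\<rho>\<close>.\<close>

section \<open>Grassmann algebra\<close>

text \<open>Three kinds of triples carry the argument. On x^a, x^b, x^d the Jacobi identity is that
  of the given odd symplectic structure. On x^a, x^b, |Dx| it adds the curvature contracted twice
  with \<open>S\<close>, since covariant derivatives commute up to the weight times dA. On x^a,
  |Dx|, |Dx| it adds, once dA = 0, the derivative of \<Theta>, which enters with a product of
  weights and so is invisible to the first two kinds. Conversely, when dA = 0 and \<Theta> = 0 the
  coordinate triples suffice: in its last argument the Jacobiator is then a first order covariant
  operator, and graded symmetry brings every argument into the last place. The numerical factors
  come from n = m: (n-m+3)/(n-m+1) = 3 and (n-m+2)/(n-m+1) = 2 undo the 1/3 and 1/2 in \<gamma> and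
  \<theta>. The derived bracket is twice the coordinate bracket, so its Jacobi expression is four
  times the one studied here. Signs are computed in an abstract ring with true equality; equality
  over an open set becomes true equality by extending functions by zero.\<close>

lemmas coeff_simps [simp] = zero_grassmann.rep_eq one_grassmann.rep_eq plus_grassmann.rep_eq
  minus_grassmann.rep_eq uminus_grassmann.rep_eq gconst.rep_eq ggen.rep_eq ginv.rep_eq

lemma grassmann_eqI: "(\<And>I. finite I \<Longrightarrow> coeff a I = coeff b I) \<Longrightarrow> a = b"
proof (rule iffD1[OF coeff_inject], rule ext)
  fix I assume *: "\<And>I. finite I \<Longrightarrow> coeff a I = coeff b I"
  show "coeff a I = coeff b I"
    using * coeff[of a] coeff[of b] by (cases "finite I") auto
qed

lemma coeff_infinite: "infinite I \<Longrightarrow> coeff z I = 0"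
  using coeff[of z] by auto

lemma coeff_times:
  "finite I \<Longrightarrow> coeff (a * b) I = (\<Sum>J\<in>Pow I. shuffle_sign J (I - J) * coeff a J * coeff b (I - J))"
  by (simp add: times_grassmann.rep_eq)

lemma coeff_sum [simp]: "coeff (sum f X) I = (\<Sum>x\<in>X. coeff (f x) I)"
  by (induction X rule: infinite_finite_induct) auto

lemma coeff_neg1_times [simp]: "coeff ((-1) ^ k * z) I = (-1) ^ k * coeff z I"
  by (cases "even k") auto

lemma coeff_gconst_times [simp]: "coeff (gconst r * z) I = r * coeff z I"
proof (cases "finite I")
  case True
  have "(\<Sum>J\<in>Pow I. shuffle_sign J (I - J) * coeff (gconst r) J * coeff z (I - J))
      = (\<Sum>J\<in>Pow I. if J = {} then shuffle_sign J (I - J) * r * coeff z (I - J) else 0)"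
    by (intro sum.cong) auto
  also have "\<dots> = r * coeff z I"
    using True by (subst sum.delta) auto
  finally show ?thesis using True by (simp add: coeff_times)
qed (simp add: coeff_infinite)

lemma coeff_times_gconst [simp]: "coeff (z * gconst r) I = r * coeff z I"
proof (cases "finite I")
  case True
  have "(\<Sum>J\<in>Pow I. shuffle_sign J (I - J) * coeff z J * coeff (gconst r) (I - J))
      = (\<Sum>J\<in>Pow I. if J = I then shuffle_sign J (I - J) * coeff z J * r else 0)"
    by (intro sum.cong) auto
  also have "\<dots> = r * coeff z I"
    using True by (subst sum.delta) auto
  finally show ?thesis using True by (simp add: coeff_times)
qed (simp add: coeff_infinite)

lemma gconst_commute: "gconst r * z = z * gconst r"
  by (rule grassmann_eqI) simp

lemma gconst_add: "gconst (r + s) = gconst r + gconst s"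
  and gconst_mult: "gconst (r * s) = gconst r * gconst s"
  and gconst_0 [simp]: "gconst 0 = 0"
  and gconst_1 [simp]: "gconst 1 = 1"
  and gconst_uminus: "gconst (- r) = - gconst r"
  by (rule grassmann_eqI; simp)+

lemma gconst_sum: "gconst (sum f X) = (\<Sum>x\<in>X. gconst (f x))"
  by (induction X rule: infinite_finite_induct) (auto simp: gconst_add)

text \<open>For disjoint sets every pair in J x K is an inversion of exactly one of the two orders,
  so the two inversion counts add up to \<open>card J * card K\<close>.\<close>

lemma shuffle_sign_swap:
  assumes "finite J" "finite K" "J \<inter> K = {}"
  shows "shuffle_sign J K = (-1) ^ (card J * card K) * shuffle_sign K J"
proof -
  let ?A = "{(j, k). j \<in> J \<and> k \<in> K \<and> k < j}" and ?B = "{(j, k). j \<in> K \<and> k \<in> J \<and> k < j}"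
  have B: "card ?B = card {(j, k). j \<in> J \<and> k \<in> K \<and> j < k}"
    by (rule bij_betw_same_card[of "\<lambda>(a, b). (b, a)"]) (auto simp: bij_betw_def inj_on_def)
  have "J \<times> K = ?A \<union> {(j, k). j \<in> J \<and> k \<in> K \<and> j < k}"
    using assms(3) linorder_neqE_nat by fastforce
  moreover have "card (?A \<union> {(j, k). j \<in> J \<and> k \<in> K \<and> j < k})
      = card ?A + card {(j, k). j \<in> J \<and> k \<in> K \<and> j < k}"
    by (rule card_Un_disjoint)
      (auto intro: finite_inversions assms finite_subset[OF _ finite_cartesian_product[OF assms(1,2)]])
  ultimately have "card J * card K = card ?A + card ?B"
    using B by (metis card_cartesian_product)
  then show ?thesis
    unfolding shuffle_sign_def by (simp add: power_add flip: power_mult_distrib)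
qed

definition ghom :: "nat \<Rightarrow> grassmann set" where
  "ghom p = {z. \<forall>I. coeff z I \<noteq> 0 \<longrightarrow> even (card I + p)}"

text \<open>Complementing the summation index exchanges the two factors. The sign of
  \<open>shuffle_sign_swap\<close> has exponent \<open>card J * card (I - J)\<close>, which is
  congruent to p q modulo 2 wherever both coefficients are nonzero.\<close>

lemma ghom_commute:
  assumes "a \<in> ghom p" "b \<in> ghom q"
  shows "a * b = (-1) ^ (p * q) * (b * a)"
proof (rule grassmann_eqI)
  fix I :: "nat set" assume I: "finite I"
  let ?s = shuffle_sign
  have "coeff (b * a) I = (\<Sum>J\<in>Pow I. ?s (I - J) J * coeff b (I - J) * coeff a J)"
    unfolding coeff_times[OF I]
    by (rule sum.reindex_bij_witness[of _ "\<lambda>J. I - J" "\<lambda>J. I - J"]) (auto simp: double_diff)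
  also have "(-1) ^ (p * q) * \<dots> = (\<Sum>J\<in>Pow I. ?s J (I - J) * coeff a J * coeff b (I - J))"
    unfolding sum_distrib_left
  proof (rule sum.cong[OF refl])
    fix J assume J: "J \<in> Pow I"
    show "(-1) ^ (p * q) * (?s (I - J) J * coeff b (I - J) * coeff a J)
        = ?s J (I - J) * coeff a J * coeff b (I - J)"
    proof (cases "coeff a J = 0 \<or> coeff b (I - J) = 0")
      case False
      then have "even (card J + p)" "even (card (I - J) + q)"
        using assms by (auto simp: ghom_def)
      then have "even (card J * card (I - J) + p * q)" by auto
      then have "(-1::real) ^ (card J * card (I - J)) = (-1) ^ (p * q)"
        by (simp add: minus_one_power_iff)
      moreover have "?s J (I - J) = (-1) ^ (card J * card (I - J)) * ?s (I - J) J"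
        using I J by (intro shuffle_sign_swap) (auto dest: finite_subset)
      ultimately show ?thesis by simp
    qed auto
  qed
  finally show "coeff (a * b) I = coeff ((-1) ^ (p * q) * (b * a)) I"
    using I by (simp add: coeff_times)
qed

lemma ghom_times: 
  assumes "a \<in> ghom p" "b \<in> ghom q"
  shows "a * b \<in> ghom (p + q)"
  unfolding ghom_def
proof (intro CollectI allI impI)
  fix I assume nz: "coeff (a * b) I \<noteq> 0"
  then have I: "finite I" using coeff_infinite by blast
  with nz obtain J where J: "J \<subseteq> I" "coeff a J \<noteq> 0" "coeff b (I - J) \<noteq> 0"
    by (auto simp: coeff_times elim!: sum.not_neutral_contains_not_neutral)
  moreover have "card I = card J + card (I - J)"
    using I J(1) by (metis card_Diff_subset card_mono finite_subset le_add_diff_inverse)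
  ultimately show "even (card I + (p + q))"
    using assms by (auto simp: ghom_def)
qed

lemma coeff_times_support:
  assumes "\<And>I. coeff a I \<noteq> 0 \<Longrightarrow> I \<subseteq> X" "\<And>I. coeff b I \<noteq> 0 \<Longrightarrow> I \<subseteq> X" "coeff (a * b) I \<noteq> 0"
  shows "I \<subseteq> X"
proof -
  have I: "finite I" using coeff_infinite assms(3) by blast
  with assms(3) obtain J where J: "J \<subseteq> I" "coeff a J \<noteq> 0" "coeff b (I - J) \<noteq> 0"
    by (auto simp: coeff_times elim!: sum.not_neutral_contains_not_neutral)
  with assms(1,2) show ?thesis by blast
qed

lemma ghom_ginv: "z \<in> ghom p \<Longrightarrow> ginv z = (-1) ^ p * z"
  by (rule grassmann_eqI) (auto simp: ghom_def minus_one_power_iff)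

text \<open>Homogeneity as an eigenvalue condition for the grading involution. In this form it can
  be checked for a solution of a linear system, whose coefficients are not known explicitly.\<close>

lemma ginv_ghom:
  assumes "ginv z = (-1) ^ p * z"
  shows "z \<in> ghom p"
  unfolding ghom_def
proof (intro CollectI allI impI)
  fix I assume "coeff z I \<noteq> 0"
  moreover have "coeff (ginv z) I = coeff ((-1) ^ p * z) I" using assms by simp
  ultimately show "even (card I + p)" by (auto simp: minus_one_power_iff split: if_splits)
qed

lemma ginv_add: "ginv (a + b) = ginv a + ginv b"
  and ginv_ginv [simp]: "ginv (ginv a) = a"
  and ginv_0 [simp]: "ginv 0 = 0"
  and ginv_1 [simp]: "ginv 1 = 1"
  and ginv_gconst [simp]: "ginv (gconst r) = gconst r"
  by (rule grassmann_eqI; simp add: algebra_simps; simp flip: power_mult_distrib power_add)+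

lemma ginv_sum: "ginv (sum f X) = (\<Sum>x\<in>X. ginv (f x))"
  by (induction X rule: infinite_finite_induct) (auto simp: ginv_add)

lemma ginv_times: "ginv (a * b) = ginv a * ginv b"
proof (rule grassmann_eqI)
  fix I :: "nat set" assume I: "finite I"
  have "(-1) ^ card I = ((-1) ^ card J * (-1) ^ card (I - J) :: real)" if "J \<subseteq> I" for J
    using that I
    by (metis card_Diff_subset card_mono finite_subset le_add_diff_inverse power_add)
  then show "coeff (ginv (a * b)) I = coeff (ginv a * ginv b) I"
    using I by (auto simp: coeff_times sum_distrib_left intro!: sum.cong)
qed

section \<open>Left derivatives along the odd generators\<close>

lemma coeff_gderiv [simp]:
  "coeff (gderiv a z) I = (if a \<in> I then 0 else (-1) ^ card {b \<in> I. b < a} * coeff z (insert a I))"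
  by (simp add: gderiv.rep_eq)

lemma gderiv_0 [simp]: "gderiv v 0 = 0"
  and gderiv_gconst [simp]: "gderiv v (gconst r) = 0"
  by (rule grassmann_eqI; simp add: algebra_simps)+

lemma gderiv_ggen: "gderiv v (ggen w) = (if v = w then 1 else 0)"
proof (rule grassmann_eqI)
  fix I :: "nat set"
  have "insert v I = {w} \<longleftrightarrow> v = w \<and> I = {}" if "v \<notin> I" using that by auto
  then show "coeff (gderiv v (ggen w)) I = coeff (if v = w then 1 else 0) I" by auto
qed

lemma shuffle_sign_singleton_left: "shuffle_sign {a} K = (-1) ^ card {b \<in> K. b < a}"
proof -
  have "card {(j, k). j \<in> {a} \<and> k \<in> K \<and> k < j} = card {b \<in> K. b < a}"
    by (rule bij_betw_same_card[of snd]) (auto simp: bij_betw_def inj_on_def image_iff)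
  then show ?thesis by (simp add: shuffle_sign_def)
qed

lemma shuffle_sign_singleton_right:
  assumes "finite J" "a \<notin> J"
  shows "shuffle_sign J {a} = (-1) ^ card J * (-1) ^ card {b \<in> J. b < a}"
  using shuffle_sign_swap[of J "{a}"] assms by (simp add: shuffle_sign_singleton_left)

text \<open>If v lies in I the left side has no coefficient there, and on the right the subsets
  without v cancel those with v under J \<mapsto> \<open>insert v J\<close>. Otherwise the subsets
  of \<open>insert v I\<close> are split by whether they contain v: those with v give the first
  summand, those without it the second.\<close>

lemma gderiv_times: "gderiv v (a * b) = gderiv v a * b + ginv a * gderiv v b"
proof (rule grassmann_eqI)
  fix I :: "nat set" assume I: "finite I"
  let ?s = shuffle_sign and ?n = "\<lambda>K. (-1) ^ card {b \<in> K. b < v} :: real"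
  show "coeff (gderiv v (a * b)) I = coeff (gderiv v a * b + ginv a * gderiv v b) I"
  proof (cases "v \<in> I")
    case True
    then have "coeff (gderiv v a * b) I
        = (\<Sum>J\<in>Pow I. if v \<in> J then 0 else ?s J (I - J) * ?n J * coeff a (insert v J) * coeff b (I - J))"
      using I by (auto simp: coeff_times intro!: sum.cong)
    also have "\<dots> = (\<Sum>J\<in>{J\<in>Pow I. v \<notin> J}. ?s J (I - J) * ?n J * coeff a (insert v J) * coeff b (I - J))"
      using I by (subst sum.inter_filter) (auto intro!: sum.cong)
    also have "\<dots> = - (\<Sum>J\<in>{J\<in>Pow I. v \<in> J}. ?s J (I - J) * (-1) ^ card J * ?n (I - J) *
         coeff a J * coeff b (insert v (I - J)))"
      unfolding sum_negf[symmetric]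
    proof (rule sum.reindex_bij_witness[of _ "\<lambda>J. J - {v}" "insert v"])
      fix J assume "J \<in> {J \<in> Pow I. v \<notin> J}"
      then have J: "J \<subseteq> I" "v \<notin> J" "finite J" using I by (auto dest: finite_subset)
      let ?K = "I - insert v J"
      have IJ: "I - J = ?K \<union> {v}" using True J by auto
      have "{b \<in> insert v J. b < v} = {b \<in> J. b < v}" by auto
      moreover have "?s (insert v J) ?K = ?s {v} ?K * ?s J ?K"
        using shuffle_sign_Un_left[of "{v}" J ?K] J I by auto
      moreover have "?s J (I - J) = ?s J ?K * ?s J {v}"
        unfolding IJ by (rule shuffle_sign_Un_right) (use I J in auto)
      moreover have "card (insert v J) = Suc (card J)" using J by simp
      moreover have "insert v ?K = I - J" using IJ by auto
      moreover have "?n ?K = 1 \<or> ?n ?K = -1"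
        by (cases "even (card {b \<in> ?K. b < v})") auto
      ultimately show "- (?s (insert v J) ?K * (-1) ^ card (insert v J) * ?n ?K * coeff a (insert v J) *
          coeff b (insert v ?K)) = ?s J (I - J) * ?n J * coeff a (insert v J) * coeff b (I - J)"
        using J by (elim disjE) (simp_all add: shuffle_sign_singleton_left shuffle_sign_singleton_right)
    qed (use True in auto)
    also have "(\<Sum>J\<in>{J\<in>Pow I. v \<in> J}. ?s J (I - J) * (-1) ^ card J * ?n (I - J) *
         coeff a J * coeff b (insert v (I - J))) = (\<Sum>J\<in>Pow I. if v \<in> J then ?s J (I - J) * (-1) ^ card J * ?n (I - J) *
         coeff a J * coeff b (insert v (I - J)) else 0)"
      using I by (subst sum.inter_filter) auto
    also have "\<dots> = coeff (ginv a * gderiv v b) I"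
      using I True by (auto simp: coeff_times intro!: sum.cong)
    finally show ?thesis using True by simp
  next
    case False
    have split: "Pow (insert v I) = Pow I \<union> insert v ` Pow I" by (rule Pow_insert)
    have inj: "inj_on (insert v) (Pow I)" using False by (auto simp: inj_on_def)
    have "coeff (gderiv v (a * b)) I
        = ?n I * (\<Sum>J\<in>Pow (insert v I). ?s J (insert v I - J) * coeff a J * coeff b (insert v I - J))"
      using False I by (simp add: coeff_times)
    also have "\<dots> = ?n I * ((\<Sum>J\<in>Pow I. ?s J (insert v I - J) * coeff a J * coeff b (insert v I - J))
        + (\<Sum>J\<in>Pow I. ?s (insert v J) (insert v I - insert v J) * coeff a (insert v J) *
             coeff b (insert v I - insert v J)))"
      unfolding split using I False inj
      by (subst sum.union_disjoint) (auto simp: sum.reindex)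
    also have "\<dots> = coeff (ginv a * gderiv v b) I + coeff (gderiv v a * b) I"
      unfolding coeff_times[OF I] distrib_left sum_distrib_left
    proof (rule arg_cong2[where f = "(+)"]; rule sum.cong[OF refl])
      fix J assume "J \<in> Pow I"
      then have J: "J \<subseteq> I" "v \<notin> J" "finite J" using I False by (auto dest: finite_subset)
      let ?K = "I - J"
      have n: "?n I = ?n J * ?n ?K"
      proof -
        have "{b \<in> I. b < v} = {b \<in> J. b < v} \<union> {b \<in> ?K. b < v}" using J by auto
        moreover have "card ({b \<in> J. b < v} \<union> {b \<in> ?K. b < v}) = card {b \<in> J. b < v} + card {b \<in> ?K. b < v}"
          using I J by (intro card_Un_disjoint) auto
        ultimately show ?thesis by (simp add: power_add)
      qed
      have pm: "?n X = 1 \<or> ?n X = -1" for X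
        by (cases "even (card {b \<in> X. b < v})") auto
      have K: "insert v I - J = ?K \<union> {v}" "insert v I - insert v J = ?K" "v \<notin> ?K" "insert v ?K = ?K \<union> {v}"
        using J False by auto
      have s1: "?s J (?K \<union> {v}) = ?s J ?K * ?s J {v}"
        by (rule shuffle_sign_Un_right) (use I J False in auto)
      have s2: "?s (insert v J) ?K = ?s {v} ?K * ?s J ?K"
        using shuffle_sign_Un_left[of "{v}" J ?K] J I by auto
      show "?n I * (?s J (insert v I - J) * coeff a J * coeff b (insert v I - J))
          = ?s J ?K * coeff (ginv a) J * coeff (gderiv v b) ?K"
        using J K(3) pm[of J] pm[of ?K] unfolding K(1) s1 n
        by (elim disjE) (simp_all add: shuffle_sign_singleton_right)
      show "?n I * (?s (insert v J) (insert v I - insert v J) * coeff a (insert v J) *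
             coeff b (insert v I - insert v J)) = ?s J ?K * coeff (gderiv v a) J * coeff b ?K"
        using J pm[of J] pm[of ?K] unfolding K(2) s2 n
        by (elim disjE) (simp_all add: shuffle_sign_singleton_left)
    qed
    finally show ?thesis by simp
  qed
qed

text \<open>Inserting v changes the number of indices below w exactly when v < w, so just one of the
  two orders of differentiation acquires an extra sign.\<close>

lemma gderiv_gderiv: "gderiv a (gderiv b z) = - gderiv b (gderiv a z)"
proof (rule grassmann_eqI)
  fix I :: "nat set" assume I: "finite I"
  have "(-1::real) ^ card {c \<in> insert v I. c < w} = (if v < w then -1 else 1) * (-1) ^ card {c \<in> I. c < w}"
    if "v \<notin> I" for v w
  proof (cases "v < w")
    case True
    then have "{c \<in> insert v I. c < w} = insert v {c \<in> I. c < w}" by auto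
    then show ?thesis using that True I by simp
  next
    case False
    then have "{c \<in> insert v I. c < w} = {c \<in> I. c < w}" by auto
    then show ?thesis using False by simp
  qed
  then show "coeff (gderiv a (gderiv b z)) I = coeff (- gderiv b (gderiv a z)) I"
    by (cases "a = b") (auto simp: insert_commute)
qed

lemma gderiv_ginv: "gderiv a (ginv z) = - ginv (gderiv a z)"
  by (rule grassmann_eqI) (auto dest: coeff_infinite)

section \<open>Calculus on coordinate domains\<close>

text \<open>Smoothness counted by the number of derivatives taken. The quantification over lists in
  \<open>smooth_fun\<close> gives no usable induction for products and compositions; peeling off the
  innermost derivative does.\<close>

fun smooth_upto :: "nat \<Rightarrow> (nat \<Rightarrow> real) set \<Rightarrow> nat \<Rightarrow> ((nat \<Rightarrow> real) \<Rightarrow> real) \<Rightarrow> bool" where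
  "smooth_upto n U 0 g \<longleftrightarrow> continuous_on U g \<and>
     (\<forall>i<n. \<forall>x\<in>U. (\<lambda>t. g (x(i := t))) differentiable (at (x i)))"
| "smooth_upto n U (Suc k) g \<longleftrightarrow> smooth_upto n U 0 g \<and> (\<forall>i<n. smooth_upto n U k (rpd i g))"

lemma smooth_upto_iff:
  "smooth_upto n U k g \<longleftrightarrow>
     (\<forall>is. set is \<subseteq> {..<n} \<and> length is \<le> k \<longrightarrow> smooth_upto n U 0 (foldr rpd is g))"
proof (induction k arbitrary: g)
  case (Suc k)
  show ?case
  proof
    assume L: "smooth_upto n U (Suc k) g"
    show "\<forall>is. set is \<subseteq> {..<n} \<and> length is \<le> Suc k \<longrightarrow> smooth_upto n U 0 (foldr rpd is g)"
    proof (intro allI impI)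
      fix "is" assume "set is \<subseteq> {..<n} \<and> length is \<le> Suc k"
      then show "smooth_upto n U 0 (foldr rpd is g)"
        \<comment> \<open>\<open>foldr\<close> applies the last entry of the list first, hence the
          split at the end of the list.\<close>
        using L Suc.IH by (cases "is" rule: rev_cases) (auto simp del: smooth_upto.simps(1))
    qed
  next
    assume R: "\<forall>is. set is \<subseteq> {..<n} \<and> length is \<le> Suc k \<longrightarrow> smooth_upto n U 0 (foldr rpd is g)"
    have "smooth_upto n U k (rpd i g)" if "i < n" for i
      unfolding Suc.IH
    proof (intro allI impI)
      fix "is" assume "set is \<subseteq> {..<n} \<and> length is \<le> k"
      then show "smooth_upto n U 0 (foldr rpd is (rpd i g))"
        using R[rule_format, of "is @ [i]"] that by simp
    qed
    then show "smooth_upto n U (Suc k) g"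
      using R[rule_format, of "[]"] by simp
  qed
qed auto

lemma smooth_fun_iff: "smooth_fun n U g \<longleftrightarrow> (\<forall>k. smooth_upto n U k g)"
proof -
  have "smooth_fun n U g \<longleftrightarrow> (\<forall>is. set is \<subseteq> {..<n} \<longrightarrow> smooth_upto n U 0 (foldr rpd is g))"
    by (simp add: smooth_fun_def)
  also have "\<dots> \<longleftrightarrow> (\<forall>k. smooth_upto n U k g)"
    by (subst smooth_upto_iff) blast
  finally show ?thesis .
qed

lemma smooth_upto_0: "smooth_upto n U k g \<Longrightarrow> smooth_upto n U 0 g"
  by (cases k) auto

lemma smooth_upto_Suc_mono: "smooth_upto n U (Suc k) g \<Longrightarrow> smooth_upto n U k g"
  by (induction k arbitrary: g) auto

lemma smooth_fun_rpd: "smooth_fun n U g \<Longrightarrow> i < n \<Longrightarrow> smooth_fun n U (rpd i g)"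
proof -
  assume "smooth_fun n U g" "i < n"
  then have "smooth_upto n U (Suc k) g" for k by (simp only: smooth_fun_iff)
  with \<open>i < n\<close> show ?thesis by (simp add: smooth_fun_iff)
qed

lemma smooth_funI:
  assumes "continuous_on U g"
    and "\<And>i x. i < n \<Longrightarrow> x \<in> U \<Longrightarrow> (\<lambda>t. g (x(i := t))) differentiable (at (x i))"
    and "\<And>i. i < n \<Longrightarrow> smooth_fun n U (rpd i g)"
  shows "smooth_fun n U g"
  unfolding smooth_fun_iff
proof
  fix k show "smooth_upto n U k g"
    using assms by (cases k) (auto simp: smooth_fun_iff)
qed

lemma smooth_fun_continuous: "smooth_fun n U g \<Longrightarrow> continuous_on U g"
  and smooth_fun_differentiable:
    "smooth_fun n U g \<Longrightarrow> i < n \<Longrightarrow> x \<in> U \<Longrightarrow> (\<lambda>t. g (x(i := t))) differentiable (at (x i))"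
  unfolding smooth_fun_def by (auto dest: spec[of _ "[]"])

lemma smooth_fun_subset: "smooth_fun n U g \<Longrightarrow> V \<subseteq> U \<Longrightarrow> smooth_fun n V g"
  unfolding smooth_fun_def by (meson continuous_on_subset subsetD)

lemma has_rpd:
  assumes "smooth_fun n U g" "i < n" "x(i := s) \<in> U"
  shows "((\<lambda>t. g (x(i := t))) has_real_derivative rpd i g (x(i := s))) (at s)"
  using smooth_fun_differentiable[OF assms] 
  by (simp add: rpd_def DERIV_deriv_iff_real_differentiable)

lemma rpd_eqI:
  "((\<lambda>t. g (x(i := t))) has_real_derivative d) (at (x i)) \<Longrightarrow> rpd i g x = d"
  unfolding rpd_def by (rule DERIV_imp_deriv)

lemma continuous_on_fun_upd [continuous_intros]:
  fixes f :: "'a::topological_space \<Rightarrow> 'b \<Rightarrow> real"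
  assumes "continuous_on X f" "continuous_on X g"
  shows "continuous_on X (\<lambda>x. (f x)(i := g x))"
proof (rule continuous_on_coordinatewise_then_product)
  fix j
  show "continuous_on X (\<lambda>x. ((f x)(i := g x)) j)"
    using assms by (cases "j = i") (auto intro: continuous_on_product_then_coordinatewise)
qed

section \<open>Open subsets of Euclidean space and functions on them\<close>

locale euclidean_domain =
  fixes n :: nat and U :: "(nat \<Rightarrow> real) set"
  assumes openin_U: "openin (Euclidean_space n) U"
begin

lemma U_support: "x \<in> U \<Longrightarrow> n \<le> i \<Longrightarrow> x i = 0"
  using openin_subset[OF openin_U] by (auto simp: topspace_Euclidean_space)

lemma U_open_ex: "\<exists>W. open W \<and> U = W \<inter> {x. \<forall>i\<ge>n. x i = 0}"
  using openin_U by (simp add: Euclidean_space_def openin_subtopology euclidean_product_topology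
      flip: open_openin)

text \<open>U is open only inside the subspace of sequences vanishing from n on. Changing a
  coordinate below n stays in that subspace, which is why partial derivatives on U depend only on
  the values on U.\<close>

lemma eventually_fun_upd:
  assumes "x \<in> U" "i < n"
  shows "\<forall>\<^sub>F t in nhds (x i). x(i := t) \<in> U"
proof -
  obtain W where W: "open W" "U = W \<inter> {x. \<forall>i\<ge>n. x i = 0}" using U_open_ex by blast
  have "open ((\<lambda>t. x(i := t)) -` W)"
    by (rule open_vimage[OF W(1)]) (intro continuous_intros)
  moreover have "x i \<in> (\<lambda>t. x(i := t)) -` W" using assms W by simp
  ultimately have "\<forall>\<^sub>F t in nhds (x i). x(i := t) \<in> W"
    by (auto simp: eventually_nhds)
  then show ?thesis
    by eventually_elim (use assms W in auto)
qed

lemma eventually_fun_upd_eq: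
  assumes "\<And>x. x \<in> U \<Longrightarrow> f x = g x" "x \<in> U" "i < n"
  shows "\<forall>\<^sub>F t in nhds (x i). f (x(i := t)) = g (x(i := t))"
  using eventually_fun_upd[OF assms(2,3)] by eventually_elim (rule assms(1))

lemma rpd_cong:
  "(\<And>x. x \<in> U \<Longrightarrow> f x = g x) \<Longrightarrow> x \<in> U \<Longrightarrow> i < n \<Longrightarrow> rpd i f x = rpd i g x"
  unfolding rpd_def by (rule deriv_cong_ev) (auto intro: eventually_fun_upd_eq)

lemma smooth_upto_0_cong:
  assumes "\<And>x. x \<in> U \<Longrightarrow> f x = g x"
  shows "smooth_upto n U 0 f \<longleftrightarrow> smooth_upto n U 0 g"
proof -
  have "(\<lambda>t. f (x(i := t))) differentiable at (x i) \<longleftrightarrow> (\<lambda>t. g (x(i := t))) differentiable at (x i)"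
    if "x \<in> U" "i < n" for x i
  proof -
    have "\<forall>\<^sub>F t in nhds (x i). f (x(i := t)) = g (x(i := t))"
      by (rule eventually_fun_upd_eq) (use assms that in auto)
    then show ?thesis
      unfolding real_differentiable_def by (simp add: DERIV_cong_ev[OF refl _ refl])
  qed
  moreover have "continuous_on U f \<longleftrightarrow> continuous_on U g"
    using assms by (rule continuous_on_cong[OF refl])
  ultimately show ?thesis by simp
qed

lemma smooth_upto_cong:
  "(\<And>x. x \<in> U \<Longrightarrow> f x = g x) \<Longrightarrow> smooth_upto n U k f \<longleftrightarrow> smooth_upto n U k g"
proof (induction k arbitrary: f g)
  case (0 f g)
  show ?case using 0 by (rule smooth_upto_0_cong)
next
  case (Suc k)
  have "smooth_upto n U k (rpd i f) \<longleftrightarrow> smooth_upto n U k (rpd i g)" if "i < n" for i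
    using rpd_cong[OF Suc.prems _ that] by (rule Suc.IH)
  moreover have "smooth_upto n U 0 f \<longleftrightarrow> smooth_upto n U 0 g"
    using Suc.prems by (rule smooth_upto_0_cong)
  ultimately show ?case by auto
qed

lemma smooth_fun_cong: "(\<And>x. x \<in> U \<Longrightarrow> f x = g x) \<Longrightarrow> smooth_fun n U f \<longleftrightarrow> smooth_fun n U g"
  unfolding smooth_fun_iff using smooth_upto_cong by blast

section \<open>Closure properties of smooth functions\<close>

lemma rpd_const: "rpd i (\<lambda>_. c) x = 0"
  by (simp add: rpd_def)

lemma smooth_upto_const: "smooth_upto n U k (\<lambda>_. c)"
proof (induction k arbitrary: c)
  case (Suc k)
  have "rpd i (\<lambda>_. c) = (\<lambda>_. 0)" for i by (simp add: rpd_const fun_eq_iff)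
  then show ?case using Suc by simp
qed simp

lemma smooth_upto_coord: "smooth_upto n U k (\<lambda>x. x j)"
proof -
  have *: "((\<lambda>t. (x(i := t)) j) has_real_derivative (if i = j then 1 else 0)) (at (x i))" for x i
    by (cases "i = j") auto
  have "rpd i (\<lambda>x. x j) = (\<lambda>_. if i = j then 1 else 0)" for i
    by (rule ext, rule rpd_eqI, rule *)
  moreover have "smooth_upto n U 0 (\<lambda>x. x j)"
    using * by (auto simp: real_differentiable_def simp del: fun_upd_apply
        intro!: continuous_on_subset[OF continuous_on_product_coordinates])
  ultimately show ?thesis
    using smooth_upto_const by (cases k) auto
qed

lemma has_rpd_0:
  assumes "smooth_upto n U k g" "i < n" "x \<in> U"
  shows "((\<lambda>t. g (x(i := t))) has_real_derivative rpd i g x) (at (x i))"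
  using smooth_upto_0[OF assms(1)] assms(2,3)
  by (simp add: rpd_def DERIV_deriv_iff_real_differentiable)

lemma smooth_upto_0_add:
  "smooth_upto n U 0 f \<Longrightarrow> smooth_upto n U 0 g \<Longrightarrow> smooth_upto n U 0 (\<lambda>x. f x + g x)"
  by (auto intro!: continuous_intros differentiable_add)

lemma smooth_upto_add:
  "smooth_upto n U k f \<Longrightarrow> smooth_upto n U k g \<Longrightarrow> smooth_upto n U k (\<lambda>x. f x + g x)"
proof (induction k arbitrary: f g)
  case 0
  then show ?case by (rule smooth_upto_0_add)
next
  case (Suc k)
  have "rpd i (\<lambda>x. f x + g x) x = rpd i f x + rpd i g x" if "i < n" "x \<in> U" for i x
    by (rule rpd_eqI, rule DERIV_add[OF has_rpd_0[OF Suc.prems(1) that] has_rpd_0[OF Suc.prems(2) that]])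
  then have "smooth_upto n U k (rpd i (\<lambda>x. f x + g x))" if "i < n" for i
    using Suc that smooth_upto_cong[of "rpd i (\<lambda>x. f x + g x)" "\<lambda>x. rpd i f x + rpd i g x"] by auto
  moreover have "smooth_upto n U 0 (\<lambda>x. f x + g x)"
    using Suc.prems by (intro smooth_upto_0_add) auto
  ultimately show ?case by simp
qed

lemma smooth_upto_0_mult:
  "smooth_upto n U 0 f \<Longrightarrow> smooth_upto n U 0 g \<Longrightarrow> smooth_upto n U 0 (\<lambda>x. f x * g x)"
  by (auto intro!: continuous_intros differentiable_mult)

lemma smooth_upto_mult:
  "smooth_upto n U k f \<Longrightarrow> smooth_upto n U k g \<Longrightarrow> smooth_upto n U k (\<lambda>x. f x * g x)"
proof (induction k arbitrary: f g)
  case 0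
  then show ?case by (rule smooth_upto_0_mult)
next
  case (Suc k)
  have "rpd i (\<lambda>x. f x * g x) x = f x * rpd i g x + rpd i f x * g x" if "i < n" "x \<in> U" for i x
  proof (rule rpd_eqI)
    show "((\<lambda>t. f (x(i := t)) * g (x(i := t))) has_real_derivative f x * rpd i g x + rpd i f x * g x) (at (x i))"
      using DERIV_mult'[OF has_rpd_0[OF Suc.prems(1) that] has_rpd_0[OF Suc.prems(2) that]]
      by (simp only: fun_upd_triv)
  qed
  then have "smooth_upto n U k (rpd i (\<lambda>x. f x * g x))
      \<longleftrightarrow> smooth_upto n U k (\<lambda>x. f x * rpd i g x + rpd i f x * g x)" if "i < n" for i
    using that by (intro smooth_upto_cong) auto
  moreover have "smooth_upto n U k (\<lambda>x. f x * rpd i g x + rpd i f x * g x)" if "i < n" for i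
    using that Suc.prems smooth_upto_Suc_mono[OF Suc.prems(1)] smooth_upto_Suc_mono[OF Suc.prems(2)]
    by (intro smooth_upto_add Suc.IH) auto
  ultimately show ?case
    using smooth_upto_0_mult[of f g] Suc.prems by simp
qed

lemma has_rpd_compose:
  assumes "(h has_real_derivative d) (at (g x))"
    and "((\<lambda>t. g (x(i := t))) has_real_derivative d') (at (x i))"
  shows "((\<lambda>t. h (g (x(i := t)))) has_real_derivative d * d') (at (x i))"
  by (rule DERIV_chain2[of h d "\<lambda>t. g (x(i := t))" "x i", OF _ assms(2)])
    (simp only: fun_upd_triv assms(1))

text \<open>The assumption \<open>F\<close> asks that h' be built from h by operations already known
  to preserve smoothness, as for exp' = exp and for the derivative -(inverse)^2 of the inverse. The
  induction then closes on the order k without a separate statement about h'.\<close>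

lemma smooth_upto_compose:
  assumes F: "\<And>g k. smooth_upto n U k g \<Longrightarrow> (\<And>x. x \<in> U \<Longrightarrow> P (g x)) \<Longrightarrow>
      smooth_upto n U k (\<lambda>x. h (g x)) \<Longrightarrow> smooth_upto n U k (\<lambda>x. h' (g x))"
    and h: "\<And>y. P y \<Longrightarrow> (h has_real_derivative h' y) (at y)"
    and g: "smooth_upto n U k g" "\<And>x. x \<in> U \<Longrightarrow> P (g x)"
  shows "smooth_upto n U k (\<lambda>x. h (g x))"
  using g
proof (induction k)
  case 0
  have "continuous_on U (\<lambda>x. h (g x))"
    by (rule continuous_on_compose2[of "{y. P y}" h])
      (use 0 h in \<open>auto intro!: DERIV_isCont continuous_at_imp_continuous_on\<close>)
  moreover have "(\<lambda>t. h (g (x(i := t)))) differentiable at (x i)" if "i < n" "x \<in> U" for i x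
    using has_rpd_compose[OF h[OF 0(2)[OF that(2)]] has_rpd_0[OF 0(1) that]]
    by (auto simp only: real_differentiable_def)
  ultimately show ?case by simp
next
  case (Suc k)
  have k: "smooth_upto n U k g" using Suc.prems smooth_upto_Suc_mono by blast
  have "rpd i (\<lambda>x. h (g x)) x = h' (g x) * rpd i g x" if "i < n" "x \<in> U" for i x
    by (rule rpd_eqI, rule has_rpd_compose[OF h[OF Suc.prems(2)[OF that(2)]] has_rpd_0[OF Suc.prems(1) that]])
  then have "smooth_upto n U k (rpd i (\<lambda>x. h (g x))) \<longleftrightarrow> smooth_upto n U k (\<lambda>x. h' (g x) * rpd i g x)"
    if "i < n" for i
    using that by (intro smooth_upto_cong) auto
  moreover have "smooth_upto n U k (\<lambda>x. h' (g x) * rpd i g x)" if "i < n" for i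
    by (intro smooth_upto_mult F k Suc.IH) (use Suc.prems that in auto)
  moreover have "smooth_upto n U 0 (\<lambda>x. h (g x))"
    using Suc.IH[OF k Suc.prems(2)] by (rule smooth_upto_0)
  ultimately show ?case by simp
qed

lemma smooth_fun_const: "smooth_fun n U (\<lambda>_. c)"
  and smooth_fun_coord: "smooth_fun n U (\<lambda>x. x j)"
  and smooth_fun_add: "smooth_fun n U f \<Longrightarrow> smooth_fun n U g \<Longrightarrow> smooth_fun n U (\<lambda>x. f x + g x)"
  and smooth_fun_mult: "smooth_fun n U f \<Longrightarrow> smooth_fun n U g \<Longrightarrow> smooth_fun n U (\<lambda>x. f x * g x)"
  by (simp_all add: smooth_fun_iff smooth_upto_const smooth_upto_coord smooth_upto_add smooth_upto_mult)

lemma smooth_fun_cmult: "smooth_fun n U f \<Longrightarrow> smooth_fun n U (\<lambda>x. c * f x)"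
  by (intro smooth_fun_mult smooth_fun_const)

lemma smooth_fun_minus: "smooth_fun n U f \<Longrightarrow> smooth_fun n U (\<lambda>x. - f x)"
  using smooth_fun_cmult[of f "-1"] by simp

lemma smooth_fun_sum:
  "(\<And>a. a \<in> X \<Longrightarrow> smooth_fun n U (f a)) \<Longrightarrow> smooth_fun n U (\<lambda>x. \<Sum>a\<in>X. f a x)"
  by (induction X rule: infinite_finite_induct) (auto intro: smooth_fun_const smooth_fun_add)

lemma smooth_fun_exp: "smooth_fun n U g \<Longrightarrow> smooth_fun n U (\<lambda>x. exp (g x))"
  unfolding smooth_fun_iff
  using smooth_upto_compose[of "\<lambda>_. True" exp exp] by (auto intro: DERIV_exp)

lemma smooth_fun_inverse:
  assumes "smooth_fun n U g" "\<And>x. x \<in> U \<Longrightarrow> g x \<noteq> 0"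
  shows "smooth_fun n U (\<lambda>x. inverse (g x))"
  unfolding smooth_fun_iff
proof
  fix k
  have *: "smooth_upto n U j (\<lambda>x. - (h x * h x))" if "smooth_upto n U j h" for j h
    using smooth_upto_mult[OF smooth_upto_const[of j "-1"] smooth_upto_mult[OF that that]] by simp
  show "smooth_upto n U k (\<lambda>x. inverse (g x))"
  proof (rule smooth_upto_compose[of "\<lambda>y. y \<noteq> 0" inverse "\<lambda>y. - (inverse y * inverse y)"])
    show "(inverse has_real_derivative - (inverse y * inverse y)) (at y)" if "y \<noteq> 0" for y :: real
      using DERIV_inverse[OF that] by (simp add: power2_eq_square power_Suc)
  qed (use assms * in \<open>auto simp: smooth_fun_iff\<close>)
qed

lemma smooth_fun_ln:
  assumes "smooth_fun n U g" "\<And>x. x \<in> U \<Longrightarrow> g x > 0"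
  shows "smooth_fun n U (\<lambda>x. ln (g x))"
proof (rule smooth_funI)
  have 1: "((\<lambda>t. ln (g (x(i := t)))) has_real_derivative inverse (g x) * rpd i g x) (at (x i))"
    if "i < n" "x \<in> U" for i x
    by (rule has_rpd_compose[where h = ln and g = g, OF DERIV_ln[OF assms(2)[OF that(2)]]])
      (use assms(1) that in \<open>auto intro: has_rpd_0 simp: smooth_fun_iff\<close>)
  then show "(\<lambda>t. ln (g (x(i := t)))) differentiable (at (x i))" if "i < n" "x \<in> U" for i x
    using that real_differentiable_def by blast
  show "smooth_fun n U (rpd i (\<lambda>x. ln (g x)))" if "i < n" for i
  proof -
    have "smooth_fun n U (rpd i (\<lambda>x. ln (g x))) \<longleftrightarrow> smooth_fun n U (\<lambda>x. inverse (g x) * rpd i g x)"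
      by (rule smooth_fun_cong, rule rpd_eqI, rule 1[OF that])
    moreover have "smooth_fun n U (\<lambda>x. inverse (g x) * rpd i g x)"
      using assms that by (intro smooth_fun_mult smooth_fun_inverse smooth_fun_rpd) (auto simp: less_imp_neq[THEN not_sym])
    ultimately show ?thesis by simp
  qed
  show "continuous_on U (\<lambda>x. ln (g x))"
    using assms smooth_fun_continuous by (intro continuous_on_ln) (auto simp: less_imp_neq[THEN not_sym])
qed

lemma rpd_add: "smooth_fun n U f \<Longrightarrow> smooth_fun n U g \<Longrightarrow> i < n \<Longrightarrow> x \<in> U \<Longrightarrow>
    rpd i (\<lambda>x. f x + g x) x = rpd i f x + rpd i g x"
  using has_rpd[of n U _ i x "x i"] by (auto intro!: rpd_eqI DERIV_add)

lemma rpd_cmult: "smooth_fun n U f \<Longrightarrow> i < n \<Longrightarrow> x \<in> U \<Longrightarrow> rpd i (\<lambda>x. c * f x) x = c * rpd i f x"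
  using has_rpd[of n U _ i x "x i"] by (auto intro!: rpd_eqI DERIV_cmult)

end

section \<open>Symmetry of second derivatives\<close>

lemma (in euclidean_domain) fun_upd_upd_in_U:
  assumes "x \<in> U" "i < n" "j < n"
  obtains d where "d > 0"
    "\<And>s t. \<bar>s - x i\<bar> < d \<Longrightarrow> \<bar>t - x j\<bar> < d \<Longrightarrow> x(i := s, j := t) \<in> U"
proof -
  obtain W where W: "open W" "U = W \<inter> {x. \<forall>i\<ge>n. x i = 0}" using U_open_ex by blast
  have "open ((\<lambda>p. x(i := fst p, j := snd p)) -` W)"
    by (rule open_vimage[OF W(1)]) (intro continuous_intros)
  moreover have "(x i, x j) \<in> (\<lambda>p. x(i := fst p, j := snd p)) -` W" using assms W by simp
  ultimately obtain A B where AB: "open A" "open B" "x i \<in> A" "x j \<in> B"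
    "A \<times> B \<subseteq> (\<lambda>p. x(i := fst p, j := snd p)) -` W"
    by (auto elim!: open_prod_elim)
  obtain d1 where d1: "d1 > 0" "\<And>y. \<bar>y - x i\<bar> < d1 \<Longrightarrow> y \<in> A"
    using AB(1,3) unfolding open_dist by (auto simp: dist_real_def)
  obtain d2 where d2: "d2 > 0" "\<And>y. \<bar>y - x j\<bar> < d2 \<Longrightarrow> y \<in> B"
    using AB(2,4) unfolding open_dist by (auto simp: dist_real_def)
  show ?thesis
  proof (rule that[of "min d1 d2"])
    fix s t assume st: "\<bar>s - x i\<bar> < min d1 d2" "\<bar>t - x j\<bar> < min d1 d2"
    then have "(s, t) \<in> A \<times> B" using d1 d2 by auto
    then have "x(i := s, j := t) \<in> W" using AB(5) by auto
    then show "x(i := s, j := t) \<in> U" using assms W(2) by auto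
  qed (use d1 d2 in auto)
qed

text \<open>Both mixed derivatives are limits of the same second difference quotient.\<close>

lemma (in euclidean_domain) mixed_difference:
  assumes g: "smooth_fun n U g" and ij: "i < n" "j < n" "i \<noteq> j"
    and h: "h > 0"
    and U: "\<And>s t. \<bar>s - x i\<bar> \<le> h \<Longrightarrow> \<bar>t - x j\<bar> \<le> h \<Longrightarrow> x(i := s, j := t) \<in> U"
  obtains s t where "\<bar>s - x i\<bar> \<le> h" "\<bar>t - x j\<bar> \<le> h"
    "g (x(i := x i + h, j := x j + h)) - g (x(i := x i + h)) - g (x(j := x j + h)) + g x
      = h * h * rpd j (rpd i g) (x(i := s, j := t))"
proof -
  let ?a = "x i" and ?b = "x j"
  have comm: "x(i := s, j := t) = x(j := t, i := s)" for s t using ij by (simp add: fun_upd_twist)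
  have U0: "x(i := s) \<in> U" if "\<bar>s - x i\<bar> \<le> h" for s
    using U[OF that, of "x j"] h ij(3) by (metis abs_0 diff_self fun_upd_other fun_upd_triv less_imp_le)
  \<comment> \<open>The second difference is an increment of \<open>\<phi>\<close>, so the mean
    value theorem applies first in direction i and then, to the resulting difference of derivatives,
    in direction j.\<close>
  define \<phi> where "\<phi> s = g (x(i := s, j := ?b + h)) - g (x(i := s, j := ?b))" for s
  have "(\<phi> has_real_derivative
      rpd i g (x(i := s, j := ?b + h)) - rpd i g (x(i := s, j := ?b))) (at s)"
    if "?a \<le> s" "s \<le> ?a + h" for s
    unfolding \<phi>_def comm
    by (intro DERIV_diff has_rpd[OF g ij(1)]) (use that h U U0 in \<open>auto simp flip: comm\<close>)
  from MVT2[of ?a "?a + h", OF _ this] h obtain s where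
    s: "?a < s" "s < ?a + h" "\<phi> (?a + h) - \<phi> ?a = h * (rpd i g (x(i := s, j := ?b + h)) - rpd i g (x(i := s, j := ?b)))"
    by auto
  have "((\<lambda>t. rpd i g ((x(i := s))(j := t))) has_real_derivative rpd j (rpd i g) ((x(i := s))(j := t))) (at t)"
    if "?b \<le> t" "t \<le> ?b + h" for t
    by (rule has_rpd[OF smooth_fun_rpd[OF g ij(1)] ij(2)]) (use that h s U in auto)
  from MVT2[of ?b "?b + h", OF _ this] h obtain t where
    t: "?b < t" "t < ?b + h" "rpd i g (x(i := s, j := ?b + h)) - rpd i g (x(i := s, j := ?b))
       = h * rpd j (rpd i g) (x(i := s, j := t))"
    by auto
  show ?thesis
  proof (rule that)
    have "x(i := s, j := x j) = x(i := s)" for s using ij by (auto simp: fun_eq_iff)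
    then show "g (x(i := x i + h, j := x j + h)) - g (x(i := x i + h)) - g (x(j := x j + h)) + g x
      = h * h * rpd j (rpd i g) (x(i := s, j := t))"
      using s(3) t(3) by (simp add: \<phi>_def algebra_simps)
  qed (use s t in auto)
qed

lemma (in euclidean_domain) rpd_commute:
  assumes g: "smooth_fun n U g" and ij: "i < n" "j < n" and x: "x \<in> U"
  shows "rpd i (rpd j g) x = rpd j (rpd i g) x"
proof (cases "i = j")
  case False
  obtain d where d: "d > 0" "\<And>s t. \<bar>s - x i\<bar> < d \<Longrightarrow> \<bar>t - x j\<bar> < d \<Longrightarrow> x(i := s, j := t) \<in> U"
    using fun_upd_upd_in_U[OF x ij] by blast
  define \<Delta> where "\<Delta> h = g (x(i := x i + h, j := x j + h)) - g (x(i := x i + h)) - g (x(j := x j + h)) + g x" for h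
  have comm: "x(i := s, j := t) = x(j := t, i := s)" for s t using False by (simp add: fun_upd_twist)
  have lim: "((\<lambda>h. \<Delta> h / (h * h)) \<longlongrightarrow> rpd k (rpd l g) x) (at_right 0)"
    if kl: "(k, l) = (i, j) \<or> (k, l) = (j, i)" for k l
  proof -
    have "\<exists>s t. \<bar>s - x i\<bar> \<le> h \<and> \<bar>t - x j\<bar> \<le> h \<and> \<Delta> h / (h * h) = rpd k (rpd l g) (x(i := s, j := t))"
      if h: "0 < h" "h < d" for h
    proof -
      have "\<bar>s - x i\<bar> \<le> h \<Longrightarrow> \<bar>t - x j\<bar> \<le> h \<Longrightarrow> x(i := s, j := t) \<in> U" for s t
        using d(2) h by auto
      note U1 = this
      have U2: "x(j := s, i := t) \<in> U" if "\<bar>s - x j\<bar> \<le> h" "\<bar>t - x i\<bar> \<le> h" for s t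
        using U1[OF that(2,1)] by (simp only: comm)
      from kl show ?thesis
      proof (elim disjE)
        assume "(k, l) = (j, i)"
        moreover obtain s t where "\<bar>s - x i\<bar> \<le> h" "\<bar>t - x j\<bar> \<le> h"
          "\<Delta> h = h * h * rpd j (rpd i g) (x(i := s, j := t))"
          unfolding \<Delta>_def by (rule mixed_difference[OF g ij False h(1) U1])
        ultimately show ?thesis using h(1) by auto
      next
        assume "(k, l) = (i, j)"
        moreover obtain s t where "\<bar>s - x j\<bar> \<le> h" "\<bar>t - x i\<bar> \<le> h"
          "g (x(j := x j + h, i := x i + h)) - g (x(j := x j + h)) - g (x(i := x i + h)) + g x
            = h * h * rpd i (rpd j g) (x(j := s, i := t))"
          by (rule mixed_difference[OF g ij(2,1) False[symmetric] h(1) U2])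
        moreover from this have "\<Delta> h = h * h * rpd i (rpd j g) (x(i := t, j := s))"
          unfolding \<Delta>_def by (simp add: comm del: fun_upd_apply)
        ultimately show ?thesis using h(1) by auto
      qed
    qed
    \<comment> \<open>The intermediate points are at distance at most h from x in both coordinates,
      so they converge to x and continuity of the mixed derivative gives the limit.\<close>
    then obtain s t where st: "\<And>h. 0 < h \<Longrightarrow> h < d \<Longrightarrow> \<bar>s h - x i\<bar> \<le> h \<and> \<bar>t h - x j\<bar> \<le> h \<and>
        \<Delta> h / (h * h) = rpd k (rpd l g) (x(i := s h, j := t h))"
      by metis
    have ev: "\<forall>\<^sub>F h in at_right 0. 0 < h \<and> h < d"
      using d(1) by (auto simp: eventually_at_right_field)
    have zero: "((\<lambda>h::real. h) \<longlongrightarrow> 0) (at_right 0)" by (rule tendsto_ident_at)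
    have s: "(s \<longlongrightarrow> x i) (at_right 0)" and t: "(t \<longlongrightarrow> x j) (at_right 0)"
      by (rule LIM_zero_cancel, rule Lim_null_comparison[OF _ zero], use ev st in \<open>auto elim!: eventually_mono\<close>)+
    have conv: "((\<lambda>h. x(i := s h, j := t h)) \<longlongrightarrow> x) (at_right 0)"
    proof -
      have "((\<lambda>h. (x(i := s h, j := t h)) k) \<longlongrightarrow> x k) (at_right 0)" for k
        using s t by (cases "k = i"; cases "k = j") auto
      moreover have "(f \<longlongrightarrow> x) (at_right 0) \<longleftrightarrow> (\<forall>k. ((\<lambda>h. f h k) \<longlongrightarrow> x k) (at_right 0))"
        for f :: "real \<Rightarrow> nat \<Rightarrow> real"
        using limitin_componentwise[where X = "\<lambda>_. euclidean" and I = UNIV and F = "at_right 0" and l = x]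
        by (simp add: euclidean_product_topology)
      ultimately show ?thesis by blast
    qed
    have cont: "continuous_on U (rpd k (rpd l g))"
      using kl g ij by (auto intro!: smooth_fun_continuous smooth_fun_rpd)
    have "\<forall>\<^sub>F h in at_right 0. x(i := s h, j := t h) \<in> U"
      using ev by eventually_elim (intro d(2); use st in fastforce)
    then have "((\<lambda>h. rpd k (rpd l g) (x(i := s h, j := t h))) \<longlongrightarrow> rpd k (rpd l g) x) (at_right 0)"
      by (rule continuous_on_tendsto_compose[OF cont conv x])
    then show ?thesis
      by (rule Lim_transform_eventually) (use ev st in \<open>auto elim!: eventually_mono\<close>)
  qed
  from tendsto_unique[OF _ lim lim] show ?thesis by auto
qed simp

section \<open>Functions on superdomains\<close>

lemma coeff_pd: 
  "coeff (pd n i f x) I = (if i < n then rpd i (\<lambda>y. coeff (f y) I) x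
     else coeff (gderiv (i - n) (f x)) I)"
proof -
  have "coeff (Abs_grassmann (\<lambda>I. if finite I then rpd i (\<lambda>y. coeff (f y) I) x else 0)) I
      = rpd i (\<lambda>y. coeff (f y) I) x"
    by (subst Abs_grassmann_inverse) (auto simp: coeff_infinite rpd_def)
  then show ?thesis by (simp add: pd_def)
qed

lemma neg_one_power_fun [simp]: "((-1) ^ k :: 'a \<Rightarrow> 'b::ring_1) x = (-1) ^ k"
  by (induction k) auto

lemma sum_fun_apply [simp]: "(sum f X :: 'a \<Rightarrow> 'b::comm_monoid_add) x = (\<Sum>a\<in>X. f a x)"
  by (induction X rule: infinite_finite_induct) auto

lemma power_fun_apply [simp]: "(f ^ k :: 'a \<Rightarrow> 'b::ring_1) x = f x ^ k"
  by (induction k) auto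

lemma SF_hom_iff:
  "f \<in> SF_hom n m U p \<longleftrightarrow> f \<in> SF n m U \<and> (\<forall>x\<in>U. f x \<in> ghom p)"
  by (auto simp: SF_hom_def ghom_def)

lemma SF_hom_SF: "f \<in> SF_hom n m U p \<Longrightarrow> f \<in> SF n m U"
  by (simp add: SF_hom_iff)

lemma ghom_cong: "even (p + q) \<Longrightarrow> ghom p = ghom q"
  by (auto simp: ghom_def)

lemma SF_hom_cong: "even (p + q) \<Longrightarrow> SF_hom n m U p = SF_hom n m U q"
  unfolding set_eq_iff SF_hom_iff using ghom_cong[of p q] by simp

lemma SF_coeff: "f \<in> SF n m U \<Longrightarrow> smooth_fun n U (\<lambda>x. coeff (f x) I)"
  and SF_support: "f \<in> SF n m U \<Longrightarrow> x \<in> U \<Longrightarrow> coeff (f x) I \<noteq> 0 \<Longrightarrow> I \<subseteq> {..<m}"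
  by (auto simp: SF_def)

lemma ghom_add: "a \<in> ghom p \<Longrightarrow> b \<in> ghom p \<Longrightarrow> a + b \<in> ghom p"
  and ghom_uminus: "a \<in> ghom p \<Longrightarrow> - a \<in> ghom p"
  and ghom_0: "0 \<in> ghom p"
  and ghom_gconst: "gconst r \<in> ghom 0"
  by (auto simp: ghom_def) (metis add.right_neutral)+

lemma ghom_gderiv: "a \<in> ghom p \<Longrightarrow> gderiv v a \<in> ghom (p + 1)"
  unfolding ghom_def
proof (intro CollectI allI impI)
  fix I assume a: "a \<in> {z. \<forall>I. coeff z I \<noteq> 0 \<longrightarrow> even (card I + p)}" and nz: "coeff (gderiv v a) I \<noteq> 0"
  then have "finite I" "v \<notin> I" "coeff a (insert v I) \<noteq> 0"
    using coeff_infinite[of I "gderiv v a"] by (auto split: if_splits)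
  with a have "even (card (insert v I) + p)" by blast
  with \<open>finite I\<close> \<open>v \<notin> I\<close> show "even (card I + (p + 1))" by simp
qed

section \<open>The superalgebra of functions and its partial derivatives\<close>

context euclidean_domain
begin

context fixes m :: nat
begin

lemma SF_cong: "(\<And>x. x \<in> U \<Longrightarrow> f x = g x) \<Longrightarrow> f \<in> SF n m U \<longleftrightarrow> g \<in> SF n m U"
  unfolding SF_def using smooth_fun_cong[of "\<lambda>x. coeff (f x) I" "\<lambda>x. coeff (g x) I" for I] by simp

lemma SF_hom_eq_cong: "(\<And>x. x \<in> U \<Longrightarrow> f x = g x) \<Longrightarrow> f \<in> SF_hom n m U p \<longleftrightarrow> g \<in> SF_hom n m U p"
  unfolding SF_hom_iff using SF_cong[of f g] by simp

lemma SF_add: "f \<in> SF n m U \<Longrightarrow> g \<in> SF n m U \<Longrightarrow> f + g \<in> SF n m U"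
  by (simp add: SF_def smooth_fun_add) (metis add.right_neutral)

lemma SF_uminus: "f \<in> SF n m U \<Longrightarrow> - f \<in> SF n m U"
  by (simp add: SF_def smooth_fun_minus)

lemma SF_gconst: "smooth_fun n U g \<Longrightarrow> (\<lambda>x. gconst (g x)) \<in> SF n m U"
proof -
  assume "smooth_fun n U g"
  then have "smooth_fun n U (\<lambda>x. if I = {} then g x else 0)" for I :: "nat set"
    by (cases "I = {}") (auto intro: smooth_fun_const)
  then show ?thesis by (auto simp: SF_def)
qed

lemma SF_0: "0 \<in> SF n m U"
  by (simp add: SF_def smooth_fun_const)

lemma SF_const: "const r \<in> SF n m U"
  unfolding const_def by (rule SF_gconst) (rule smooth_fun_const)

lemma SF_times:
  assumes "f \<in> SF n m U" "g \<in> SF n m U"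
  shows "f * g \<in> SF n m U"
proof -
  have "smooth_fun n U (\<lambda>x. coeff (f x * g x) I)" for I
  proof (cases "finite I")
    case True
    then show ?thesis
      using assms by (auto simp: coeff_times intro!: smooth_fun_sum smooth_fun_mult smooth_fun_cmult SF_coeff)
  qed (simp add: coeff_infinite smooth_fun_const)
  moreover have "I \<subseteq> {..<m}" if "x \<in> U" "coeff (f x * g x) I \<noteq> 0" for x I
    using coeff_times_support[of "f x" "{..<m}" "g x" I] that assms SF_support by blast
  ultimately show ?thesis by (auto simp: SF_def)
qed

lemma SF_sum: "(\<And>a. a \<in> X \<Longrightarrow> f a \<in> SF n m U) \<Longrightarrow> sum f X \<in> SF n m U"
  by (induction X rule: infinite_finite_induct) (auto intro: SF_0 SF_add)

lemma SF_sgn_pow: "f \<in> SF n m U \<Longrightarrow> sgn_pow k f \<in> SF n m U"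
  by (cases "even k") (auto simp: sgn_pow_def SF_def intro!: smooth_fun_cmult)

lemma SF_coord: "i < n + m \<Longrightarrow> coord n i \<in> SF n m U"
  unfolding coord_def by (auto intro!: SF_gconst smooth_fun_coord) (auto simp: SF_def smooth_fun_const)

lemma SF_pd:
  assumes "f \<in> SF n m U"
  shows "pd n i f \<in> SF n m U"
  unfolding SF_def
proof (intro CollectI conjI allI ballI impI)
  fix I
  show "smooth_fun n U (\<lambda>x. coeff (pd n i f x) I)"
    using assms
    by (cases "i < n"; cases "i - n \<in> I")
      (auto simp: coeff_pd intro!: smooth_fun_rpd smooth_fun_const smooth_fun_cmult SF_coeff)
next
  fix x I assume x: "x \<in> U" and nz: "coeff (pd n i f x) I \<noteq> 0"
  show "I \<subseteq> {..<m}"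
  proof (cases "i < n")
    case True
    show ?thesis
    proof (rule ccontr)
      assume "\<not> I \<subseteq> {..<m}"
      then have "coeff (f y) I = 0" if "y \<in> U" for y
        using SF_support[OF assms that] by blast
      then have "rpd i (\<lambda>y. coeff (f y) I) x = rpd i (\<lambda>_. 0) x"
        using x True by (intro rpd_cong) auto
      then show False using nz True by (simp add: coeff_pd rpd_const)
    qed
  next
    case False
    then have "coeff (f x) (insert (i - n) I) \<noteq> 0" using nz by (auto simp: coeff_pd split: if_splits)
    then show ?thesis using SF_support[OF assms x] by blast
  qed
qed

lemma SF_hom_add: "f \<in> SF_hom n m U p \<Longrightarrow> g \<in> SF_hom n m U p \<Longrightarrow> f + g \<in> SF_hom n m U p"
  and SF_hom_uminus: "f \<in> SF_hom n m U p \<Longrightarrow> - f \<in> SF_hom n m U p"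
  and SF_hom_0: "0 \<in> SF_hom n m U p"
  and SF_hom_const: "const r \<in> SF_hom n m U 0"
  and SF_hom_times: "f \<in> SF_hom n m U p \<Longrightarrow> g \<in> SF_hom n m U q \<Longrightarrow> f * g \<in> SF_hom n m U (p + q)"
  by (auto simp: SF_hom_iff const_def ghom_gconst SF_add SF_uminus SF_0 SF_times ghom_add ghom_uminus ghom_0
      ghom_times intro!: SF_gconst smooth_fun_const)

lemma SF_hom_neg_one_power: "f \<in> SF_hom n m U p \<Longrightarrow> (-1) ^ k * f \<in> SF_hom n m U p"
  by (cases "even k") (auto intro: SF_hom_uminus)

lemma SF_hom_const_times: "f \<in> SF_hom n m U p \<Longrightarrow> const r * f \<in> SF_hom n m U p"
  using SF_hom_times[OF SF_hom_const] by simp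

lemma SF_hom_sum: "(\<And>a. a \<in> X \<Longrightarrow> f a \<in> SF_hom n m U p) \<Longrightarrow> sum f X \<in> SF_hom n m U p"
  by (induction X rule: infinite_finite_induct) (auto intro: SF_hom_0 SF_hom_add)

lemma SF_hom_coord: "i < n + m \<Longrightarrow> coord n i \<in> SF_hom n m U (par n i)"
  unfolding SF_hom_iff using SF_coord by (auto simp: coord_def par_def ghom_def)

lemma SF_hom_pd:
  assumes f: "f \<in> SF_hom n m U p"
  shows "pd n i f \<in> SF_hom n m U (p + par n i)"
  unfolding SF_hom_iff
proof (intro conjI ballI)
  show "pd n i f \<in> SF n m U" using f by (simp add: SF_pd SF_hom_SF)
  fix x assume x: "x \<in> U"
  show "pd n i f x \<in> ghom (p + par n i)"
  proof (cases "i < n")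
    case True
    show ?thesis
      unfolding ghom_def
    proof (intro CollectI allI impI, rule ccontr)
      fix I assume nz: "coeff (pd n i f x) I \<noteq> 0" and "odd (card I + (p + par n i))"
      then have "coeff (f y) I = 0" if "y \<in> U" for y
        using f that True by (auto simp: SF_hom_def par_def)
      then have "rpd i (\<lambda>y. coeff (f y) I) x = rpd i (\<lambda>_. 0) x"
        using x True by (intro rpd_cong) auto
      then show False using nz True by (simp add: coeff_pd rpd_const)
    qed
  next
    case False
    then show ?thesis using f x ghom_gderiv[of "f x" p] by (auto simp: SF_hom_iff pd_def par_def)
  qed
qed

lemma pd_cong: "(\<And>x. x \<in> U \<Longrightarrow> f x = g x) \<Longrightarrow> x \<in> U \<Longrightarrow> pd n i f x = pd n i g x"
proof (rule grassmann_eqI)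
  fix I assume "\<And>x. x \<in> U \<Longrightarrow> f x = g x" "x \<in> U"
  then show "coeff (pd n i f x) I = coeff (pd n i g x) I"
    using rpd_cong[of "\<lambda>y. coeff (f y) I" "\<lambda>y. coeff (g y) I" x i] by (simp add: coeff_pd)
qed

lemma pd_0 [simp]: "pd n i 0 = 0"
  by (rule ext, rule grassmann_eqI) (simp add: coeff_pd rpd_const)

lemma pd_add:
  assumes "f \<in> SF n m U" "g \<in> SF n m U" "x \<in> U"
  shows "pd n i (f + g) x = pd n i f x + pd n i g x"
  by (rule grassmann_eqI) (use assms in \<open>auto simp: coeff_pd rpd_add SF_coeff algebra_simps\<close>)

lemma pd_const_times:
  assumes "f \<in> SF n m U" "x \<in> U"
  shows "pd n i (const r * f) x = gconst r * pd n i f x"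
  by (rule grassmann_eqI) (use assms in \<open>auto simp: coeff_pd rpd_cmult SF_coeff const_def\<close>)

lemma pd_commute:
  assumes f: "f \<in> SF n m U" and x: "x \<in> U"
  shows "pd n i (pd n j f) x = (-1) ^ (par n i * par n j) * pd n j (pd n i f) x"
proof (rule grassmann_eqI)
  fix I :: "nat set" assume I: "finite I"
  show "coeff (pd n i (pd n j f) x) I = coeff ((-1) ^ (par n i * par n j) * pd n j (pd n i f) x) I"
  proof (cases "i < n"; cases "j < n")
    assume "i < n" "j < n"
    then show ?thesis using rpd_commute[OF SF_coeff[OF f] _ _ x] by (simp add: coeff_pd par_def)
  next
    \<comment> \<open>An odd derivative only reindexes coefficients and multiplies them by
      constants, so it passes through the even one without sign.\<close>
    assume "i < n" "\<not> j < n"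
    then show ?thesis using rpd_cmult[OF SF_coeff[OF f] _ x] by (auto simp: coeff_pd par_def rpd_const)
  next
    assume "\<not> i < n" "j < n"
    then show ?thesis using rpd_cmult[OF SF_coeff[OF f] _ x] by (auto simp: coeff_pd par_def rpd_const)
  next
    assume "\<not> i < n" "\<not> j < n"
    then show ?thesis using gderiv_gderiv[of "i - n" "j - n" "f x"] by (simp add: pd_def par_def)
  qed
qed

end

end

section \<open>The graded Leibniz rule\<close>

lemma rpd_coeff_times:
  assumes "\<And>I. (\<lambda>t. coeff (f (x(i := t))) I) differentiable (at (x i))"
    and "\<And>I. (\<lambda>t. coeff (g (x(i := t))) I) differentiable (at (x i))"
  shows "rpd i (\<lambda>y. coeff (f y * g y) I) x = (if finite I then
      \<Sum>J\<in>Pow I. shuffle_sign J (I - J) * (coeff (f x) J * rpd i (\<lambda>y. coeff (g y) (I - J)) x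
        + rpd i (\<lambda>y. coeff (f y) J) x * coeff (g x) (I - J)) else 0)"
proof (cases "finite I")
  case True
  have d: "((\<lambda>t. coeff (h (x(i := t))) J) has_real_derivative rpd i (\<lambda>y. coeff (h y) J) x) (at (x i))"
    if "(\<lambda>t. coeff (h (x(i := t))) J) differentiable (at (x i))" for h :: superfun and J
    using that by (simp add: rpd_def DERIV_deriv_iff_real_differentiable)
  have "((\<lambda>t. \<Sum>J\<in>Pow I. shuffle_sign J (I - J) * (coeff (f (x(i := t))) J * coeff (g (x(i := t))) (I - J)))
      has_real_derivative (\<Sum>J\<in>Pow I. shuffle_sign J (I - J) * (coeff (f x) J * rpd i (\<lambda>y. coeff (g y) (I - J)) x
        + rpd i (\<lambda>y. coeff (f y) J) x * coeff (g x) (I - J)))) (at (x i))"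
  proof (intro DERIV_sum DERIV_cmult)
    fix J
    show "((\<lambda>t. coeff (f (x(i := t))) J * coeff (g (x(i := t))) (I - J)) has_real_derivative
        coeff (f x) J * rpd i (\<lambda>y. coeff (g y) (I - J)) x
        + rpd i (\<lambda>y. coeff (f y) J) x * coeff (g x) (I - J)) (at (x i))"
      using DERIV_mult'[OF d[OF assms(1), of J] d[OF assms(2), of "I - J"]] by (simp only: fun_upd_triv)
  qed
  then show ?thesis
    using True by (intro rpd_eqI) (simp add: coeff_times mult.assoc del: fun_upd_apply)
qed (simp add: coeff_infinite rpd_def)

text \<open>Stated at a single point and under differentiability in a single direction, because it
  is applied both to smooth functions on U and to lifts on the cotangent bundle differentiated along
  a momentum.\<close>

lemma pd_times_if_differentiable:
  assumes "\<And>I. i < n \<Longrightarrow> (\<lambda>t. coeff (f (x(i := t))) I) differentiable (at (x i))"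
    and "\<And>I. i < n \<Longrightarrow> (\<lambda>t. coeff (g (x(i := t))) I) differentiable (at (x i))"
  shows "pd n i (f * g) x = pd n i f x * g x + sgn_pow (par n i) f x * pd n i g x"
proof (cases "i < n")
  case True
  show ?thesis
  proof (rule grassmann_eqI)
    fix I :: "nat set" assume I: "finite I"
    show "coeff (pd n i (f * g) x) I = coeff (pd n i f x * g x + sgn_pow (par n i) f x * pd n i g x) I"
      using True I rpd_coeff_times[OF assms(1)[OF True] assms(2)[OF True], of I]
      by (simp add: coeff_pd coeff_times par_def sgn_pow_def sum.distrib algebra_simps)
  qed
next
  case False
  then show ?thesis by (simp add: pd_def gderiv_times sgn_pow_def par_def)
qed

context euclidean_domain
begin

lemma pd_times:
  assumes "f \<in> SF n m U" "g \<in> SF n m U" "x \<in> U"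
  shows "pd n i (f * g) x = pd n i f x * g x + sgn_pow (par n i) f x * pd n i g x"
  by (rule pd_times_if_differentiable) (use assms SF_coeff smooth_fun_differentiable in blast)+

end

section \<open>Brackets from connections with values in weights\<close>

text \<open>Signs as an operator, which can be moved through products without looping.\<close>

definition sg :: "nat \<Rightarrow> 'r::ring_1 \<Rightarrow> 'r" where
  "sg k a = (-1) ^ k * a"

lemma sg_mult_right: "a * sg k b = sg k (a * b)"
  and sg_mult_left: "sg k a * b = sg k (a * b)"
  and sg_sg: "sg j (sg k a) = sg (j + k) a"
  and sg_add: "sg k (a + b) = sg k a + sg k b"
  and sg_diff: "sg k (a - b) = sg k a - sg k b"
  and sg_uminus: "sg k (- a) = - sg k a"
  by (cases "even k"; cases "even j"; simp add: sg_def)+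

lemma sg_sum: "sg k (sum f X) = (\<Sum>i\<in>X. sg k (f i))"
  by (simp add: sg_def sum_distrib_left)

lemmas neg1_simps = sg_def[symmetric] sg_mult_right sg_mult_left sg_sg sg_add sg_diff sg_uminus sg_sum
  mult.assoc

lemma neg1_collect: "(-1) ^ j * ((-1) ^ k * a) = (-1) ^ (j + k) * (a :: 'r::ring_1)"
  by (simp add: power_add mult.assoc)

text \<open>Signs are compared by the parity of their exponents; the sign identities below end in
  such a parity goal, which is decided by cases on parities.\<close>

lemma sg_cong: "even (j + k) \<Longrightarrow> sg j a = sg k (a :: 'r::ring_1)"
  by (auto simp: sg_def minus_one_power_iff)

lemma neg1_cong: "even (j + k) \<Longrightarrow> (-1) ^ j = ((-1) ^ k :: 'r::ring_1)"
  by (auto simp: minus_one_power_iff)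

text \<open>The algebra is modelled on functions extended by zero off a domain. Its unit
  \<open>u\<close> is then the indicator function of the domain and differs from 1 in the ambient
  ring, and a constant \<open>c r\<close> acts on \<open>H p\<close> without being assumed to belong
  to it.\<close>

locale super_derivations =
  fixes H :: "nat \<Rightarrow> 'r::ring_1 set" and N :: nat and e :: "nat \<Rightarrow> nat"
    and D :: "nat \<Rightarrow> 'r \<Rightarrow> 'r" and x :: "nat \<Rightarrow> 'r" and u :: 'r and c :: "real \<Rightarrow> 'r"
  assumes H_add: "a \<in> H p \<Longrightarrow> b \<in> H p \<Longrightarrow> a + b \<in> H p"
    and H_uminus: "a \<in> H p \<Longrightarrow> - a \<in> H p"
    and H_0: "0 \<in> H p"
    and H_mult: "a \<in> H p \<Longrightarrow> b \<in> H q \<Longrightarrow> a * b \<in> H (p + q)"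
    and H_parity: "even (p + q) \<Longrightarrow> H p = H q"
    and commute: "a \<in> H p \<Longrightarrow> b \<in> H q \<Longrightarrow> a * b = (-1) ^ (p * q) * (b * a)"
    and H_c: "a \<in> H p \<Longrightarrow> c r * a \<in> H p"
    and c_commute: "c r * a = a * c r"
    and c_add: "c (r + s) = c r + c s"
    and c_mult: "c (r * s) = c r * c s"
    and c_0: "c 0 = 0"
    and c_1: "c 1 = 1"
    and H_u: "u \<in> H 0"
    and u_left: "a \<in> H p \<Longrightarrow> u * a = a"
    and H_x: "i < N \<Longrightarrow> x i \<in> H (e i)"
    and H_D: "i < N \<Longrightarrow> a \<in> H p \<Longrightarrow> D i a \<in> H (p + e i)"
    and D_add: "i < N \<Longrightarrow> a \<in> H p \<Longrightarrow> b \<in> H p \<Longrightarrow> D i (a + b) = D i a + D i b"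
    and D_c: "i < N \<Longrightarrow> a \<in> H p \<Longrightarrow> D i (c r * a) = c r * D i a"
    and D_mult: "i < N \<Longrightarrow> a \<in> H p \<Longrightarrow> b \<in> H q \<Longrightarrow>
      D i (a * b) = D i a * b + (-1) ^ (e i * p) * (a * D i b)"
    and D_commute: "i < N \<Longrightarrow> j < N \<Longrightarrow> a \<in> H p \<Longrightarrow> D i (D j a) = (-1) ^ (e i * e j) * D j (D i a)"
    and D_x: "i < N \<Longrightarrow> j < N \<Longrightarrow> D i (x j) = (if i = j then u else 0)"
begin

lemma H_conv: "a \<in> H p \<Longrightarrow> even (p + q) \<Longrightarrow> a \<in> H q"
  using H_parity by blast

lemma commute_left: "a \<in> H p \<Longrightarrow> b \<in> H q \<Longrightarrow> a * (b * y) = (-1) ^ (p * q) * (b * (a * y))"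
  using commute[of a p b q] by (simp flip: mult.assoc)

lemma u_right: "a \<in> H p \<Longrightarrow> a * u = a"
  using commute[OF _ H_u, of a p] u_left by simp

lemma H_sum: "(\<And>i. i \<in> X \<Longrightarrow> f i \<in> H p) \<Longrightarrow> sum f X \<in> H p"
  by (induction X rule: infinite_finite_induct) (auto intro: H_0 H_add)

lemma H_neg1: "a \<in> H p \<Longrightarrow> (-1) ^ k * a \<in> H p"
  by (cases "even k") (auto intro: H_uminus)

lemma H_diff: "a \<in> H p \<Longrightarrow> b \<in> H p \<Longrightarrow> a - b \<in> H p"
  using H_add[OF _ H_uminus] by force

text \<open>Does for constants what \<open>sg\<close> does for signs: as an operator it can be moved
  to the front of a product by terminating rewriting.\<close>

definition cs :: "real \<Rightarrow> 'r \<Rightarrow> 'r" where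
  "cs r a = c r * a"

lemma cs_mult_right: "a * cs r b = cs r (a * b)"
  unfolding cs_def by (metis c_commute mult.assoc)

lemma cs_commute: "cs r (cs s a) = cs s (cs r a)"
  by (metis cs_def cs_mult_right)

lemma cs_mult_left: "cs r a * b = cs r (a * b)"
  and cs_add: "cs r (a + b) = cs r a + cs r b"
  and cs_diff: "cs r (a - b) = cs r a - cs r b"
  and cs_uminus: "cs r (- a) = - cs r a"
  and cs_sum: "cs r (sum f X) = (\<Sum>i\<in>X. cs r (f i))"
  and cs_sg: "cs r (sg k a) = sg k (cs r a)"
  and cs_weight_add: "cs (r + s) a = cs r a + cs s a"
  and cs_weight_mult: "cs (r * s) a = cs r (cs s a)"
  by (cases "even k"; simp add: cs_def sg_def c_add c_mult ring_distribs mult.assoc sum_distrib_left)+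

lemmas c_simps = cs_def[symmetric] cs_mult_right cs_mult_left cs_add cs_diff cs_uminus cs_sum cs_sg
  cs_weight_add cs_weight_mult cs_commute

lemma c_uminus: "c (- r) = - c r"
  using c_add[of r "- r"] c_0 by (simp add: eq_neg_iff_add_eq_0 add.commute)

lemma D_0: "i < N \<Longrightarrow> D i 0 = 0"
  using D_c[of i 0 0 0] H_0 c_0 by simp

lemma D_uminus: "i < N \<Longrightarrow> a \<in> H p \<Longrightarrow> D i (- a) = - D i a"
  using D_c[of i a p "-1"] by (simp add: c_uminus c_1)

end

text \<open>\<open>S\<close> is only assumed odd and symmetric. The Jacobi identity on coordinates
  is an explicit hypothesis where it is used, so that the locale covers both directions of the
  equivalence.\<close>

locale super_connection = super_derivations H N e D x u c
  for H :: "nat \<Rightarrow> 'r::ring_1 set" and N e D x u c +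
  fixes S :: "nat \<Rightarrow> nat \<Rightarrow> 'r" and A :: "nat \<Rightarrow> 'r"
  assumes H_S: "i < N \<Longrightarrow> j < N \<Longrightarrow> S i j \<in> H (e i + e j + 1)"
    and S_sym: "i < N \<Longrightarrow> j < N \<Longrightarrow> S i j = (-1) ^ (e i * e j) * S j i"
    and H_A: "i < N \<Longrightarrow> A i \<in> H (e i)"
begin

text \<open>The covariant derivative of \<open>f |Dx|\<^sup>r\<close>, its curvature, the Hamiltonian vector field of
  \<open>f |Dx|\<^sup>r\<close> with \<open>f\<close> of parity \<open>p\<close>, and the bracket.\<close>

definition nab :: "real \<Rightarrow> nat \<Rightarrow> 'r \<Rightarrow> 'r" where
  "nab r i f = D i f - c r * (A i * f)"

definition curv :: "nat \<Rightarrow> nat \<Rightarrow> 'r" where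
  "curv i j = D i (A j) - (-1) ^ (e i * e j) * D j (A i)"

definition ham :: "nat \<Rightarrow> real \<Rightarrow> 'r \<Rightarrow> nat \<Rightarrow> 'r" where
  "ham p r f i = (\<Sum>j<N. (-1) ^ ((e i + 1) * p) * (S i j * nab r j f))"

definition br :: "nat \<Rightarrow> real \<Rightarrow> 'r \<Rightarrow> real \<Rightarrow> 'r \<Rightarrow> 'r" where
  "br p r f s g = (\<Sum>i<N. ham p r f i * nab s i g)"

lemma H_nab: "i < N \<Longrightarrow> f \<in> H p \<Longrightarrow> nab r i f \<in> H (p + e i)"
  unfolding nab_def using H_mult[OF H_A, of i f p] by (auto intro!: H_diff H_D H_c simp: add.commute)

lemma nab_0: "i < N \<Longrightarrow> nab r i 0 = 0"
  by (simp add: nab_def D_0)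

lemma nab_add: "i < N \<Longrightarrow> f \<in> H p \<Longrightarrow> g \<in> H p \<Longrightarrow> nab r i (f + g) = nab r i f + nab r i g"
  by (simp add: nab_def D_add algebra_simps)

lemma nab_neg1: "i < N \<Longrightarrow> f \<in> H p \<Longrightarrow> nab r i ((-1) ^ k * f) = (-1) ^ k * nab r i f"
  by (cases "even k") (auto simp: nab_def D_uminus algebra_simps)

lemma nab_sum: "i < N \<Longrightarrow> (\<And>j. j \<in> X \<Longrightarrow> f j \<in> H p) \<Longrightarrow> nab r i (sum f X) = (\<Sum>j\<in>X. nab r i (f j))"
  by (induction X rule: infinite_finite_induct) (auto simp: nab_0 nab_add[of i _ p] H_sum)

lemma nab_weight_0: "nab 0 i f = D i f"
  by (simp add: nab_def c_0)

text \<open>The connection term is linear in the weight, so it divides between the factors along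
  \<open>r + s\<close>; moving \<open>A i\<close> past f costs the Leibniz sign.\<close>

lemma nab_mult:
  assumes i: "i < N" and f: "f \<in> H p" and g: "g \<in> H q"
  shows "nab (r + s) i (f * g) = nab r i f * g + (-1) ^ (e i * p) * (f * nab s i g)"
proof -
  have "A i * (f * g) = (-1) ^ (e i * p) * (f * (A i * g))"
    by (rule commute_left[OF H_A[OF i] f])
  then show ?thesis
    by (simp add: nab_def D_mult[OF i f g] ring_distribs c_simps neg1_simps)
qed

lemma nab_nab:
  assumes i: "i < N" and j: "j < N" and f: "f \<in> H p"
  shows "nab r i (nab r j f) - (-1) ^ (e i * e j) * nab r j (nab r i f) = - (c r * (curv i j * f))"
proof -
  have exp: "nab r i (nab r j f) = D i (D j f) - c r * (D i (A j) * f) - c r * ((-1) ^ (e i * e j) * (A j * D i f))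
      - c r * (A i * D j f) + c r * (c r * (A i * (A j * f)))" if "i < N" "j < N" for i j
  proof -
    have Af: "A j * f \<in> H (e j + p)" by (intro H_mult H_A f that)
    then have "D i (D j f - c r * (A j * f)) = D i (D j f) - c r * D i (A j * f)"
      using D_add[OF that(1) H_D[OF that(2) f], of "- (c r * (A j * f))"] D_c[OF that(1) Af]
        D_uminus[OF that(1) H_c[OF Af]] H_uminus[OF H_c[OF Af]]
      by (simp add: add.commute)
    then show ?thesis
      unfolding nab_def by (simp add: D_mult[OF that(1) H_A[OF that(2)] f] ring_distribs c_simps neg1_simps)
  qed
  \<comment> \<open>The terms quadratic in A cancel by supercommutativity, as do those with a first
    derivative of f; what remains is the derivative of A.\<close>
  have AA: "A i * (A j * f) = (-1) ^ (e i * e j) * (A j * (A i * f))"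
    by (rule commute_left[OF H_A[OF i] H_A[OF j]])
  show ?thesis
    unfolding exp[OF i j] exp[OF j i] AA D_commute[OF i j f] curv_def
    by (cases "even (e i * e j)") (simp_all add: ring_distribs c_simps mult.commute[of "e j"] mult.assoc)
qed

section \<open>Hamiltonian vector fields and the bracket\<close>

lemma H_ham: "i < N \<Longrightarrow> f \<in> H p \<Longrightarrow> ham p r f i \<in> H (p + e i + 1)"
  unfolding ham_def
proof (intro H_sum H_neg1)
  fix j assume "i < N" "f \<in> H p" "j \<in> {..<N}"
  then have "S i j * nab r j f \<in> H ((e i + e j + 1) + (p + e j))" by (intro H_mult H_S H_nab) auto
  then show "S i j * nab r j f \<in> H (p + e i + 1)" by (rule H_conv) auto
qed

lemma H_br:
  assumes f: "f \<in> H p" and g: "g \<in> H q"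
  shows "br p r f s g \<in> H (p + q + 1)"
  unfolding br_def
proof (intro H_sum)
  fix j assume "j \<in> {..<N}"
  then have "ham p r f j * nab s j g \<in> H ((p + e j + 1) + (q + e j))" by (intro H_mult H_ham H_nab f g) auto
  then show "ham p r f j * nab s j g \<in> H (p + q + 1)" by (rule H_conv) auto
qed

lemma ham_neg1: "f \<in> H q \<Longrightarrow> ham p r ((-1) ^ k * f) i = (-1) ^ k * ham p r f i"
  unfolding ham_def
  by (simp add: nab_neg1[folded sg_def] neg1_simps add_ac cong: sum.cong_simp)

lemma br_neg1_left: "f \<in> H q \<Longrightarrow> br p r ((-1) ^ k * f) s g = (-1) ^ k * br p r f s g"
  unfolding br_def by (simp add: ham_neg1[folded sg_def] neg1_simps)

lemma br_neg1_right: "g \<in> H q \<Longrightarrow> br p r f s ((-1) ^ k * g) = (-1) ^ k * br p r f s g"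
  unfolding br_def by (simp add: nab_neg1[folded sg_def] neg1_simps cong: sum.cong_simp)

lemma br_add_right: "g \<in> H q \<Longrightarrow> g' \<in> H q \<Longrightarrow> br p r f s (g + g') = br p r f s g + br p r f s g'"
  unfolding br_def by (simp add: nab_add[of _ _ q] ring_distribs sum.distrib)

lemma br_uminus_left: "f \<in> H q \<Longrightarrow> br p r (- f) s g = - br p r f s g"
  using br_neg1_left[of f q p r 1] by simp

lemma br_uminus_right: "g \<in> H q \<Longrightarrow> br p r f s (- g) = - br p r f s g"
  using br_neg1_right[of g q p r f s 1] by simp

text \<open>Exchanging the summation indices, using the symmetry of \<open>S\<close> and commuting
  the two covariant derivatives produces the sign; its exponent agrees modulo 2 with the required
  one.\<close>

lemma br_anti:
  assumes f: "f \<in> H p" and g: "g \<in> H q"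
  shows "br p r f s g = - ((-1) ^ ((p + 1) * (q + 1)) * br q s g r f)"
proof -
  have "- ((-1) ^ ((p + 1) * (q + 1)) * br q s g r f)
      = (\<Sum>i<N. \<Sum>j<N. (-1) ^ ((p + 1) * (q + 1) + 1 + (e i + 1) * q) * (S i j * (nab s j g * nab r i f)))"
    unfolding br_def ham_def
    by (simp add: sum_distrib_left sum_distrib_right neg1_simps sum_negf add_ac)
  also have "\<dots> = (\<Sum>i<N. \<Sum>j<N. (-1) ^ ((p + 1) * (q + 1) + 1 + (e j + 1) * q) * (S j i * (nab s i g * nab r j f)))"
    by (rule sum.swap)
  also have "\<dots> = (\<Sum>i<N. \<Sum>j<N. (-1) ^ ((e i + 1) * p) * (S i j * (nab r j f * nab s i g)))"
  proof (intro sum.cong refl)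
    fix i j assume "i \<in> {..<N}" "j \<in> {..<N}"
    then have ij: "i < N" "j < N" by auto
    have "(-1) ^ ((p + 1) * (q + 1) + 1 + (e j + 1) * q) * (S j i * (nab s i g * nab r j f))
        = (-1) ^ ((p + 1) * (q + 1) + 1 + (e j + 1) * q + e j * e i + (q + e i) * (p + e j))
          * (S i j * (nab r j f * nab s i g))"
      unfolding S_sym[OF ij(2,1)] commute[OF H_nab[OF ij(1) g] H_nab[OF ij(2) f]]
      by (simp only: neg1_simps add_ac)
    also have "(-1) ^ ((p + 1) * (q + 1) + 1 + (e j + 1) * q + e j * e i + (q + e i) * (p + e j))
        = ((-1) ^ ((e i + 1) * p) :: 'r)"
      by (rule neg1_cong) auto
    finally show "(-1) ^ ((p + 1) * (q + 1) + 1 + (e j + 1) * q) * (S j i * (nab s i g * nab r j f))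
        = (-1) ^ ((e i + 1) * p) * (S i j * (nab r j f * nab s i g))" .
  qed
  also have "\<dots> = br p r f s g"
    unfolding br_def ham_def by (simp add: sum_distrib_right neg1_simps)
  finally show ?thesis ..
qed

lemma br_mult:
  assumes f: "f \<in> H p" and a: "a \<in> H q" and b: "b \<in> H k"
  shows "br p r f (s + t) (a * b) = br p r f s a * b + (-1) ^ ((p + 1) * q) * (a * br p r f t b)"
proof -
  have "ham p r f i * nab (s + t) i (a * b)
      = ham p r f i * nab s i a * b + (-1) ^ ((p + 1) * q) * (a * (ham p r f i * nab t i b))"
    if i: "i < N" for i
  proof -
    have "ham p r f i * (a * nab t i b) = (-1) ^ ((p + e i + 1) * q) * (a * (ham p r f i * nab t i b))"
      by (rule commute_left[OF H_ham[OF i f] a])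
    moreover have "sg (e i * q + (p + e i + 1) * q) y = sg ((p + 1) * q) y" for y :: 'r
      by (rule sg_cong) auto
    ultimately show ?thesis
      unfolding nab_mult[OF i a b] by (simp add: distrib_left neg1_simps)
  qed
  then show ?thesis
    unfolding br_def by (simp add: sum.distrib sum_distrib_left sum_distrib_right)
qed

text \<open>The components \<open>ham q s g j\<close> of the inner field are differentiated as
  densities of weight s and \<open>nab t j h\<close> as one of weight t. This separates a first
  order part in h from a part with second covariant derivatives.\<close>

lemma br_br:
  assumes f: "f \<in> H p" and g: "g \<in> H q" and h: "h \<in> H k"
  shows "br p r f (s + t) (br q s g t h) = (\<Sum>j<N. br p r f s (ham q s g j) * nab t j h)
    + (\<Sum>i<N. \<Sum>j<N. (-1) ^ (e i * (q + e j + 1)) * (ham p r f i * (ham q s g j * nab t i (nab t j h))))"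
proof -
  have mem: "ham q s g j * nab t j h \<in> H (q + k + 1)" if "j < N" for j
    using H_mult[OF H_ham[OF that g] H_nab[OF that h], of s t] by (rule H_conv) auto
  have "nab (s + t) i (br q s g t h) = (\<Sum>j<N. nab s i (ham q s g j) * nab t j h
      + (-1) ^ (e i * (q + e j + 1)) * (ham q s g j * nab t i (nab t j h)))" if i: "i < N" for i
  proof -
    have "nab (s + t) i (br q s g t h) = (\<Sum>j<N. nab (s + t) i (ham q s g j * nab t j h))"
      unfolding br_def by (rule nab_sum[OF i mem]) simp
    also have "\<dots> = (\<Sum>j<N. nab s i (ham q s g j) * nab t j h
      + (-1) ^ (e i * (q + e j + 1)) * (ham q s g j * nab t i (nab t j h)))"
      by (rule sum.cong[OF refl]) (rule nab_mult[OF i H_ham[OF _ g] H_nab[OF _ h]]; simp)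
    finally show ?thesis .
  qed
  then have "br p r f (s + t) (br q s g t h) = (\<Sum>i<N. \<Sum>j<N. ham p r f i * (nab s i (ham q s g j) * nab t j h))
    + (\<Sum>i<N. \<Sum>j<N. (-1) ^ (e i * (q + e j + 1)) * (ham p r f i * (ham q s g j * nab t i (nab t j h))))"
    unfolding br_def[of p r f "s + t"]
    by (simp add: sum_distrib_left distrib_left sum.distrib neg1_simps)
  then show ?thesis
    by (subst (asm) sum.swap) (simp add: br_def[of p r f s] sum_distrib_right mult.assoc)
qed

section \<open>The Jacobiator\<close>

definition jac :: "nat \<Rightarrow> real \<Rightarrow> 'r \<Rightarrow> nat \<Rightarrow> real \<Rightarrow> 'r \<Rightarrow> real \<Rightarrow> 'r \<Rightarrow> 'r" where
  "jac p r f q s g t h = br p r f (s + t) (br q s g t h)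
     - (-1) ^ ((p + 1) * (q + 1)) * br q s g (r + t) (br p r f t h)
     - br (p + q + 1) (r + s) (br p r f s g) t h"

text \<open>The commutator of two Hamiltonian vector fields is a vector field plus the curvature; its
  coefficients are read off on the coordinates.\<close>

lemma commutator:
  assumes f: "f \<in> H p" and g: "g \<in> H q" and h: "h \<in> H k"
  shows "br p r f (s + t) (br q s g t h) - (-1) ^ ((p + 1) * (q + 1)) * br q s g (r + t) (br p r f t h)
    = (\<Sum>j<N. (br p r f s (ham q s g j) - (-1) ^ ((p + 1) * (q + 1)) * br q s g r (ham p r f j)) * nab t j h)
    - c t * (\<Sum>i<N. \<Sum>j<N. (-1) ^ (e i * (q + e j + 1)) * (ham p r f i * (ham q s g j * (curv i j * h))))"
proof -
  let ?s = "(p + 1) * (q + 1)"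
  let ?X = "\<lambda>i j. nab t i (nab t j h)"
  let ?F = "\<lambda>i j y. ham p r f i * (ham q s g j * y)"
  \<comment> \<open>The second order sum of the opposite composition is rewritten with the same
    coefficients \<open>ham p r f i * ham q s g j\<close>. The difference of both sums then contains
    only graded commutators of covariant derivatives, that is, curvature.\<close>
  have "(-1) ^ ?s * (\<Sum>i<N. \<Sum>j<N. (-1) ^ (e i * (p + e j + 1)) * (ham q s g i * (ham p r f j * ?X i j)))
      = (\<Sum>i<N. \<Sum>j<N. (-1) ^ (?s + e j * (p + e i + 1)) * (ham q s g j * (ham p r f i * ?X j i)))"
    by (subst sum.swap) (simp add: sum_distrib_left neg1_simps add_ac)
  also have "\<dots> = (\<Sum>i<N. \<Sum>j<N. (-1) ^ (e i * (q + e j + 1)) * ?F i j ((-1) ^ (e i * e j) * ?X j i))"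
  proof (intro sum.cong refl)
    fix i j assume "i \<in> {..<N}" "j \<in> {..<N}"
    then have ij: "i < N" "j < N" by auto
    have "ham q s g j * (ham p r f i * ?X j i)
        = (-1) ^ ((q + e j + 1) * (p + e i + 1)) * ?F i j (?X j i)"
      by (rule commute_left[OF H_ham[OF ij(2) g] H_ham[OF ij(1) f]])
    then have "(-1) ^ (?s + e j * (p + e i + 1)) * (ham q s g j * (ham p r f i * ?X j i))
        = sg (?s + e j * (p + e i + 1) + (q + e j + 1) * (p + e i + 1)) (?F i j (?X j i))"
      by (simp only: neg1_simps add_ac)
    also have "\<dots> = sg (e i * (q + e j + 1) + e i * e j) (?F i j (?X j i))"
      by (rule sg_cong) auto
    also have "\<dots> = (-1) ^ (e i * (q + e j + 1)) * ?F i j ((-1) ^ (e i * e j) * ?X j i)"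
      by (simp only: neg1_simps add_ac)
    finally show "(-1) ^ (?s + e j * (p + e i + 1)) * (ham q s g j * (ham p r f i * ?X j i))
        = (-1) ^ (e i * (q + e j + 1)) * ?F i j ((-1) ^ (e i * e j) * ?X j i)" .
  qed
  finally have second: "(\<Sum>i<N. \<Sum>j<N. (-1) ^ (e i * (q + e j + 1)) * ?F i j (?X i j))
      - (-1) ^ ?s * (\<Sum>i<N. \<Sum>j<N. (-1) ^ (e i * (p + e j + 1)) * (ham q s g i * (ham p r f j * ?X i j)))
    = (\<Sum>i<N. \<Sum>j<N. (-1) ^ (e i * (q + e j + 1)) * ?F i j (?X i j - (-1) ^ (e i * e j) * ?X j i))"
    by (simp add: right_diff_distrib sum_subtractf)
  also have "\<dots> = - (c t * (\<Sum>i<N. \<Sum>j<N. (-1) ^ (e i * (q + e j + 1)) * ?F i j (curv i j * h)))"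
  proof -
    have "?F i j (?X i j - (-1) ^ (e i * e j) * ?X j i) = - cs t (?F i j (curv i j * h))" if "i < N" "j < N" for i j
      unfolding nab_nab[OF that h] by (simp add: c_simps)
    then show ?thesis by (simp add: c_simps neg1_simps sum_negf cong: sum.cong_simp)
  qed
  finally have curvature: "(\<Sum>i<N. \<Sum>j<N. (-1) ^ (e i * (q + e j + 1)) * ?F i j (?X i j))
      - (-1) ^ ?s * (\<Sum>i<N. \<Sum>j<N. (-1) ^ (e i * (p + e j + 1)) * (ham q s g i * (ham p r f j * ?X i j)))
    = - (c t * (\<Sum>i<N. \<Sum>j<N. (-1) ^ (e i * (q + e j + 1)) * ?F i j (curv i j * h)))" .
  have first: "(\<Sum>j<N. (br p r f s (ham q s g j) - (-1) ^ ?s * br q s g r (ham p r f j)) * nab t j h)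
      = (\<Sum>j<N. br p r f s (ham q s g j) * nab t j h) - (-1) ^ ?s * (\<Sum>j<N. br q s g r (ham p r f j) * nab t j h)"
    by (simp only: left_diff_distrib sum_subtractf sum_distrib_left mult.assoc)
  have regroup: "(a + a') - \<sigma> * (b + b') = (a - \<sigma> * b) + (a' - \<sigma> * b')" for a a' b b' \<sigma> :: 'r
    by (simp add: distrib_left)
  show ?thesis
    unfolding br_br[OF f g h] br_br[OF g f h] regroup curvature first
    by (simp only: diff_conv_add_uminus)
qed

lemma ham_x: "a < N \<Longrightarrow> i < N \<Longrightarrow> ham (e a) 0 (x a) i = (-1) ^ e a * S a i"
proof -
  assume a: "a < N" "i < N"
  have "ham (e a) 0 (x a) i = (\<Sum>j<N. if j = a then (-1) ^ ((e i + 1) * e a) * (S i j * u) else 0)"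
    unfolding ham_def using a by (intro sum.cong) (auto simp: nab_weight_0 D_x)
  also have "\<dots> = (-1) ^ ((e i + 1) * e a) * S i a"
    using a u_right[OF H_S] by simp
  also have "\<dots> = (-1) ^ ((e i + 1) * e a + e i * e a) * S a i"
    using S_sym[of i a] a by (simp add: neg1_collect)
  also have "(-1) ^ ((e i + 1) * e a + e i * e a) = ((-1) ^ e a :: 'r)"
    by (rule neg1_cong) auto
  finally show ?thesis .
qed

lemma br_x_right: "a < N \<Longrightarrow> f \<in> H p \<Longrightarrow> br p r f 0 (x a) = ham p r f a"
proof -
  assume a: "a < N" "f \<in> H p"
  have "br p r f 0 (x a) = (\<Sum>j<N. if j = a then ham p r f j * u else 0)"
    unfolding br_def using a by (intro sum.cong) (auto simp: nab_weight_0 D_x)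
  also have "\<dots> = ham p r f a"
    using a u_right[OF H_ham] by simp
  finally show ?thesis .
qed

text \<open>Applied to the coordinate \<open>x a\<close> of weight 0, the commutator of the
  Hamiltonian fields is its own component \<open>C a\<close>, and the hypothesis says that this is
  the component of the field of the bracket. All first order terms therefore cancel for every h, and
  the curvature term is left.\<close>

lemma jac_from_coordinates:
  assumes f: "f \<in> H p" and g: "g \<in> H q" and h: "h \<in> H k"
    and J: "\<And>a. a < N \<Longrightarrow> jac p r f q s g 0 (x a) = 0"
  shows "jac p r f q s g t h
    = - (c t * (\<Sum>i<N. \<Sum>j<N. (-1) ^ (e i * (q + e j + 1)) * (ham p r f i * (ham q s g j * (curv i j * h)))))"
proof -
  define C where "C j = br p r f s (ham q s g j) - (-1) ^ ((p + 1) * (q + 1)) * br q s g r (ham p r f j)" for j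
  have "C a = ham (p + q + 1) (r + s) (br p r f s g) a" if a: "a < N" for a
  proof -
    have C: "C a \<in> H (p + q + e a)"
      unfolding C_def
      by (intro H_diff H_neg1 H_conv[OF H_br[OF f H_ham[OF a g]]] H_conv[OF H_br[OF g H_ham[OF a f]]]) auto
    have "(\<Sum>j<N. C j * nab 0 j (x a)) = (\<Sum>j<N. if j = a then C j * u else 0)"
      using a by (intro sum.cong) (auto simp: nab_weight_0 D_x)
    also have "\<dots> = C a" using a u_right[OF C] by simp
    finally have "br p r f (s + 0) (br q s g 0 (x a))
        - (-1) ^ ((p + 1) * (q + 1)) * br q s g (r + 0) (br p r f 0 (x a)) = C a"
      using commutator[OF f g H_x[OF a], of r s 0] by (simp add: C_def c_0)
    then show ?thesis
      using J[OF a] br_x_right[OF a H_br[OF f g]] by (simp add: jac_def)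
  qed
  then have "(\<Sum>j<N. C j * nab t j h) = br (p + q + 1) (r + s) (br p r f s g) t h"
    unfolding br_def[of "p + q + 1"] by simp
  then show ?thesis
    unfolding jac_def commutator[OF f g h] C_def by simp
qed

lemma jac_swap_left:
  assumes f: "f \<in> H p" and g: "g \<in> H q"
  shows "jac p r f q s g t h = - ((-1) ^ ((p + 1) * (q + 1)) * jac q s g p r f t h)"
proof -
  have "br (p + q + 1) (r + s) (br p r f s g) t h
      = - ((-1) ^ ((p + 1) * (q + 1)) * br (q + p + 1) (s + r) (br q s g r f) t h)"
    unfolding br_anti[OF f g, of r s]
    using br_uminus_left[OF H_neg1[OF H_br[OF g f]]] br_neg1_left[OF H_br[OF g f]]
    by (simp add: add.commute)
  moreover have "(-1) ^ ((p + 1) * (q + 1)) = (1 :: 'r) \<or> (-1) ^ ((p + 1) * (q + 1)) = (-1 :: 'r)"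
    by (cases "even ((p + 1) * (q + 1))") (simp_all del: even_mult_iff)
  ultimately show ?thesis
    unfolding jac_def mult.commute[of "q + 1" "p + 1"] by (elim disjE) (simp_all only: simp_thms, simp_all)
qed

text \<open>By antisymmetry of the bracket the nested term \<open>?T1\<close> reproduces itself,
  while \<open>?T2\<close> and \<open>?T3\<close> exchange their roles as the last and the middle
  term of the Jacobiator.\<close>

lemma jac_swap_right:
  assumes f: "f \<in> H p" and g: "g \<in> H q" and h: "h \<in> H k"
  shows "jac p r f q s g t h = - ((-1) ^ ((q + 1) * (k + 1)) * jac p r f k t h s g)"
proof -
  let ?T1 = "br p r f (s + t) (br q s g t h)"
  let ?T2 = "br (p + q + 1) (r + s) (br p r f s g) t h"
  let ?T3 = "br q s g (r + t) (br p r f t h)"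
  have 1: "br p r f (t + s) (br k t h s g) = - ((-1) ^ ((k + 1) * (q + 1)) * ?T1)"
    unfolding br_anti[OF h g, of t s]
    using br_uminus_right[OF H_neg1[OF H_br[OF g h]]] br_neg1_right[OF H_br[OF g h]]
    by (simp add: add.commute)
  have 2: "br k t h (r + s) (br p r f s g) = - ((-1) ^ ((k + 1) * (p + q + 1 + 1)) * ?T2)"
    by (rule br_anti[OF h H_br[OF f g]])
  have 3: "br (p + k + 1) (r + t) (br p r f t h) s g = - ((-1) ^ ((p + k + 1 + 1) * (q + 1)) * ?T3)"
    by (rule br_anti[OF H_br[OF f h] g])
  have "jac p r f k t h s g = - ((-1) ^ ((k + 1) * (q + 1)) * ?T1)
      + (-1) ^ ((p + 1) * (k + 1) + (k + 1) * (p + q + 1 + 1)) * ?T2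
      + (-1) ^ ((p + k + 1 + 1) * (q + 1)) * ?T3"
    unfolding jac_def 1 2 3 by (simp add: neg1_collect)
  also have "(-1) ^ ((p + 1) * (k + 1) + (k + 1) * (p + q + 1 + 1)) = ((-1) ^ ((q + 1) * (k + 1)) :: 'r)"
    by (rule neg1_cong) auto
  also have "(-1) ^ ((p + k + 1 + 1) * (q + 1)) = ((-1) ^ ((q + 1) * (k + 1) + (p + 1) * (q + 1)) :: 'r)"
    by (rule neg1_cong) auto
  also have "(-1) ^ ((k + 1) * (q + 1)) = ((-1) ^ ((q + 1) * (k + 1)) :: 'r)"
    by (simp add: mult.commute)
  finally have "- ((-1) ^ ((q + 1) * (k + 1)) * jac p r f k t h s g)
      = (-1) ^ ((q + 1) * (k + 1) + (q + 1) * (k + 1)) * ?T1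
        - (-1) ^ ((q + 1) * (k + 1) + (q + 1) * (k + 1)) * ?T2
        - (-1) ^ ((q + 1) * (k + 1) + ((q + 1) * (k + 1) + (p + 1) * (q + 1))) * ?T3"
    by (simp add: ring_distribs neg1_collect)
  also have "\<dots> = jac p r f q s g t h"
  proof -
    have "(-1) ^ ((q + 1) * (k + 1) + (q + 1) * (k + 1)) = (1 :: 'r)"
      "(-1) ^ ((q + 1) * (k + 1) + ((q + 1) * (k + 1) + (p + 1) * (q + 1))) = ((-1) ^ ((p + 1) * (q + 1)) :: 'r)"
      by (simp, rule neg1_cong, simp only: even_add, blast)
    then show ?thesis unfolding jac_def by (simp add: algebra_simps)
  qed
  finally show ?thesis ..
qed

text \<open>Without curvature, vanishing with a coordinate in the last place implies vanishing with
  anything there. The graded symmetries bring each argument to the last place, so the coordinates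
  are replaced one at a time by arbitrary densities.\<close>

lemma jac_eq_0:
  assumes J: "\<And>a b d. a < N \<Longrightarrow> b < N \<Longrightarrow> d < N \<Longrightarrow> jac (e a) 0 (x a) (e b) 0 (x b) 0 (x d) = 0"
    and flat: "\<And>i j. i < N \<Longrightarrow> j < N \<Longrightarrow> curv i j = 0"
    and f: "f \<in> H p" and g: "g \<in> H q" and h: "h \<in> H k"
  shows "jac p r f q s g t h = 0"
proof -
  have lift: "jac p r f q s g t h = 0"
    if "f \<in> H p" "g \<in> H q" "h \<in> H k" "\<And>a. a < N \<Longrightarrow> jac p r f q s g 0 (x a) = 0" for p r f q s g k t h
    using jac_from_coordinates[OF that(1-3), of r s t] that(4) flat by (simp cong: sum.cong_simp)
  have 1: "jac (e a) 0 (x a) (e b) 0 (x b) t h = 0" if "a < N" "b < N" "h \<in> H k" for a b k t h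
    by (rule lift[OF H_x[OF that(1)] H_x[OF that(2)] that(3) J[OF that(1,2)]])
  have 2: "jac (e a) 0 (x a) q s g t h = 0" if "a < N" "g \<in> H q" "h \<in> H k" for a q k s t g h
    by (rule lift[OF H_x[OF that(1)] that(2,3)], subst jac_swap_right[OF H_x[OF that(1)] that(2) H_x])
      (use 1 that in auto)
  have 3: "jac p r f (e a) 0 (x a) t h = 0" if "a < N" "f \<in> H p" "h \<in> H k" for a p k r t f h
    by (subst jac_swap_left[OF that(2) H_x[OF that(1)]]) (use 2 that in auto)
  show ?thesis
    by (rule lift[OF f g h], subst jac_swap_right[OF f g H_x]) (use 3 f g in auto)
qed

section \<open>Consequences of the invertibility of S\<close>

context
  fixes T :: "nat \<Rightarrow> nat \<Rightarrow> 'r"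
  assumes T: "\<And>i k. i < N \<Longrightarrow> k < N \<Longrightarrow> (\<Sum>j<N. T i j * S j k) = (if i = k then u else 0)"
begin

text \<open>The left inverse \<open>T\<close> recovers each \<open>y k\<close> up to the factor
  \<open>u\<close>; membership of \<open>y k\<close> in some \<open>H q\<close> makes
  \<open>u\<close> act on it as the identity.\<close>

lemma S_injective:
  assumes y: "\<And>b. b < N \<Longrightarrow> (\<Sum>j<N. S b j * y j) = 0" and H: "\<And>j. j < N \<Longrightarrow> y j \<in> H (q j)" and k: "k < N"
  shows "y k = 0"
proof -
  have "0 = (\<Sum>b<N. T k b * (\<Sum>j<N. S b j * y j))" using y by simp
  also have "\<dots> = (\<Sum>j<N. (\<Sum>b<N. T k b * S b j) * y j)"
    by (simp add: sum_distrib_left sum_distrib_right mult.assoc, rule sum.swap)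
  also have "\<dots> = (\<Sum>j<N. if j = k then u * y j else 0)"
    using T k by (intro sum.cong) auto
  also have "\<dots> = y k" using k u_left[OF H[OF k]] by simp
  finally show ?thesis ..
qed

lemma H_curv: "i < N \<Longrightarrow> j < N \<Longrightarrow> curv i j \<in> H (e i + e j)"
  unfolding curv_def using H_D[OF _ H_A, of i j] H_D[OF _ H_A, of j i]
  by (auto intro!: H_diff H_neg1 simp: add.commute)

text \<open>On x^a, x^b, |Dx| the Jacobiator is the curvature contracted with two copies of
  \<open>S\<close>, which are cancelled one after the other.\<close>

lemma curv_eq_0:
  assumes J: "\<And>a b d. a < N \<Longrightarrow> b < N \<Longrightarrow> d < N \<Longrightarrow> jac (e a) 0 (x a) (e b) 0 (x b) 0 (x d) = 0"
    and J1: "\<And>a b. a < N \<Longrightarrow> b < N \<Longrightarrow> jac (e a) 0 (x a) (e b) 0 (x b) 1 u = 0"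
    and k: "k < N" and l: "l < N"
  shows "curv k l = 0"
proof -
  have "(\<Sum>i<N. S a i * (\<Sum>j<N. (-1) ^ (e i * (e b + e j + 1)) * (S b j * curv i j))) = 0"
    if a: "a < N" and b: "b < N" for a b
  proof -
    have "(\<Sum>i<N. \<Sum>j<N. (-1) ^ (e i * (e b + e j + 1)) * (ham (e a) 0 (x a) i * (ham (e b) 0 (x b) j * (curv i j * u)))) = 0"
      using jac_from_coordinates[OF H_x[OF a] H_x[OF b] H_u J[OF a b], of 1] J1[OF a b] by (simp add: c_1)
    also have "(\<Sum>i<N. \<Sum>j<N. (-1) ^ (e i * (e b + e j + 1)) * (ham (e a) 0 (x a) i * (ham (e b) 0 (x b) j * (curv i j * u))))
        = (-1) ^ (e a + e b) * (\<Sum>i<N. S a i * (\<Sum>j<N. (-1) ^ (e i * (e b + e j + 1)) * (S b j * curv i j)))"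
      unfolding sum_distrib_left using a b
      by (intro sum.cong refl) (simp add: ham_x u_right[OF H_curv] neg1_simps add_ac)
    finally show ?thesis
      by (cases "even (e a + e b)") (simp_all del: even_add)
  qed
  moreover have "(\<Sum>j<N. (-1) ^ (e i * (e b + e j + 1)) * (S b j * curv i j)) \<in> H (e b + e i + 1)"
    if "i < N" "b < N" for i b
  proof (intro H_sum H_neg1)
    fix j assume "j \<in> {..<N}"
    then have "S b j * curv i j \<in> H ((e b + e j + 1) + (e i + e j))" using that by (intro H_mult H_S H_curv) auto
    then show "S b j * curv i j \<in> H (e b + e i + 1)" by (rule H_conv) auto
  qed
  ultimately have "(\<Sum>j<N. (-1) ^ (e i * (e b + e j + 1)) * (S b j * curv i j)) = 0" if "i < N" "b < N" for i b
    using that S_injective[of "\<lambda>i. \<Sum>j<N. (-1) ^ (e i * (e b + e j + 1)) * (S b j * curv i j)" "\<lambda>i. e b + e i + 1" i]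
    by auto
  \<comment> \<open>Multiplication by this sign makes the signs under the sum independent of b, so
    that \<open>S_injective\<close> can be applied a second time.\<close>
  then have "(-1) ^ (e k * (e b + 1)) * (\<Sum>j<N. (-1) ^ (e k * (e b + e j + 1)) * (S b j * curv k j)) = 0"
    if "b < N" for b
    using that k by simp
  moreover have "sg (e k + e k * (e b + e j) + (e k + e k * e b)) y = sg (e k * e j) y" for b j and y :: 'r
    by (rule sg_cong) auto
  ultimately have "(\<Sum>j<N. S b j * ((-1) ^ (e k * e j) * curv k j)) = 0" if "b < N" for b
    using that by (simp add: sum_distrib_left neg1_simps)
  then have "(-1) ^ (e k * e l) * curv k l = 0"
    by (rule S_injective[where q = "\<lambda>j. e k + e j"]) (auto intro: H_neg1 H_curv k l)
  then show ?thesis by (cases "even (e k * e l)") auto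
qed

end

text \<open>The bracket of densities with an additional term \<open>\<Theta> |Dx|\<^sup>2\<close> in \<open>{|Dx|, |Dx|}\<close>.\<close>

definition dbr :: "'r \<Rightarrow> nat \<Rightarrow> real \<Rightarrow> 'r \<Rightarrow> real \<Rightarrow> 'r \<Rightarrow> 'r" where
  "dbr \<Theta> p r f s g = br p r f s g + c (r * s) * (f * (\<Theta> * g))"

definition djac :: "'r \<Rightarrow> nat \<Rightarrow> real \<Rightarrow> 'r \<Rightarrow> nat \<Rightarrow> real \<Rightarrow> 'r \<Rightarrow> real \<Rightarrow> 'r \<Rightarrow> 'r" where
  "djac \<Theta> p r f q s g t h = dbr \<Theta> p r f (s + t) (dbr \<Theta> q s g t h)
     - (-1) ^ ((p + 1) * (q + 1)) * dbr \<Theta> q s g (r + t) (dbr \<Theta> p r f t h)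
     - dbr \<Theta> (p + q + 1) (r + s) (dbr \<Theta> p r f s g) t h"

lemma dbr_weight_0 [simp]: "dbr \<Theta> p 0 f s g = br p 0 f s g" "dbr \<Theta> p r f 0 g = br p r f 0 g"
  by (simp_all add: dbr_def c_0)

lemma dbr_Theta_0: "dbr 0 p r f s g = br p r f s g"
  by (simp add: dbr_def)

text \<open>Subtracting the two Jacobi identities on x^a, |Dx|, |Dx| leaves the terms linear in
  \<Theta>. The bracket of x^a with \<Theta> |Dx|^2 contributes twice \<Theta> times y by the
  Leibniz rule, and the other two terms contribute the same. Hence the Hamiltonian field of x^a
  annihilates \<Theta>, and \<open>S\<close> can be cancelled.\<close>

lemma D_Theta_eq_0:
  assumes Theta: "\<Theta> \<in> H 1"
    and T: "\<And>i k. i < N \<Longrightarrow> k < N \<Longrightarrow> (\<Sum>j<N. T i j * S j k) = (if i = k then u else 0)"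
    and jac: "\<And>a. a < N \<Longrightarrow> jac (e a) 0 (x a) 0 1 u 1 u = 0"
    and djac: "\<And>a. a < N \<Longrightarrow> djac \<Theta> (e a) 0 (x a) 0 1 u 1 u = 0"
    and i: "i < N"
  shows "D i \<Theta> = 0"
proof -
  have "(\<Sum>i<N. S a i * D i \<Theta>) = 0" if a: "a < N" for a
  proof -
    let ?x = "x a" and ?e = "e a"
    define y where "y = br ?e 0 ?x 1 u"
    have y: "y \<in> H (?e + 0 + 1)" unfolding y_def by (rule H_br[OF H_x[OF a] H_u])
    have uu: "br 0 1 u 1 u \<in> H 1" using H_br[OF H_u H_u, of 1 1] by simp
    have "djac \<Theta> ?e 0 ?x 0 1 u 1 u = br ?e 0 ?x 2 (br 0 1 u 1 u + \<Theta>)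
        - (-1) ^ (?e + 1) * (br 0 1 u 1 y + \<Theta> * y) - (br (?e + 0 + 1) 1 y 1 u + y * \<Theta>)"
      using u_left[OF Theta] u_right[OF Theta] u_left[OF H_mult[OF Theta y]]
      by (simp add: djac_def dbr_def[of \<Theta> _ 1] c_1 y_def)
    moreover have "jac ?e 0 ?x 0 1 u 1 u = br ?e 0 ?x 2 (br 0 1 u 1 u)
        - (-1) ^ (?e + 1) * br 0 1 u 1 y - br (?e + 0 + 1) 1 y 1 u"
      by (simp add: jac_def y_def)
    ultimately have "br ?e 0 ?x 2 \<Theta> = (-1) ^ (?e + 1) * (\<Theta> * y) + y * \<Theta>"
      using jac[OF a] djac[OF a] br_add_right[OF uu Theta, of ?e 0 ?x 2] by (simp add: algebra_simps)
    moreover have "y * \<Theta> = (-1) ^ (?e + 1) * (\<Theta> * y)"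
      using commute[OF y Theta] by simp
    moreover have "br ?e 0 ?x 2 u = y + y"
      using br_mult[OF H_x[OF a] H_u H_u, of 0 1 1] u_left[OF H_u] u_left[OF y] u_right[OF y]
      by (simp add: y_def)
    moreover have "br ?e 0 ?x (0 + 2) (\<Theta> * u)
        = br ?e 0 ?x 0 \<Theta> * u + (-1) ^ ((?e + 1) * 1) * (\<Theta> * br ?e 0 ?x 2 u)"
      by (rule br_mult[OF H_x[OF a] Theta H_u])
    moreover have "br ?e 0 ?x 0 \<Theta> * u = br ?e 0 ?x 0 \<Theta>"
      by (rule u_right[OF H_br[OF H_x[OF a] Theta]])
    ultimately have "br ?e 0 ?x 0 \<Theta> = 0"
      using u_right[OF Theta] by (simp add: ring_distribs)
    then have "(-1) ^ ?e * (\<Sum>i<N. S a i * D i \<Theta>) = 0"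
      unfolding br_def using a by (simp add: ham_x nab_weight_0 sum_distrib_left mult.assoc)
    then show ?thesis by (cases "even ?e") auto
  qed
  then show ?thesis
    by (intro S_injective[where T = T and y = "\<lambda>i. D i \<Theta>" and q = "\<lambda>i. 1 + e i" and k = i])
      (use T H_D[OF _ Theta] i in auto)
qed

text \<open>Sorts the bracket by powers of the weights, in the shape of
  \<open>dens_coeff_bracket\<close>. The bracket defined by A has {x^i, |Dx|} = -S^{ij} A_j |Dx| and
  {|Dx|, |Dx|} = S^{ij} A_j A_i |Dx|^2.\<close>

lemma br_components:
  assumes f: "f \<in> H p" and g: "g \<in> H q"
  shows "br p r f s g = (\<Sum>i<N. \<Sum>j<N. (-1) ^ ((e i + 1) * p) * (S i j * (D j f * D i g)))
    + c r * (f * (\<Sum>i<N. (- (\<Sum>j<N. S i j * A j)) * D i g))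
    + c s * ((-1) ^ p * ((\<Sum>i<N. (- (\<Sum>j<N. S i j * A j)) * D i f) * g))
    + c (r * s) * (f * ((\<Sum>i<N. \<Sum>j<N. S i j * (A j * A i)) * g))"
proof -
  have move: "(-1) ^ ((e i + 1) * p) * (S i j * (A j * (f * y))) = f * (S i j * (A j * y))"
    if ij: "i < N" "j < N" for i j y
  proof -
    have "S i j * A j \<in> H (e i + 1)"
      using H_mult[OF H_S[OF ij] H_A[OF ij(2)]] by (rule H_conv) auto
    from commute_left[OF f this] have "f * (S i j * (A j * y)) = (-1) ^ (p * (e i + 1)) * (S i j * (A j * (f * y)))"
      by (simp add: mult.assoc)
    then show ?thesis by (simp add: mult.commute)
  qed
  have "br p r f s g = (\<Sum>i<N. \<Sum>j<N. (-1) ^ ((e i + 1) * p) * (S i j * ((D j f - c r * (A j * f)) * (D i g - c s * (A i * g)))))"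
    unfolding br_def ham_def nab_def by (simp add: sum_distrib_right neg1_simps)
  also have "\<dots> = (\<Sum>i<N. \<Sum>j<N. (-1) ^ ((e i + 1) * p) * (S i j * (D j f * D i g)))
     - c r * (\<Sum>i<N. \<Sum>j<N. (-1) ^ ((e i + 1) * p) * (S i j * (A j * (f * D i g))))
     - c s * (\<Sum>i<N. \<Sum>j<N. (-1) ^ ((e i + 1) * p) * (S i j * (D j f * (A i * g))))
     + c (r * s) * (\<Sum>i<N. \<Sum>j<N. (-1) ^ ((e i + 1) * p) * (S i j * (A j * (f * (A i * g)))))"
    by (simp add: sum.distrib sum_subtractf ring_distribs c_simps neg1_simps)
  also have "(\<Sum>i<N. \<Sum>j<N. (-1) ^ ((e i + 1) * p) * (S i j * (A j * (f * D i g))))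
     = f * (\<Sum>i<N. (\<Sum>j<N. S i j * A j) * D i g)"
    unfolding sum_distrib_left sum_distrib_right
    by (intro sum.cong refl) (simp only: lessThan_iff mult.assoc move)
  \<comment> \<open>Here A carries the first index of \<open>S\<close>. Symmetry of \<open>S\<close>
    and an exchange of the sums bring it to the second one, so that the same components -S^{ij} A_j
    appear again.\<close>
  also have "(\<Sum>i<N. \<Sum>j<N. (-1) ^ ((e i + 1) * p) * (S i j * (D j f * (A i * g))))
     = (\<Sum>i<N. \<Sum>j<N. (-1) ^ p * (S j i * (A i * (D j f * g))))"
  proof (intro sum.cong refl)
    fix i j assume "i \<in> {..<N}" "j \<in> {..<N}"
    then have ij: "i < N" "j < N" by auto
    have "A i * (D j f * g) = (-1) ^ (e i * (p + e j)) * (D j f * (A i * g))"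
      by (rule commute_left[OF H_A[OF ij(1)] H_D[OF ij(2) f]])
    then have "(-1) ^ p * (S j i * (A i * (D j f * g)))
        = (-1) ^ (p + e j * e i + e i * (p + e j)) * (S i j * (D j f * (A i * g)))"
      unfolding S_sym[OF ij(2,1)] by (simp only: neg1_simps add_ac)
    also have "(-1) ^ (p + e j * e i + e i * (p + e j)) = ((-1) ^ ((e i + 1) * p) :: 'r)"
      by (rule neg1_cong) auto
    finally show "(-1) ^ ((e i + 1) * p) * (S i j * (D j f * (A i * g))) = (-1) ^ p * (S j i * (A i * (D j f * g)))" ..
  qed
  also have "\<dots> = (-1) ^ p * ((\<Sum>i<N. (\<Sum>j<N. S i j * A j) * D i f) * g)"
    by (subst sum.swap) (simp add: sum_distrib_left sum_distrib_right mult.assoc)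
  also have "(\<Sum>i<N. \<Sum>j<N. (-1) ^ ((e i + 1) * p) * (S i j * (A j * (f * (A i * g)))))
     = f * ((\<Sum>i<N. \<Sum>j<N. S i j * (A j * A i)) * g)"
    unfolding sum_distrib_left sum_distrib_right
    by (intro sum.cong refl) (simp only: lessThan_iff mult.assoc move)
  finally show ?thesis
    by (simp add: sum_negf)
qed

end

section \<open>The Poincare lemma\<close>

text \<open>Cubes are used because a path parallel to the axes from the centre stays inside, and
  they contain arbitrarily small neighbourhoods in the product topology.\<close>

definition cube :: "nat \<Rightarrow> (nat \<Rightarrow> real) \<Rightarrow> real \<Rightarrow> (nat \<Rightarrow> real) set" where
  "cube n a d = {x. (\<forall>i<n. \<bar>x i - a i\<bar> < d) \<and> (\<forall>i\<ge>n. x i = 0)}"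

lemma openin_cube: "openin (Euclidean_space n) (cube n a d)"
proof -
  let ?W = "\<Inter>i\<in>{..<n}. {x :: nat \<Rightarrow> real. \<bar>x i - a i\<bar> < d}"
  have "open ?W"
    by (intro open_INT ballI finite_lessThan open_Collect_less continuous_intros
        continuous_on_product_coordinates)
  moreover have "cube n a d = ?W \<inter> {x. \<forall>i\<ge>n. x i = 0}"
    by (auto simp: cube_def)
  ultimately have "\<exists>W. open W \<and> cube n a d = W \<inter> {x. \<forall>i\<ge>n. x i = 0}"
    by (intro exI[of _ ?W] conjI)
  then show ?thesis
    by (simp add: Euclidean_space_def openin_subtopology euclidean_product_topology flip: open_openin)
qed

lemma (in euclidean_domain) cube_in_U:
  assumes "a \<in> U"
  obtains d where "d > 0" "cube n a d \<subseteq> U"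
proof -
  obtain W where W: "open W" "U = W \<inter> {x. \<forall>i\<ge>n. x i = 0}" using U_open_ex by blast
  have "openin (product_topology (\<lambda>i::nat. euclidean :: real topology) UNIV) W"
    using W(1) by (simp add: euclidean_product_topology flip: open_openin)
  moreover have "a \<in> W" using assms W(2) by simp
  ultimately obtain X where
    X: "a \<in> (\<Pi>\<^sub>E i\<in>UNIV. X i)" "\<And>i. open (X i)" "(\<Pi>\<^sub>E i\<in>UNIV. X i) \<subseteq> W"
    using product_topology_open_contains_basis[of "\<lambda>i::nat. euclidean :: real topology" UNIV W a]
    by (auto simp flip: open_openin)
  have "\<exists>e>0. \<forall>t. \<bar>t - a i\<bar> < e \<longrightarrow> t \<in> X i" for i
    using X(1) X(2)[of i] unfolding open_dist by (auto simp: dist_real_def PiE_iff)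
  then obtain e where e: "\<And>i. e i > 0" "\<And>i t. \<bar>t - a i\<bar> < e i \<Longrightarrow> t \<in> X i" by metis
  \<comment> \<open>Only the first n coordinates bound d, since from n on both points have
    coordinate 0. The inserted 1 keeps \<open>Min\<close> meaningful for n = 0.\<close>
  define d where "d = Min (insert 1 (e ` {..<n}))"
  have "d > 0" using e(1) by (auto simp: d_def)
  moreover have "cube n a d \<subseteq> U"
  proof
    fix x assume x: "x \<in> cube n a d"
    have "x i \<in> X i" for i
    proof (cases "i < n")
      case True
      then have "d \<le> e i" by (auto simp: d_def intro!: Min_le)
      then show ?thesis using x True by (intro e(2)) (auto simp: cube_def)
    next
      case False
      then show ?thesis
        using x assms U_support[of a i] e(1)[of i] by (intro e(2)) (auto simp: cube_def)
    qed
    then have "x \<in> W" using X(3) by auto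
    then show "x \<in> U" using x W(2) by (auto simp: cube_def)
  qed
  ultimately show ?thesis using that by blast
qed

lemma has_integral_derivative:
  fixes F :: "real \<Rightarrow> real"
  assumes "a \<le> b" "\<And>s. s \<in> {a..b} \<Longrightarrow> (F has_real_derivative f s) (at s)"
  shows "(f has_integral F b - F a) {a..b}"
  using assms
  by (intro fundamental_theorem_of_calculus)
    (auto simp: has_real_derivative_iff_has_vector_derivative[symmetric] has_field_derivative_at_within)

section \<open>Closed one-forms in the even variables\<close>

locale closed_form_on_cube =
  fixes n :: nat and a :: "nat \<Rightarrow> real" and d :: real and \<alpha> :: "nat \<Rightarrow> (nat \<Rightarrow> real) \<Rightarrow> real"
  assumes d: "d > 0" and a: "\<And>i. i \<ge> n \<Longrightarrow> a i = 0"
    and smooth: "i < n \<Longrightarrow> smooth_fun n (cube n a d) (\<alpha> i)"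
    and closed_form: "i < n \<Longrightarrow> j < n \<Longrightarrow> x \<in> cube n a d \<Longrightarrow> rpd i (\<alpha> j) x = rpd j (\<alpha> i) x"
begin

abbreviation Q :: "(nat \<Rightarrow> real) set" where "Q \<equiv> cube n a d"

sublocale euclidean_domain n Q
  by unfold_locales (rule openin_cube)

text \<open>\<open>cut k x\<close> is the k-th corner of the path from the centre to x parallel to
  the axes; \<open>seg k x\<close> below is the edge joining it to the next corner.\<close>

definition cut :: "nat \<Rightarrow> (nat \<Rightarrow> real) \<Rightarrow> nat \<Rightarrow> real" where
  "cut k x = (\<lambda>i. if i < k then x i else a i)"

definition seg :: "nat \<Rightarrow> (nat \<Rightarrow> real) \<Rightarrow> real \<Rightarrow> nat \<Rightarrow> real" where
  "seg k x s = (cut k x)(k := a k + s * (x k - a k))"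

text \<open>The integral of the form along the path from the centre to \<open>x\<close> parallel to the axes.\<close>

primrec potential :: "nat \<Rightarrow> (nat \<Rightarrow> real) \<Rightarrow> real" where
  "potential 0 x = 0"
| "potential (Suc k) x = potential k x + integral {0..1} (\<lambda>s. (x k - a k) * \<alpha> k (seg k x s))"

lemma cut_upd: "k \<le> i \<Longrightarrow> cut k (x(i := t)) = cut k x"
  and cut_upd_less: "i < k \<Longrightarrow> cut k (x(i := t)) = (cut k x)(i := t)"
  and cut_Suc: "cut (Suc k) x = (cut k x)(k := x k)"
  by (auto simp: cut_def fun_eq_iff)

lemma cut_all: "x \<in> Q \<Longrightarrow> cut n x = x"
  using a by (auto simp: cut_def fun_eq_iff cube_def)

lemma cut_in_Q: "x \<in> Q \<Longrightarrow> k \<le> n \<Longrightarrow> cut k x \<in> Q"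
  using a d by (auto simp: cut_def cube_def)

lemma upd_in_Q: "x \<in> Q \<Longrightarrow> i < n \<Longrightarrow> \<bar>t - a i\<bar> < d \<Longrightarrow> x(i := t) \<in> Q"
  by (auto simp: cube_def)

lemma segment_bound: "\<bar>y - a i\<bar> < d \<Longrightarrow> s \<in> {0..1} \<Longrightarrow> \<bar>a i + s * (y - a i) - a i\<bar> < d"
proof -
  assume y: "\<bar>y - a i\<bar> < d" and s: "s \<in> {0..1}"
  have "\<bar>s * (y - a i)\<bar> \<le> 1 * \<bar>y - a i\<bar>"
    unfolding abs_mult using s by (intro mult_right_mono) auto
  then show ?thesis using y by simp
qed

lemma seg_in_Q: "x \<in> Q \<Longrightarrow> k < n \<Longrightarrow> s \<in> {0..1} \<Longrightarrow> seg k x s \<in> Q"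
  unfolding seg_def by (intro upd_in_Q cut_in_Q segment_bound) (auto simp: cube_def)

lemma continuous_on_seg:
  assumes "continuous_on X f" "continuous_on X g"
  shows "continuous_on X (\<lambda>p. seg k (f p) (g p :: real))"
proof (rule continuous_on_coordinatewise_then_product)
  fix j
  have f: "continuous_on X (\<lambda>p. f p j)" for j
    using assms(1) by (rule continuous_on_product_then_coordinatewise)
  consider "j = k" | "j < k" | "j > k" by linarith
  then show "continuous_on X (\<lambda>p. seg k (f p) (g p) j)"
  proof cases
    case 1
    then have "(\<lambda>p. seg k (f p) (g p) j) = (\<lambda>p. a k + g p * (f p k - a k))" by (simp add: seg_def)
    then show ?thesis by (simp only:) (intro continuous_intros assms(2) f)
  next
    case 2
    then have "(\<lambda>p. seg k (f p) (g p) j) = (\<lambda>p. f p j)" by (simp add: seg_def cut_def)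
    then show ?thesis by (simp only: f)
  next
    case 3
    then have "(\<lambda>p. seg k (f p) (g p) j) = (\<lambda>p. a j)" by (simp add: seg_def cut_def)
    then show ?thesis by (simp only: continuous_on_const)
  qed
qed

lemma continuous_on_\<alpha>_seg:
  assumes "continuous_on X f" "continuous_on X g" "\<And>p. p \<in> X \<Longrightarrow> f p \<in> Q" "\<And>p. p \<in> X \<Longrightarrow> g p \<in> {0..1}"
    and "smooth_fun n Q h" "k < n"
  shows "continuous_on X (\<lambda>p. h (seg k (f p) (g p)))"
  by (rule continuous_on_compose2[OF smooth_fun_continuous[OF assms(5)] continuous_on_seg[OF assms(1,2)]])
    (use assms seg_in_Q in auto)

lemma potential_upd: "k \<le> i \<Longrightarrow> potential k (x(i := t)) = potential k x"
  by (induction k) (auto simp: seg_def cut_upd)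

lemma continuous_potential: "k \<le> n \<Longrightarrow> continuous_on Q (potential k)"
proof (induction k)
  case (Suc k)
  have "continuous_on (Q \<times> cbox 0 1) (\<lambda>(x, s). (x k - a k) * \<alpha> k (seg k x s))"
    unfolding split_beta
  proof (rule continuous_on_mult)
    show "continuous_on (Q \<times> cbox 0 1) (\<lambda>p. fst p k - a k)"
      by (intro continuous_intros continuous_on_product_then_coordinatewise[of _ fst])
    show "continuous_on (Q \<times> cbox 0 1) (\<lambda>p. \<alpha> k (seg k (fst p) (snd p)))"
      by (rule continuous_on_\<alpha>_seg[where h = "\<alpha> k" and f = fst and g = snd])
        (use Suc.prems smooth in \<open>auto intro: continuous_on_fst continuous_on_snd continuous_on_id\<close>)
  qed
  then have "continuous_on Q (\<lambda>x. integral (cbox 0 1) (\<lambda>s. (x k - a k) * \<alpha> k (seg k x s)))"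
    by (rule integral_continuous_on_param)
  then show ?case using Suc by (auto intro!: continuous_intros)
qed simp

lemma has_derivative_segment:
  assumes "smooth_fun n Q h" "k < n" "x \<in> Q" "\<bar>y - a k\<bar> < d" "s \<in> {0..1}"
  shows "((\<lambda>s. h ((cut k x)(k := a k + s * (y - a k)))) has_real_derivative
      (y - a k) * rpd k h ((cut k x)(k := a k + s * (y - a k)))) (at s)"
proof -
  have "(cut k x)(k := a k + s * (y - a k)) \<in> Q"
    using assms by (intro upd_in_Q cut_in_Q segment_bound) auto
  note * = has_rpd[OF assms(1,2) this]
  have "((\<lambda>s. a k + s * (y - a k)) has_real_derivative (y - a k)) (at s)"
    by (auto intro!: derivative_eq_intros)
  from DERIV_chain2[OF * this] show ?thesis by (simp add: mult.commute)
qed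

lemma has_derivative_segment_end:
  assumes "smooth_fun n Q h" "k < n" "x \<in> Q" "\<bar>y - a k\<bar> < d" "s \<in> {0..1}"
  shows "((\<lambda>y. h ((cut k x)(k := a k + s * (y - a k)))) has_real_derivative
      s * rpd k h ((cut k x)(k := a k + s * (y - a k)))) (at y)"
proof -
  have "(cut k x)(k := a k + s * (y - a k)) \<in> Q"
    using assms by (intro upd_in_Q cut_in_Q segment_bound) auto
  note * = has_rpd[OF assms(1,2) this]
  have "((\<lambda>y. a k + s * (y - a k)) has_real_derivative s) (at y)"
    by (auto intro!: derivative_eq_intros)
  from DERIV_chain2[OF * this] show ?thesis by (simp add: mult.commute)
qed

lemma open_interval: "open {t. \<bar>t - a i\<bar> < d}" "convex {t. \<bar>t - a i\<bar> < d}"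
proof -
  have "{t. \<bar>t - a i\<bar> < d} = ball (a i) d" by (auto simp: dist_real_def)
  then show "open {t. \<bar>t - a i\<bar> < d}" "convex {t. \<bar>t - a i\<bar> < d}" by simp_all
qed

text \<open>Under the integral, closedness replaces the i-th derivative of \<open>\<alpha> k\<close>
  by the k-th derivative of \<open>\<alpha> i\<close>. The integrand becomes a derivative along the
  edge, and its integral is the difference of \<open>\<alpha> i\<close> at the two corners.\<close>

lemma deriv_integral_less:
  assumes x: "x \<in> Q" and k: "k < n" and i: "i < k"
  shows "((\<lambda>t. integral {0..1} (\<lambda>s. ((x(i := t)) k - a k) * \<alpha> k (seg k (x(i := t)) s))) has_real_derivative
      \<alpha> i (cut (Suc k) x) - \<alpha> i (cut k x)) (at (x i))"
proof -
  let ?I = "{t. \<bar>t - a i\<bar> < d}"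
  have xi: "x i \<in> ?I" and xk: "\<bar>x k - a k\<bar> < d" using x i k by (auto simp: cube_def)
  have xt: "x(i := t) \<in> Q" if "t \<in> ?I" for t using that x i k by (intro upd_in_Q) auto
  have segt: "seg k (x(i := t)) s = (seg k x s)(i := t)" for t s
    using i by (auto simp: seg_def cut_upd_less fun_upd_twist)
  have "((\<lambda>t. integral (cbox 0 1) (\<lambda>s. (x k - a k) * \<alpha> k (seg k (x(i := t)) s))) has_real_derivative
      integral (cbox 0 1) (\<lambda>s. (x k - a k) * rpd i (\<alpha> k) (seg k (x(i := x i)) s))) (at (x i) within ?I)"
  proof (rule leibniz_rule_field_derivative[OF _ _ _ xi open_interval(2)])
    fix t s :: real assume "t \<in> ?I" "s \<in> cbox 0 1"
    then have "seg k (x(i := t)) s \<in> Q" using k xt by (intro seg_in_Q) auto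
    then have "(seg k x s)(i := t) \<in> Q" by (simp only: segt)
    then have "((\<lambda>t. \<alpha> k ((seg k x s)(i := t))) has_real_derivative rpd i (\<alpha> k) ((seg k x s)(i := t))) (at t)"
      using i k by (intro has_rpd[OF smooth[OF k]]) auto
    then have "((\<lambda>t. \<alpha> k (seg k (x(i := t)) s)) has_real_derivative rpd i (\<alpha> k) (seg k (x(i := t)) s)) (at t)"
      by (simp only: segt)
    then show "((\<lambda>t. (x k - a k) * \<alpha> k (seg k (x(i := t)) s)) has_real_derivative
        (x k - a k) * rpd i (\<alpha> k) (seg k (x(i := t)) s)) (at t within ?I)"
      by (rule has_field_derivative_at_within[OF DERIV_cmult])
  next
    fix t assume t: "t \<in> ?I"
    show "(\<lambda>s. (x k - a k) * \<alpha> k (seg k (x(i := t)) s)) integrable_on cbox 0 1"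
      by (intro integrable_continuous continuous_on_mult continuous_on_const
          continuous_on_\<alpha>_seg[where h = "\<alpha> k" and f = "\<lambda>s. x(i := t)" and g = "\<lambda>s. s"])
        (use t xt k smooth in \<open>auto intro: continuous_on_id\<close>)
  next
    show "continuous_on (?I \<times> cbox 0 1) (\<lambda>(t, s). (x k - a k) * rpd i (\<alpha> k) (seg k (x(i := t)) s))"
      unfolding split_beta
      by (intro continuous_on_mult continuous_on_const
          continuous_on_\<alpha>_seg[where h = "rpd i (\<alpha> k)" and f = "\<lambda>p. x(i := fst p)" and g = snd]
          continuous_on_fun_upd continuous_on_fst continuous_on_snd continuous_on_id)
        (use xt i k smooth smooth_fun_rpd in auto)
  qed
  moreover have "integral (cbox 0 1) (\<lambda>s. (x k - a k) * rpd i (\<alpha> k) (seg k (x(i := x i)) s))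
      = \<alpha> i (cut (Suc k) x) - \<alpha> i (cut k x)"
  proof (rule integral_unique)
    have "((\<lambda>s. (x k - a k) * rpd k (\<alpha> i) (seg k x s)) has_integral \<alpha> i (seg k x 1) - \<alpha> i (seg k x 0)) {0..1}"
      unfolding seg_def
      by (rule has_integral_derivative[where F = "\<lambda>s. \<alpha> i ((cut k x)(k := a k + s * (x k - a k)))"], simp,
          rule has_derivative_segment) (use x k i xk smooth in auto)
    moreover have "seg k x 1 = cut (Suc k) x" "seg k x 0 = cut k x"
      by (auto simp: seg_def cut_def fun_eq_iff)
    moreover have "rpd i (\<alpha> k) (seg k x s) = rpd k (\<alpha> i) (seg k x s)" if "s \<in> {0..1}" for s
      using that i k x by (intro closed_form seg_in_Q) auto
    ultimately show "((\<lambda>s. (x k - a k) * rpd i (\<alpha> k) (seg k (x(i := x i)) s)) has_integral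
        \<alpha> i (cut (Suc k) x) - \<alpha> i (cut k x)) (cbox 0 1)"
      using has_integral_cong[of "{0..1}" "\<lambda>s. (x k - a k) * rpd i (\<alpha> k) (seg k x s)"
          "\<lambda>s. (x k - a k) * rpd k (\<alpha> i) (seg k x s)"]
      by simp
  qed
  moreover have "at (x i) within ?I = at (x i)"
    by (rule at_within_open[OF xi open_interval(1)])
  ultimately show ?thesis using i by simp
qed

text \<open>Differentiation in the coordinate of the edge itself turns the integrand into the
  s-derivative of s times \<open>\<alpha> k\<close>, so only the value at the end of the edge
  survives.\<close>

lemma deriv_integral_same:
  assumes x: "x \<in> Q" and k: "k < n"
  shows "((\<lambda>t. integral {0..1} (\<lambda>s. ((x(k := t)) k - a k) * \<alpha> k (seg k (x(k := t)) s))) has_real_derivative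
      \<alpha> k (cut (Suc k) x)) (at (x k))"
proof -
  let ?I = "{t. \<bar>t - a k\<bar> < d}"
  let ?q = "\<lambda>t s. (cut k x)(k := a k + s * (t - a k))"
  have xk: "x k \<in> ?I" using x k by (auto simp: cube_def)
  have q: "seg k (x(k := t)) s = ?q t s" for t s by (simp add: seg_def cut_upd)
  have xt: "x(k := t) \<in> Q" if "t \<in> ?I" for t using that x k by (intro upd_in_Q) auto
  let ?g = "\<lambda>t s. \<alpha> k (?q t s) + (t - a k) * (s * rpd k (\<alpha> k) (?q t s))"
  have "((\<lambda>t. integral (cbox 0 1) (\<lambda>s. (t - a k) * \<alpha> k (?q t s))) has_real_derivative
      integral (cbox 0 1) (?g (x k))) (at (x k) within ?I)"
  proof (rule leibniz_rule_field_derivative[OF _ _ _ xk open_interval(2)])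
    fix t s :: real assume ts: "t \<in> ?I" "s \<in> cbox 0 1"
    have "((\<lambda>t. \<alpha> k (?q t s)) has_real_derivative s * rpd k (\<alpha> k) (?q t s)) (at t)"
      using ts x k by (intro has_derivative_segment_end smooth) auto
    then have "((\<lambda>t. (t - a k) * \<alpha> k (?q t s)) has_real_derivative ?g t s) (at t)"
      by (auto intro!: derivative_eq_intros)
    then show "((\<lambda>t. (t - a k) * \<alpha> k (?q t s)) has_real_derivative ?g t s) (at t within ?I)"
      by (rule has_field_derivative_at_within)
  next
    fix t assume t: "t \<in> ?I"
    show "(\<lambda>s. (t - a k) * \<alpha> k (?q t s)) integrable_on cbox 0 1"
      unfolding q[symmetric]
      by (intro integrable_continuous continuous_on_mult continuous_on_const
          continuous_on_\<alpha>_seg[where h = "\<alpha> k" and f = "\<lambda>s. x(k := t)" and g = "\<lambda>s. s"])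
        (use t xt k smooth in \<open>auto intro: continuous_on_id\<close>)
  next
    show "continuous_on (?I \<times> cbox 0 1) (\<lambda>(t, s). ?g t s)"
      unfolding split_beta q[symmetric]
      by (intro continuous_on_add continuous_on_mult continuous_on_diff continuous_on_const
          continuous_on_\<alpha>_seg[where h = "rpd k (\<alpha> k)" and f = "\<lambda>p. x(k := fst p)" and g = snd]
          continuous_on_\<alpha>_seg[where h = "\<alpha> k" and f = "\<lambda>p. x(k := fst p)" and g = snd]
          continuous_on_fun_upd continuous_on_fst continuous_on_snd continuous_on_id)
        (use xt k smooth smooth_fun_rpd in auto)
  qed
  moreover have "integral (cbox 0 1) (?g (x k)) = \<alpha> k (cut (Suc k) x)"
  proof (rule integral_unique)
    have "((\<lambda>s. ?g (x k) s) has_integral 1 * \<alpha> k (?q (x k) 1) - 0 * \<alpha> k (?q (x k) 0)) {0..1}"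
    proof (rule has_integral_derivative[where F = "\<lambda>s. s * \<alpha> k (?q (x k) s)"])
      fix s :: real assume s: "s \<in> {0..1}"
      show "((\<lambda>s. s * \<alpha> k (?q (x k) s)) has_real_derivative ?g (x k) s) (at s)"
        using DERIV_mult'[OF DERIV_ident has_derivative_segment[OF smooth[OF k] k x _ s, of "x k"]] xk
        by (simp add: algebra_simps)
    qed simp
    then show "(?g (x k) has_integral \<alpha> k (cut (Suc k) x)) (cbox 0 1)"
      by (simp add: cut_Suc)
  qed
  moreover have "at (x k) within ?I = at (x k)"
    by (rule at_within_open[OF xk open_interval(1)])
  ultimately show ?thesis by (simp add: q)
qed

text \<open>The edge in direction i contributes \<open>\<alpha> i\<close> at its end, and each later
  edge the change of \<open>\<alpha> i\<close> along it, so the sum telescopes.\<close>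

lemma deriv_potential:
  "k \<le> n \<Longrightarrow> i < k \<Longrightarrow> x \<in> Q \<Longrightarrow>
    ((\<lambda>t. potential k (x(i := t))) has_real_derivative \<alpha> i (cut k x)) (at (x i))"
proof (induction k)
  case (Suc k)
  show ?case
  proof (cases "i = k")
    case True
    have "(\<lambda>t. potential k (x(k := t))) = (\<lambda>t. potential k x)" by (simp add: potential_upd)
    then show ?thesis
      using DERIV_add[OF DERIV_const deriv_integral_same[of x k], of "potential k x"] Suc.prems True
      by (simp only: potential.simps) (simp only: potential_upd add_0 Suc_le_eq)
  next
    case False
    then have "((\<lambda>t. potential k (x(i := t))) has_real_derivative \<alpha> i (cut k x)) (at (x i))"
      using Suc.prems by (intro Suc.IH) auto
    moreover have "((\<lambda>t. integral {0..1} (\<lambda>s. ((x(i := t)) k - a k) * \<alpha> k (seg k (x(i := t)) s))) has_real_derivative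
        \<alpha> i (cut (Suc k) x) - \<alpha> i (cut k x)) (at (x i))"
      using False Suc.prems by (intro deriv_integral_less) auto
    ultimately show ?thesis
      unfolding potential.simps by (rule DERIV_add[THEN DERIV_cong]) simp
  qed
qed simp

lemma exists_potential:
  obtains f where "smooth_fun n Q f" "\<And>i x. i < n \<Longrightarrow> x \<in> Q \<Longrightarrow> rpd i f x = \<alpha> i x"
proof (rule that)
  have D: "((\<lambda>t. potential n (x(i := t))) has_real_derivative \<alpha> i x) (at (x i))" if "i < n" "x \<in> Q" for i x
    using deriv_potential[of n i x] that cut_all by simp
  then show eq: "rpd i (potential n) x = \<alpha> i x" if "i < n" "x \<in> Q" for i x
    using that by (intro rpd_eqI) auto
  show "smooth_fun n Q (potential n)"
  proof (rule smooth_funI)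
    show "smooth_fun n Q (rpd i (potential n))" if "i < n" for i
      using smooth_fun_cong[of "rpd i (potential n)" "\<alpha> i"] eq[OF that] smooth[OF that] by simp
  qed (use D continuous_potential in \<open>auto simp: real_differentiable_def\<close>)
qed

end

text \<open>The coefficients of positive degree in the odd coordinates are read off from the components along
  the odd coordinates; only the remaining coefficient needs integration.\<close>

lemma super_poincare:
  assumes d: "d > 0" and a: "\<And>i. i \<ge> n \<Longrightarrow> a i = 0"
    and A: "\<And>i. i < n + m \<Longrightarrow> A i \<in> SF_hom n m (cube n a d) (par n i)"
    and closed_form: "\<And>i j x. i < n + m \<Longrightarrow> j < n + m \<Longrightarrow> x \<in> cube n a d \<Longrightarrow>
      pd n i (A j) x = (-1) ^ (par n i * par n j) * pd n j (A i) x"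
  obtains \<sigma> where "\<sigma> \<in> SF_hom n m (cube n a d) 0"
    "\<And>i x. i < n + m \<Longrightarrow> x \<in> cube n a d \<Longrightarrow> pd n i \<sigma> x = A i x"
proof -
  let ?Q = "cube n a d"
  interpret euclidean_domain n ?Q by unfold_locales (rule openin_cube)
  have ASF: "A i \<in> SF n m ?Q" if "i < n + m" for i using A[OF that] by (rule SF_hom_SF)
  interpret form: closed_form_on_cube n a d "\<lambda>i x. coeff (A i x) {}"
  proof
    fix i j x assume ij: "i < n" "j < n" "x \<in> ?Q"
    have "coeff (pd n i (A j) x) {} = coeff (pd n j (A i) x) {}"
      using closed_form[of i j x] ij by (simp add: par_def)
    then show "rpd i (\<lambda>x. coeff (A j x) {}) x = rpd j (\<lambda>x. coeff (A i x) {}) x"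
      using ij by (simp add: coeff_pd)
  qed (use d a SF_coeff[OF ASF] in auto)
  obtain f where f: "smooth_fun n ?Q f" "\<And>i x. i < n \<Longrightarrow> x \<in> ?Q \<Longrightarrow> rpd i f x = coeff (A i x) {}"
    by (rule form.exists_potential) simp
  \<comment> \<open>The coefficient at I is prescribed by the derivative along its smallest index:
    no index of I lies below it, so no sign occurs. At the empty set the even potential is
    used.\<close>
  define \<sigma> where "\<sigma> x = Abs_grassmann (\<lambda>I. if I = {} then f x
      else if I \<subseteq> {..<m} then coeff (A (n + Min I) x) (I - {Min I}) else 0)" for x
  have \<sigma>: "coeff (\<sigma> x) I = (if I = {} then f x
      else if I \<subseteq> {..<m} then coeff (A (n + Min I) x) (I - {Min I}) else 0)" for x I
    unfolding \<sigma>_def by (subst Abs_grassmann_inverse) (auto dest: finite_subset)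
  have Min_I: "finite I" "Min I \<in> I" "Min I < m" "\<And>b. b \<in> I \<Longrightarrow> Min I \<le> b" if "I \<noteq> {}" "I \<subseteq> {..<m}" for I
  proof -
    show "finite I" using finite_subset[OF that(2)] by simp
    then show "Min I \<in> I" "\<And>b. b \<in> I \<Longrightarrow> Min I \<le> b" using that(1) by auto
    then show "Min I < m" using that(2) by blast
  qed
  have "\<sigma> \<in> SF n m ?Q"
    unfolding SF_def
  proof (intro CollectI conjI allI ballI impI)
    fix I show "smooth_fun n ?Q (\<lambda>x. coeff (\<sigma> x) I)"
      unfolding \<sigma> using Min_I[of I] f(1) SF_coeff[OF ASF, of "n + Min I" "I - {Min I}"]
      by (cases "I = {}"; cases "I \<subseteq> {..<m}") (auto simp: smooth_fun_const)
  qed (auto simp: \<sigma> split: if_splits)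
  moreover have "\<sigma> x \<in> ghom 0" if x: "x \<in> ?Q" for x
    unfolding ghom_def
  proof (intro CollectI allI impI)
    fix I assume nz: "coeff (\<sigma> x) I \<noteq> 0"
    show "even (card I + 0)"
    proof (cases "I = {}")
      case False
      with nz have I: "I \<subseteq> {..<m}" "coeff (A (n + Min I) x) (I - {Min I}) \<noteq> 0"
        by (auto simp: \<sigma> split: if_splits)
      have "even (card (I - {Min I}) + par n (n + Min I))"
        using A[of "n + Min I"] x I(2) Min_I(3)[OF False I(1)] unfolding SF_hom_def by fastforce
      moreover have "card I = Suc (card (I - {Min I}))"
        using Min_I[OF False I(1)] by (metis card_Suc_Diff1)
      ultimately show ?thesis by (simp add: par_def)
    qed simp
  qed
  ultimately have "\<sigma> \<in> SF_hom n m ?Q 0" by (simp add: SF_hom_iff)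
  moreover have "pd n i \<sigma> x = A i x" if i: "i < n + m" and x: "x \<in> ?Q" for i x
  proof (rule grassmann_eqI)
    fix J :: "nat set" assume J: "finite J"
    show "coeff (pd n i \<sigma> x) J = coeff (A i x) J"
    proof (cases "i < n")
      case True
      consider "J = {}" | "J \<noteq> {}" "J \<subseteq> {..<m}" | "\<not> J \<subseteq> {..<m}" by blast
      then show ?thesis
      proof cases
        case 1
        then show ?thesis using True f(2)[OF True x] by (simp add: coeff_pd \<sigma>)
      next
        case 2
        let ?b = "Min J" and ?K = "J - {Min J}"
        note M = Min_I[OF 2]
        \<comment> \<open>Closedness exchanges the even derivative of an odd component for the odd
          derivative of the component \<open>A i\<close>, whose coefficient at J is then read
          off.\<close>
        have "coeff (pd n i \<sigma> x) J = coeff (pd n i (A (n + ?b)) x) ?K"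
          using True 2 by (simp add: coeff_pd \<sigma>)
        also have "\<dots> = coeff (pd n (n + ?b) (A i) x) ?K"
          using closed_form[OF i _ x, of "n + ?b"] M True by (simp add: par_def)
        also have "\<dots> = coeff (A i x) J"
        proof -
          have "{c \<in> ?K. c < ?b} = {}" using M(4) by fastforce
          moreover have "insert ?b ?K = J" "(?b \<in> ?K) = False" using M(2) by auto
          ultimately have "coeff (gderiv ?b (A i x)) ?K = coeff (A i x) J"
            by (simp only: coeff_gderiv card.empty power_0 mult_1 if_False)
          then show ?thesis by (simp add: coeff_pd)
        qed
        finally show ?thesis .
      next
        case 3
        then have "coeff (A i x) J = 0" using SF_support[OF ASF[OF i] x] by blast
        moreover have "J \<noteq> {}" using 3 by auto
        ultimately show ?thesis using 3 True by (simp add: coeff_pd \<sigma> rpd_const)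
      qed
    next
      case False
      define v where "v = i - n"
      have v: "v < m" "i = n + v" using False i by (auto simp: v_def)
      have g: "gderiv v (A (n + b) x) = - gderiv b (A (n + v) x)" if "b < m" for b
        using closed_form[of "n + v" "n + b" x] that x v by (simp add: pd_def par_def)
      have L: "coeff (pd n i \<sigma> x) J = coeff (gderiv v (\<sigma> x)) J" using False by (simp add: pd_def v_def)
      show ?thesis
      proof (cases "v \<in> J")
        case True
        \<comment> \<open>Closedness for twice the same odd index says that the derivative of
          \<open>A (n + v)\<close> along v equals its negative, so no monomial of it contains
          v.\<close>
        have "coeff (gderiv v (A (n + v) x)) (J - {v}) = - coeff (gderiv v (A (n + v) x)) (J - {v})"
          using g[OF v(1)] by (metis uminus_grassmann.rep_eq)
        then have "coeff (A (n + v) x) J = 0" using True by (simp add: insert_absorb)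
        then show ?thesis using True v unfolding L by simp
      next
        case vJ: False
        let ?I = "insert v J"
        show ?thesis
        proof (cases "J \<subseteq> {..<m}")
          case False
          then have "coeff (A i x) J = 0" using SF_support[OF ASF[OF i] x] by blast
          then show ?thesis using False vJ by (simp add: L \<sigma>)
        next
          case True
          then have I: "?I \<noteq> {}" "?I \<subseteq> {..<m}" using v by auto
          note M = Min_I[OF I]
          define b where "b = Min ?I"
          have sig: "coeff (\<sigma> x) ?I = coeff (A (n + b) x) (?I - {b})" using I by (simp add: \<sigma> b_def)
          show ?thesis
          proof (cases "b = v")
            case True
            then have "{c \<in> J. c < v} = {}" using M(4) unfolding b_def by fastforce
            then have "coeff (gderiv v (\<sigma> x)) J = coeff (\<sigma> x) ?I"
              by (simp only: coeff_gderiv if_not_P[OF vJ] card.empty power_0 mult_1)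
            then show ?thesis using vJ v sig True unfolding L by simp
          next
            case False
            then have b: "b \<in> J" "b < v" "b < m" using M unfolding b_def by (auto simp: le_neq_implies_less)
            let ?K = "J - {b}"
            have "{c \<in> ?K. c < b} = {}" using M(4) unfolding b_def[symmetric] by fastforce
            then have c1: "coeff (gderiv b z) ?K = coeff z (insert b ?K)" for z
              by (simp only: coeff_gderiv card.empty power_0 mult_1) simp
            \<comment> \<open>Since b < v, removing b lowers the number of indices below v by one;
              this sign cancels the minus sign in the closedness relation of two odd
              components.\<close>
            have "{c \<in> J. c < v} = insert b {c \<in> ?K. c < v}" using b by auto
            then have c2: "card {c \<in> J. c < v} = Suc (card {c \<in> ?K. c < v})" using J by simp
            have "coeff (gderiv v (A (n + b) x)) ?K = - coeff (gderiv b (A (n + v) x)) ?K"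
              using g[OF b(3)] by (simp only: uminus_grassmann.rep_eq)
            moreover have "insert v ?K = ?I - {b}" "insert b ?K = J" using b by auto
            ultimately have "(-1) ^ card {c \<in> ?K. c < v} * coeff (A (n + b) x) (?I - {b}) = - coeff (A (n + v) x) J"
              using vJ unfolding uminus_grassmann.rep_eq c1 by simp
            then show ?thesis using vJ v sig unfolding L by (simp add: c2)
          qed
        qed
      qed
    qed
  qed
  ultimately show ?thesis using that by blast
qed

section \<open>Exponential and logarithm\<close>

text \<open>Each factor without body uses up at least one generator.\<close>

lemma coeff_power_nilpotent:
  assumes "coeff z {} = 0" "\<And>I. coeff z I \<noteq> 0 \<Longrightarrow> I \<subseteq> X" "finite X" "coeff (z ^ k) I \<noteq> 0"
  shows "k \<le> card I \<and> I \<subseteq> X"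
  using assms(4)
proof (induction k arbitrary: I)
  case 0
  then show ?case by (auto split: if_splits)
next
  case (Suc k)
  then have I: "finite I" using coeff_infinite by blast
  with Suc.prems obtain J where J: "J \<subseteq> I" "coeff z J \<noteq> 0" "coeff (z ^ k) (I - J) \<noteq> 0"
    by (auto simp: coeff_times elim!: sum.not_neutral_contains_not_neutral)
  then have "J \<noteq> {}" using assms(1) by auto
  have fJ: "finite J" using J I finite_subset by blast
  then have "card J > 0" using \<open>J \<noteq> {}\<close> by auto
  moreover have "card I = card J + card (I - J)"
    using I J(1) fJ by (metis card_Diff_subset card_mono le_add_diff_inverse)
  ultimately show ?case using Suc.IH[OF J(3)] assms(2)[OF J(2)] J(1) by auto
qed

text \<open>Substitution of a nilpotent element into a formal power series. Identities such as log(1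
  + (exp X - 1)) = X are thereby inherited from formal power series.\<close>

definition geval :: "nat \<Rightarrow> real fps \<Rightarrow> grassmann \<Rightarrow> grassmann" where
  "geval m f z = (\<Sum>k\<le>m. gconst (fps_nth f k) * z ^ k)"

lemma geval_diff: "geval m (f - g) z = geval m f z - geval m g z"
proof -
  have "gconst (r - s) = gconst r - gconst s" for r s
    using gconst_add[of "r - s" s] by simp
  then show ?thesis by (simp add: geval_def left_diff_distrib sum_subtractf)
qed

lemma geval_1: "geval m 1 z = 1"
proof -
  have "geval m 1 z = (\<Sum>k\<le>m. if k = 0 then 1 else 0)" unfolding geval_def by (intro sum.cong) auto
  then show ?thesis by simp
qed

context
  fixes z :: grassmann and m :: nat
  assumes nilpotent: "\<And>k. k > m \<Longrightarrow> z ^ k = 0"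
begin

lemma geval_mult: "geval m (f * g) z = geval m f z * geval m g z"
proof -
  let ?h = "\<lambda>i j. gconst (fps_nth f i * fps_nth g j) * z ^ (i + j)"
  have comm: "gconst s * x * (gconst t * y) = gconst (s * t) * (x * y)" for s t x y
    by (metis gconst_commute gconst_mult mult.assoc)
  have "geval m f z * geval m g z = (\<Sum>i\<le>m. \<Sum>j\<le>m. ?h i j)"
    by (simp add: geval_def sum_product comm power_add)
  also have "\<dots> = (\<Sum>(i, j)\<in>{..m} \<times> {..m}. ?h i j)" by (rule sum.cartesian_product)
  \<comment> \<open>Outside the triangle the power of z exceeds m and vanishes, so the truncated
    product is exact.\<close>
  also have "\<dots> = (\<Sum>(i, j)\<in>{(i, j). i + j \<le> m}. ?h i j)"
    by (rule sum.mono_neutral_right) (auto simp: nilpotent not_le intro: ccontr)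
  also have "\<dots> = (\<Sum>k\<le>m. \<Sum>i\<le>k. ?h i (k - i))" by (rule sum.triangle_reindex_eq)
  also have "\<dots> = geval m (f * g) z"
    by (simp add: geval_def fps_mult_nth gconst_sum sum_distrib_right atLeast0AtMost)
  finally show ?thesis ..
qed

lemma geval_power: "geval m (f ^ k) z = geval m f z ^ k"
  by (induction k) (simp_all add: geval_1 geval_mult)

lemma geval_X: "geval m fps_X z = z"
proof (cases "m = 0")
  case True
  then show ?thesis using nilpotent[of 1] by (simp add: geval_def)
next
  case False
  have "geval m fps_X z = (\<Sum>k\<le>m. if k = 1 then z else 0)" unfolding geval_def by (intro sum.cong) auto
  then show ?thesis using False by simp
qed

text \<open>As g has no constant term, powers of g beyond the k-th do not reach the k-th
  coefficient, so truncating the outer series at m is harmless for k \<le> m.\<close>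

lemma geval_compose:
  assumes "fps_nth g 0 = 0"
  shows "geval m (f oo g) z = (\<Sum>i\<le>m. gconst (fps_nth f i) * geval m g z ^ i)"
proof -
  have "fps_nth (f oo g) k = (\<Sum>i\<le>m. fps_nth f i * fps_nth (g ^ i) k)" if "k \<le> m" for k
    unfolding fps_compose_nth
    by (rule sum.mono_neutral_left)
      (use that startsby_zero_power_prefix[OF assms] in auto)
  then have "geval m (f oo g) z = (\<Sum>k\<le>m. \<Sum>i\<le>m. gconst (fps_nth f i) * (gconst (fps_nth (g ^ i) k) * z ^ k))"
    unfolding geval_def by (simp add: gconst_sum gconst_mult sum_distrib_right mult.assoc)
  also have "\<dots> = (\<Sum>i\<le>m. gconst (fps_nth f i) * geval m (g ^ i) z)"
    by (subst sum.swap) (simp add: geval_def sum_distrib_left)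
  finally show ?thesis by (simp add: geval_power)
qed

end

definition gexp :: "nat \<Rightarrow> grassmann \<Rightarrow> grassmann" where
  "gexp m z = gconst (exp (body z)) * (\<Sum>k\<le>m. gconst (1 / fact k) * (z - gconst (body z)) ^ k)"

text \<open>Dividing \<open>gexp m z\<close> by its body and subtracting 1 gives exp - 1 evaluated
  at the nilpotent part of z. The sum in \<open>gln\<close> is log(1 + X) evaluated there, and the
  two series are inverse to each other under composition.\<close>

lemma
  assumes "\<And>I. coeff z I \<noteq> 0 \<Longrightarrow> I \<subseteq> {..<m}"
  shows body_gexp: "body (gexp m z) = exp (body z)"
    and gln_gexp: "gln m (gexp m z) = z"
proof -
  let ?u = "z - gconst (body z)"
  have u0: "coeff ?u {} = 0" by (simp add: body_def)
  have uI: "I \<subseteq> {..<m}" if "coeff ?u I \<noteq> 0" for I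
    using that assms[of I] by (auto split: if_splits)
  note pow = coeff_power_nilpotent[OF u0 uI finite_lessThan]
  have nil: "?u ^ k = 0" if "k > m" for k
  proof (rule grassmann_eqI, rule ccontr)
    fix I assume "coeff (?u ^ k) I \<noteq> coeff 0 I"
    then have "k \<le> card I" "I \<subseteq> {..<m}" using pow[of k I] by auto
    then show False using that card_mono[of "{..<m}" I] by simp
  qed
  have "coeff (?u ^ k) {} = (if k = 0 then 1 else 0)" for k
    using pow[of k "{}"] by (cases k) auto
  then have "(\<Sum>k\<le>m. 1 / fact k * coeff (?u ^ k) {}) = (\<Sum>k\<le>m. if k = 0 then 1 else (0 :: real))"
    by (intro sum.cong) auto
  then show body: "body (gexp m z) = exp (body z)"
    by (simp add: gexp_def body_def)
  let ?g = "fps_exp 1 - 1 :: real fps"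
  have ge: "geval m (fps_exp 1) ?u = (\<Sum>k\<le>m. gconst (1 / fact k) * ?u ^ k)" by (simp add: geval_def)
  have "geval m ?g ?u = geval m (fps_exp 1) ?u - geval m 1 ?u" by (rule geval_diff)
  then have v: "gconst (1 / body (gexp m z)) * (gexp m z - gconst (body (gexp m z))) = geval m ?g ?u"
    unfolding body geval_1 ge
    by (simp add: gexp_def right_diff_distrib mult.assoc[symmetric] gconst_mult[symmetric])
  \<comment> \<open>\<open>fps_ln 1\<close> is the series of log(1 + X).\<close>
  have "fps_ln 1 oo ?g = fps_X"
    unfolding fps_ln_fps_exp_inv[OF zero_neq_one[symmetric]] by (rule fps_inv) simp_all
  then have "?u = (\<Sum>i\<le>m. gconst (fps_nth (fps_ln 1) i) * geval m ?g ?u ^ i)"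
    using geval_compose[where m = m and z = ?u and g = ?g and f = "fps_ln 1", OF nil] geval_X[where m = m and z = ?u, OF nil]
    by simp
  also have "\<dots> = (\<Sum>i=1..m. gconst ((-1) ^ (i + 1) / real i) * geval m ?g ?u ^ i)"
  proof (rule sum.mono_neutral_cong_right)
    show "gconst (fps_nth (fps_ln 1) i) * geval m ?g ?u ^ i = gconst ((-1) ^ (i + 1) / real i) * geval m ?g ?u ^ i"
      if "i \<in> {1..m}" for i
      using that by (cases i) (auto simp: fps_ln_nth)
  qed (auto simp: not_le)
  finally show "gln m (gexp m z) = z"
    unfolding gln_def v by (simp add: body)
qed

section \<open>Volume forms and their logarithms\<close>

context euclidean_domain
begin

lemma SF_body: "f \<in> SF n m U \<Longrightarrow> smooth_fun n U (\<lambda>x. body (f x))"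
  unfolding body_def by (rule SF_coeff)

lemma SF_hom_gconst: "smooth_fun n U g \<Longrightarrow> (\<lambda>x. gconst (g x)) \<in> SF_hom n m U 0"
  by (simp add: SF_hom_iff SF_gconst ghom_gconst)

lemma SF_hom_power: "f \<in> SF_hom n m U 0 \<Longrightarrow> f ^ k \<in> SF_hom n m U 0"
proof (induction k)
  case 0
  have "const 1 = (1 :: superfun)" by (simp add: const_def fun_eq_iff)
  then show ?case using SF_hom_const[of 1] by (simp only: power_0)
next
  case (Suc k)
  then show ?case using SF_hom_times[of f m 0 "f ^ k" 0] by (simp only: power_Suc add_0)
qed

lemma SF_hom_diff: "f \<in> SF_hom n m U p \<Longrightarrow> g \<in> SF_hom n m U p \<Longrightarrow> f - g \<in> SF_hom n m U p"
  using SF_hom_add[OF _ SF_hom_uminus, of f m p g] by simp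

lemma SF_hom_times_0: "f \<in> SF_hom n m U 0 \<Longrightarrow> g \<in> SF_hom n m U 0 \<Longrightarrow> f * g \<in> SF_hom n m U 0"
  using SF_hom_times[of f m 0 g 0] by simp

lemma SF_hom_slog:
  assumes "volume_form n m U \<rho>"
  shows "slog m \<rho> \<in> SF_hom n m U 0"
proof -
  have \<rho>: "\<rho> \<in> SF_hom n m U 0" "\<And>x. x \<in> U \<Longrightarrow> body (\<rho> x) > 0" using assms by (auto simp: volume_form_def)
  then have b: "smooth_fun n U (\<lambda>x. body (\<rho> x))" by (auto intro: SF_body SF_hom_SF)
  have "slog m \<rho> = (\<lambda>x. gconst (ln (body (\<rho> x)))) + (\<Sum>k=1..m. const ((-1) ^ (k + 1) / real k) *
      ((\<lambda>x. gconst (1 / body (\<rho> x))) * (\<rho> - (\<lambda>x. gconst (body (\<rho> x))))) ^ k)"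
    by (simp add: slog_def gln_def const_def fun_eq_iff)
  also have "\<dots> \<in> SF_hom n m U 0"
    using \<rho> b smooth_fun_inverse[OF b]
    by (intro SF_hom_add SF_hom_sum SF_hom_const_times SF_hom_power SF_hom_times_0 SF_hom_diff
        SF_hom_gconst smooth_fun_ln) (auto simp: inverse_eq_divide less_imp_neq[THEN not_sym])
  finally show ?thesis .
qed

lemma exists_volume_form:
  assumes \<sigma>: "\<sigma> \<in> SF_hom n m U 0"
  obtains \<rho> where "volume_form n m U \<rho>" "\<And>x. x \<in> U \<Longrightarrow> slog m \<rho> x = \<sigma> x"
proof (rule that)
  have b: "smooth_fun n U (\<lambda>x. body (\<sigma> x))" using \<sigma> by (auto intro: SF_body SF_hom_SF)
  have sup: "\<And>I. coeff (\<sigma> x) I \<noteq> 0 \<Longrightarrow> I \<subseteq> {..<m}" if "x \<in> U" for x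
    using SF_support[OF SF_hom_SF[OF \<sigma>] that] .
  have "(\<lambda>x. gexp m (\<sigma> x)) = (\<lambda>x. gconst (exp (body (\<sigma> x)))) *
      (\<Sum>k\<le>m. const (1 / fact k) * (\<sigma> - (\<lambda>x. gconst (body (\<sigma> x)))) ^ k)"
    by (simp add: gexp_def const_def fun_eq_iff)
  also have "\<dots> \<in> SF_hom n m U 0"
    using \<sigma> b
    by (intro SF_hom_times_0 SF_hom_sum SF_hom_const_times SF_hom_power SF_hom_diff SF_hom_gconst smooth_fun_exp)
  finally show "volume_form n m U (\<lambda>x. gexp m (\<sigma> x))"
    using body_gexp[OF sup] by (simp add: volume_form_def)
  show "slog m (\<lambda>x. gexp m (\<sigma> x)) x = \<sigma> x" if "x \<in> U" for x
    using gln_gexp[OF sup[OF that]] by (simp add: slog_def)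
qed

end

section \<open>The derived bracket in coordinates\<close>

lemma sg_0 [simp]: "sg k 0 = 0"
  by (simp add: sg_def)

text \<open>On the cotangent bundle the product rule is applied along momenta only. Lifted functions
  are constant there, so differentiability along one coordinate line through one point is
  enough.\<close>

definition coeff_differentiable :: "nat \<Rightarrow> superfun \<Rightarrow> (nat \<Rightarrow> real) \<Rightarrow> bool" where
  "coeff_differentiable k f z \<longleftrightarrow> (\<forall>I. (\<lambda>t. coeff (f (z(k := t))) I) differentiable at (z k))"

lemma coeff_differentiable_add:
  "coeff_differentiable k f z \<Longrightarrow> coeff_differentiable k g z \<Longrightarrow> coeff_differentiable k (f + g) z"
  by (simp add: coeff_differentiable_def differentiable_add)

lemma coeff_differentiable_sum:
  "(\<And>a. a \<in> X \<Longrightarrow> coeff_differentiable k (f a) z) \<Longrightarrow> coeff_differentiable k (sum f X) z"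
  by (induction X rule: infinite_finite_induct)
    (auto intro: coeff_differentiable_add simp: coeff_differentiable_def)

lemma coeff_differentiable_times:
  assumes "coeff_differentiable k f z" "coeff_differentiable k g z"
  shows "coeff_differentiable k (f * g) z"
  unfolding coeff_differentiable_def
proof
  fix I
  show "(\<lambda>t. coeff ((f * g) (z(k := t))) I) differentiable at (z k)"
  proof (cases "finite I")
    case True
    have "(\<lambda>t. \<Sum>J\<in>Pow I. shuffle_sign J (I - J) * coeff (f (z(k := t))) J * coeff (g (z(k := t))) (I - J))
        differentiable at (z k)"
      using True assms unfolding coeff_differentiable_def
      by (intro differentiable_sum ballI differentiable_mult differentiable_const) auto
    then show ?thesis using True by (simp add: coeff_times)
  qed (simp add: coeff_infinite)
qed

lemma coeff_differentiable_coord: "coeff_differentiable k (coord N j) z"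
proof -
  have "(\<lambda>t. (z(k := t)) j) differentiable at (z k)"
    by (cases "j = k") (auto simp: differentiable_ident)
  then have "(\<lambda>t. if I = {} then (z(k := t)) j else 0) differentiable at (z k)" for I :: "nat set"
    by (cases "I = {}") (simp_all only: if_P if_not_P simp_thms if_True if_False differentiable_const)
  then show ?thesis
    by (auto simp: coeff_differentiable_def coord_def simp del: fun_upd_apply)
qed

lemma pd_times_cd:
  assumes "coeff_differentiable k f z" "coeff_differentiable k g z"
  shows "pd N k (f * g) z = pd N k f z * g z + sgn_pow (par N k) f z * pd N k g z"
  by (rule pd_times_if_differentiable) (use assms in \<open>auto simp: coeff_differentiable_def\<close>)

lemma has_rpd_coeff:
  "coeff_differentiable k f z \<Longrightarrow>
    ((\<lambda>t. coeff (f (z(k := t))) I) has_real_derivative rpd k (\<lambda>y. coeff (f y) I) z) (at (z k))"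
  by (simp add: coeff_differentiable_def rpd_def DERIV_deriv_iff_real_differentiable)

lemma pd_add_cd:
  assumes "coeff_differentiable k f z" "coeff_differentiable k g z"
  shows "pd N k (f + g) z = pd N k f z + pd N k g z"
proof (rule grassmann_eqI)
  fix I
  have "rpd k (\<lambda>y. coeff ((f + g) y) I) z = rpd k (\<lambda>y. coeff (f y) I) z + rpd k (\<lambda>y. coeff (g y) I) z"
    using DERIV_add[OF has_rpd_coeff[OF assms(1)] has_rpd_coeff[OF assms(2)]] by (intro rpd_eqI) simp
  then show "coeff (pd N k (f + g) z) I = coeff (pd N k f z + pd N k g z) I"
    by (simp add: coeff_pd algebra_simps)
qed

lemma pd_sum_cd:
  "(\<And>a. a \<in> X \<Longrightarrow> coeff_differentiable k (f a) z) \<Longrightarrow> pd N k (sum f X) z = (\<Sum>a\<in>X. pd N k (f a) z)"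
proof (induction X rule: infinite_finite_induct)
  case (insert a X)
  have "pd N k (f a + sum f X) z = pd N k (f a) z + pd N k (sum f X) z"
    by (intro pd_add_cd coeff_differentiable_sum insert.prems) auto
  moreover have "pd N k (sum f X) z = (\<Sum>a\<in>X. pd N k (f a) z)"
    by (intro insert.IH insert.prems) auto
  ultimately show ?case
    unfolding sum.insert[OF insert.hyps] by (rule trans[OF _ arg_cong2[where f = "(+)", OF refl]])
\<comment> \<open>The derivative of 0 is 0 everywhere; the fact is taken from the instance over the
  empty domain.\<close>
qed (auto simp: euclidean_domain.pd_0[OF euclidean_domain.intro[OF openin_empty]])

lemma coeff_sgn_pow: "coeff (sgn_pow q f x) I = (-1) ^ (q * card I) * coeff (f x) I"
  by (auto simp: sgn_pow_def minus_one_power_iff)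

lemma pd_sgn_pow:
  assumes "k < N \<Longrightarrow> coeff_differentiable k f z"
  shows "pd N k (sgn_pow q f) z = (-1) ^ (q * par N k) * sgn_pow q (pd N k f) z"
proof (cases "k < N")
  case True
  show ?thesis
  proof (rule grassmann_eqI)
    fix I
    have "rpd k (\<lambda>y. coeff (sgn_pow q f y) I) z = (-1) ^ (q * card I) * rpd k (\<lambda>y. coeff (f y) I) z"
      unfolding coeff_sgn_pow by (intro rpd_eqI DERIV_cmult has_rpd_coeff assms True)
    then show "coeff (pd N k (sgn_pow q f) z) I = coeff ((-1) ^ (q * par N k) * sgn_pow q (pd N k f) z) I"
      using True by (simp add: coeff_pd par_def coeff_sgn_pow)
  qed
next
  case False
  then show ?thesis by (auto simp: pd_def sgn_pow_def par_def gderiv_ginv)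
qed

lemma sgn_pow_times: "sgn_pow q (f * g) x = sgn_pow q f x * sgn_pow q g x"
  and sgn_pow_add: "sgn_pow q (f + g) x = sgn_pow q f x + sgn_pow q g x"
  and sgn_pow_sum: "sgn_pow q (sum h X) x = (\<Sum>a\<in>X. sgn_pow q (h a) x)"
  by (auto simp: sgn_pow_def ginv_times ginv_add ginv_sum)

lemma sgn_pow_ghom: "f x \<in> ghom p \<Longrightarrow> sgn_pow q f x = (-1) ^ (q * p) * f x"
  by (auto simp: sgn_pow_def ghom_ginv minus_one_power_iff)

lemma coord_ghom: "coord N j x \<in> ghom (par N j)"
  by (auto simp: coord_def par_def ghom_def)

lemma pd_coord_everywhere: "pd N i (coord N j) x = (if i = j then 1 else 0)"
proof (cases "i < N")
  case True
  show ?thesis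
  proof (rule grassmann_eqI)
    fix I
    have "rpd i (\<lambda>x. x j) x = (if i = j then 1 else 0)"
      by (rule rpd_eqI) (cases "i = j"; auto)
    then show "coeff (pd N i (coord N j) x) I = coeff (if i = j then 1 else 0) I"
      using True by (auto simp: coeff_pd coord_def rpd_def)
  qed
next
  case False
  then show ?thesis by (auto simp: pd_def coord_def gderiv_ggen)
qed

lemma pd_cong_line:
  assumes "\<And>t. k < N \<Longrightarrow> f (z(k := t)) = g (z(k := t))" "f z = g z"
  shows "pd N k f z = pd N k g z"
  by (rule grassmann_eqI) (use assms in \<open>auto simp: coeff_pd rpd_def\<close>)

lemma ghom_sum: "(\<And>a. a \<in> X \<Longrightarrow> f a \<in> ghom p) \<Longrightarrow> sum f X \<in> ghom p"
  by (induction X rule: infinite_finite_induct) (auto intro: ghom_0 ghom_add)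

section \<open>Lifts to the cotangent bundle\<close>

locale superdomain = euclidean_domain n U for n U +
  fixes m :: nat
begin

abbreviation e :: "nat \<Rightarrow> nat" where "e \<equiv> par n"

text \<open>All coordinates beyond the base are left free, so that the set is stable under changes
  of the momenta.\<close>

definition cotangent :: "(nat \<Rightarrow> real) set" where
  "cotangent = {z. (\<lambda>i. if i < n then z i else 0) \<in> U}"

lemma lift_T_U: "x \<in> U \<Longrightarrow> lift_T n f x = f x"
proof -
  assume "x \<in> U"
  then have "(\<lambda>i. if i < n then x i else 0) = x" using U_support by (auto simp: fun_eq_iff)
  then show ?thesis by (simp add: lift_T_def)
qed

lemma U_cotangent: "x \<in> U \<Longrightarrow> x \<in> cotangent"
proof -
  assume "x \<in> U"
  then have "(\<lambda>i. if i < n then x i else 0) = x" using U_support by (auto simp: fun_eq_iff)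
  then show ?thesis using \<open>x \<in> U\<close> by (simp add: cotangent_def)
qed

lemma cotangent_upd: "z \<in> cotangent \<Longrightarrow> n \<le> k \<Longrightarrow> z(k := t) \<in> cotangent"
proof -
  assume "z \<in> cotangent" "n \<le> k"
  moreover from this have "(\<lambda>i. if i < n then (z(k := t)) i else 0) = (\<lambda>i. if i < n then z i else 0)"
    by (auto simp: fun_eq_iff)
  ultimately show ?thesis by (simp only: cotangent_def mem_Collect_eq)
qed

lemma lift_T_upd: "n \<le> k \<Longrightarrow> lift_T n f (z(k := t)) = lift_T n f z"
proof -
  assume "n \<le> k"
  then have "(\<lambda>i. if i < n then (z(k := t)) i else 0) = (\<lambda>i. if i < n then z i else 0)"
    by (auto simp: fun_eq_iff)
  then show ?thesis by (simp only: lift_T_def)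
qed

lemma par_pidx: "par (2 * n) (pidx n m k) = e k"
  and pidx_ge: "n \<le> pidx n m k"
  by (auto simp: par_def pidx_def)

lemma coeff_differentiable_lift_T: "coeff_differentiable (pidx n m k) (lift_T n f) z"
  unfolding coeff_differentiable_def lift_T_upd[OF pidx_ge] by simp

text \<open>An even momentum is dropped by the lift. An odd momentum has generator index at least m,
  and the function involves generators below m only.\<close>

lemma pd_pidx_lift_T:
  assumes "f \<in> SF n m U" "z \<in> cotangent"
  shows "pd (2 * n) (pidx n m k) (lift_T n f) z = 0"
proof (rule grassmann_eqI)
  fix I
  show "coeff (pd (2 * n) (pidx n m k) (lift_T n f) z) I = coeff 0 I"
  proof (cases "k < n")
    case True
    then show ?thesis
      by (simp add: coeff_pd rpd_def lift_T_upd[OF pidx_ge] del: fun_upd_apply) (simp add: pidx_def)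
  next
    case False
    then have "pidx n m k - 2 * n \<ge> m" by (simp add: pidx_def)
    moreover have "coeff (lift_T n f z) J = 0" if "\<not> J \<subseteq> {..<m}" for J
      using assms that SF_support[OF assms(1)] by (auto simp: lift_T_def cotangent_def)
    ultimately show ?thesis using False by (simp add: coeff_pd pidx_def)
  qed
qed

lemma pd_xidx_lift_T:
  "pd (2 * n) (xidx n k) (lift_T n f) z = lift_T n (pd n k f) z"
proof (rule grassmann_eqI)
  fix I
  show "coeff (pd (2 * n) (xidx n k) (lift_T n f) z) I = coeff (lift_T n (pd n k f) z) I"
  proof (cases "k < n")
    case True
    have "(\<lambda>i. if i < n then (z(k := t)) i else 0) = (\<lambda>i. if i < n then z i else 0)(k := t)" for t
      using True by (auto simp: fun_eq_iff)
    then show ?thesis using True by (simp add: coeff_pd xidx_def lift_T_def rpd_def del: fun_upd_apply)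
  next
    case False
    then show ?thesis by (simp add: coeff_pd xidx_def lift_T_def)
  qed
qed

lemma pd_mom: "i < n + m \<Longrightarrow> k < n + m \<Longrightarrow> pd (2 * n) (pidx n m k) (mom n m i) z = (if i = k then 1 else 0)"
  by (auto simp: mom_def pd_coord_everywhere pidx_def split: if_splits)

lemma sgn_pow_mom: "sgn_pow q (mom n m i) z = (-1) ^ (q * e i) * mom n m i z"
  using sgn_pow_ghom[OF coord_ghom] by (simp add: mom_def par_pidx)

lemma coeff_differentiable_mom: "coeff_differentiable k (mom n m i) z"
  unfolding mom_def by (rule coeff_differentiable_coord)

context
  fixes S :: "nat \<Rightarrow> nat \<Rightarrow> superfun"
  assumes S: "\<And>i j. i < n + m \<Longrightarrow> j < n + m \<Longrightarrow> S i j \<in> SF_hom n m U (e i + e j + 1)"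
    and S_sym: "\<And>i j x. i < n + m \<Longrightarrow> j < n + m \<Longrightarrow> x \<in> U \<Longrightarrow> S i j x = (-1) ^ (e i * e j) * S j i x"
begin

lemma lift_S_ghom: "i < n + m \<Longrightarrow> j < n + m \<Longrightarrow> z \<in> cotangent \<Longrightarrow> lift_T n (S i j) z \<in> ghom (e i + e j + 1)"
  using S[of i j] by (auto simp: SF_hom_iff lift_T_def cotangent_def)

lemma lift_S_sym:
  "i < n + m \<Longrightarrow> j < n + m \<Longrightarrow> z \<in> cotangent \<Longrightarrow> lift_T n (S i j) z = (-1) ^ (e i * e j) * lift_T n (S j i) z"
  using S_sym[of i j] by (auto simp: lift_T_def cotangent_def)

lemma coeff_differentiable_hamiltonian: "coeff_differentiable (pidx n m k) (hamiltonian n m S) z"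
  unfolding hamiltonian_def
  by (intro coeff_differentiable_sum coeff_differentiable_times coeff_differentiable_lift_T coeff_differentiable_mom)

text \<open>Each of the two momenta in S^{ij} p_j p_i contributes one sum, and the symmetry of
  \<open>S\<close> makes them equal. This is the origin of the factor 2 in the derived
  bracket.\<close>

lemma pd_hamiltonian:
  assumes k: "k < n + m" and z: "z \<in> cotangent"
  shows "pd (2 * n) (pidx n m k) (hamiltonian n m S) z
    = (\<Sum>i<n + m. lift_T n (S k i) z * mom n m i z) + (\<Sum>i<n + m. lift_T n (S k i) z * mom n m i z)"
proof -
  let ?P = "pd (2 * n) (pidx n m k)" and ?s = "\<lambda>i j. lift_T n (S i j)" and ?p = "mom n m"
  note cd = coeff_differentiable_times[OF coeff_differentiable_lift_T coeff_differentiable_mom]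
    coeff_differentiable_lift_T coeff_differentiable_mom
  have trm: "?P (?s i j * ?p j * ?p i) z = (if j = k then sg (e k * (e i + e j + 1)) (?s i j z * ?p i z) else 0)
      + (if i = k then sg (e k * (e i + e j + 1) + e k * e j) (?s i j z * ?p j z) else 0)"
    if ij: "i < n + m" "j < n + m" for i j
  proof -
    have "?P (?s i j) z = 0" using pd_pidx_lift_T[OF SF_hom_SF[OF S[OF ij]] z] .
    then have "?P (?s i j * ?p j) z = sgn_pow (e k) (?s i j) z * (if j = k then 1 else 0)"
      using pd_times_cd[where k = "pidx n m k" and f = "?s i j" and g = "?p j" and z = z and N = "2 * n", OF cd(2,3)] pd_mom[OF ij(2) k] by (simp add: par_pidx)
    moreover have "?P (?s i j * ?p j * ?p i) z
        = ?P (?s i j * ?p j) z * ?p i z + sgn_pow (e k) (?s i j * ?p j) z * (if i = k then 1 else 0)"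
      using pd_times_cd[where k = "pidx n m k" and f = "?s i j * ?p j" and g = "?p i" and z = z and N = "2 * n", OF cd(1,3)] pd_mom[OF ij(1) k] by (simp add: par_pidx)
    ultimately show ?thesis
      using sgn_pow_ghom[where f = "?s i j", OF lift_S_ghom[OF ij z]]
      by (auto simp: sgn_pow_times sgn_pow_mom neg1_simps add_ac)
  qed
  have "?P (hamiltonian n m S) z = (\<Sum>i<n + m. \<Sum>j<n + m. ?P (?s i j * ?p j * ?p i) z)"
    unfolding hamiltonian_def using cd
    by (simp add: pd_sum_cd coeff_differentiable_sum coeff_differentiable_times)
  also have "\<dots> = (\<Sum>i<n + m. \<Sum>j<n + m. (if j = k then sg (e k * (e i + e j + 1)) (?s i j z * ?p i z) else 0))
      + (\<Sum>i<n + m. \<Sum>j<n + m. (if i = k then sg (e k * (e i + e j + 1) + e k * e j) (?s i j z * ?p j z) else 0))"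
    by (simp add: trm sum.distrib cong: sum.cong_simp)
  also have "(\<Sum>i<n + m. \<Sum>j<n + m. (if j = k then sg (e k * (e i + e j + 1)) (?s i j z * ?p i z) else 0))
      = (\<Sum>i<n + m. sg (e k * (e i + e k + 1)) (?s i k z * ?p i z))"
    using k by simp
  also have "\<dots> = (\<Sum>i<n + m. ?s k i z * ?p i z)"
  proof (intro sum.cong refl)
    fix i assume "i \<in> {..<n + m}"
    then have "?s i k z = sg (e i * e k) (?s k i z)" using lift_S_sym[of i k z] k z by (simp add: sg_def)
    then have "sg (e k * (e i + e k + 1)) (?s i k z * ?p i z) = sg (e k * (e i + e k + 1) + e i * e k) (?s k i z * ?p i z)"
      by (simp only: neg1_simps)
    also have "\<dots> = sg 0 (?s k i z * ?p i z)" by (rule sg_cong) auto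
    finally show "sg (e k * (e i + e k + 1)) (?s i k z * ?p i z) = ?s k i z * ?p i z" by (simp add: sg_def)
  qed
  also have "(\<Sum>i<n + m. \<Sum>j<n + m. (if i = k then sg (e k * (e i + e j + 1) + e k * e j) (?s i j z * ?p j z) else 0))
      = (\<Sum>j<n + m. sg (e k * (e k + e j + 1) + e k * e j) (?s k j z * ?p j z))"
    using k by (subst sum.swap) simp
  also have "\<dots> = (\<Sum>j<n + m. sg 0 (?s k j z * ?p j z))"
    by (intro sum.cong refl, rule sg_cong) auto
  finally show ?thesis by (simp add: sg_def)
qed

text \<open>The lift of f is independent of the momenta, so just the half of the canonical bracket
  with momentum derivatives of the Hamiltonian remains.\<close>

lemma can_bracket_hamiltonian:
  assumes f: "f \<in> SF n m U" and z: "z \<in> cotangent"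
  shows "can_bracket_T n m (hamiltonian n m S) (lift_T n f) z
    = (\<Sum>k<n + m. \<Sum>i<n + m. lift_T n (S k i) z * mom n m i z * lift_T n (pd n k f) z
        + lift_T n (S k i) z * mom n m i z * lift_T n (pd n k f) z)"
proof -
  let ?s = "\<lambda>i j. lift_T n (S i j)" and ?p = "mom n m"
  have "(-1) ^ e k * pd (2 * n) (pidx n m k) (sgn_pow (e k) (hamiltonian n m S)) z
      = (\<Sum>i<n + m. ?s k i z * ?p i z) + (\<Sum>i<n + m. ?s k i z * ?p i z)" if k: "k < n + m" for k
  proof -
    let ?Q = "(\<lambda>z. \<Sum>i<n + m. ?s k i z * ?p i z) :: superfun"
    have Q: "?Q z \<in> ghom (e k + 1)"
    proof -
      have "?s k i z * ?p i z \<in> ghom (e k + 1)" if i: "i < n + m" for i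
      proof -
        have "?s k i z * ?p i z \<in> ghom (e k + e i + 1 + e i)"
          using ghom_times[OF lift_S_ghom[OF k i z] coord_ghom[of "2 * n" "pidx n m i"]]
          by (simp add: mom_def par_pidx)
        moreover have "ghom (e k + e i + 1 + e i) = ghom (e k + 1)" by (rule ghom_cong) auto
        ultimately show ?thesis by (simp only:)
      qed
      then show ?thesis by (intro ghom_sum) auto
    qed
    have "pd (2 * n) (pidx n m k) (sgn_pow (e k) (hamiltonian n m S)) z
        = (-1) ^ (e k * e k) * sgn_pow (e k) (pd (2 * n) (pidx n m k) (hamiltonian n m S)) z"
      using pd_sgn_pow[where k = "pidx n m k" and f = "hamiltonian n m S" and z = z and N = "2 * n" and q = "e k",
          OF coeff_differentiable_hamiltonian] by (simp add: par_pidx)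
    also have "sgn_pow (e k) (pd (2 * n) (pidx n m k) (hamiltonian n m S)) z = sgn_pow (e k) (?Q + ?Q) z"
      using pd_hamiltonian[OF k z] by (simp add: sgn_pow_def)
    also have "\<dots> = (-1) ^ (e k * (e k + 1)) * (?Q z + ?Q z)"
      using sgn_pow_ghom[where f = "?Q + ?Q" and x = z and p = "e k + 1"] ghom_add[OF Q Q] by simp
    finally have "(-1) ^ e k * pd (2 * n) (pidx n m k) (sgn_pow (e k) (hamiltonian n m S)) z
        = sg (e k + (e k * e k + e k * (e k + 1))) (?Q z + ?Q z)"
      by (simp only: neg1_simps)
    also have "\<dots> = sg 0 (?Q z + ?Q z)" by (rule sg_cong) auto
    finally show ?thesis by (simp add: sg_def)
  qed
  then have "can_bracket_T n m (hamiltonian n m S) (lift_T n f) z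
      = (\<Sum>k<n + m. ((\<Sum>i<n + m. ?s k i z * ?p i z) + (\<Sum>i<n + m. ?s k i z * ?p i z)) * lift_T n (pd n k f) z)"
    unfolding can_bracket_T_def using f z
    by (simp add: pd_pidx_lift_T pd_xidx_lift_T flip: mult.assoc cong: sum.cong_simp)
  then show ?thesis
    by (simp add: sum_distrib_right distrib_right sum.distrib)
qed

text \<open>The first bracket is linear in the momenta, so its momentum derivatives on the zero
  section are its coefficients. The sum occurs twice because of the symmetry of the
  Hamiltonian.\<close>

lemma derived_bracket_eq:
  assumes f: "f \<in> SF n m U" and g: "g \<in> SF n m U" and x: "x \<in> U"
  shows "derived_bracket n m S f g x
    = (\<Sum>l<n + m. \<Sum>k<n + m. S l k x * pd n k (sgn_pow (e l) f) x * pd n l g x)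
    + (\<Sum>l<n + m. \<Sum>k<n + m. S l k x * pd n k (sgn_pow (e l) f) x * pd n l g x)"
proof -
  let ?s = "\<lambda>i j. lift_T n (S i j)" and ?p = "mom n m" and ?f = "\<lambda>k. lift_T n (pd n k f)"
  let ?G = "can_bracket_T n m (hamiltonian n m S) (lift_T n f)"
  define G' :: superfun where "G' = (\<Sum>k<n + m. \<Sum>i<n + m. ?s k i * ?p i * ?f k + ?s k i * ?p i * ?f k)"
  have z: "x \<in> cotangent" using x by (rule U_cotangent)
  have GG': "?G z = G' z" if "z \<in> cotangent" for z
    using can_bracket_hamiltonian[OF f that] by (simp add: G'_def)
  note cd = coeff_differentiable_times[OF coeff_differentiable_lift_T coeff_differentiable_mom]
    coeff_differentiable_lift_T coeff_differentiable_mom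
  have cdt: "coeff_differentiable (pidx n m l) (?s k i * ?p i * ?f k) z" for l k i z
    by (intro coeff_differentiable_times coeff_differentiable_lift_T coeff_differentiable_mom)
  have cdG': "coeff_differentiable (pidx n m l) G' z" for l z
    unfolding G'_def by (intro coeff_differentiable_sum coeff_differentiable_add cdt)
  have main: "(-1) ^ e l * pd (2 * n) (pidx n m l) (sgn_pow (e l) ?G) x
      = (\<Sum>k<n + m. S l k x * pd n k (sgn_pow (e l) f) x) + (\<Sum>k<n + m. S l k x * pd n k (sgn_pow (e l) f) x)"
    if l: "l < n + m" for l
  proof -
    let ?P = "pd (2 * n) (pidx n m l)"
    have trm: "?P (?s k i * ?p i * ?f k) x = (if i = l then sg (e l * (e k + e i + 1)) (S k i x * pd n k f x) else 0)"
      if ki: "k < n + m" "i < n + m" for k i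
    proof -
      have "?P (?s k i) x = 0" using pd_pidx_lift_T[OF SF_hom_SF[OF S[OF ki]] z] .
      then have "?P (?s k i * ?p i) x = sgn_pow (e l) (?s k i) x * (if i = l then 1 else 0)"
        using pd_times_cd[where k = "pidx n m l" and f = "?s k i" and g = "?p i" and z = x and N = "2 * n", OF cd(2,3)] pd_mom[OF ki(2) l] by (simp add: par_pidx)
      moreover have "?P (?f k) x = 0" using pd_pidx_lift_T[OF SF_pd[OF f] z] .
      moreover have "?P (?s k i * ?p i * ?f k) x
          = ?P (?s k i * ?p i) x * ?f k x + sgn_pow (e l) (?s k i * ?p i) x * ?P (?f k) x"
        using pd_times_cd[where k = "pidx n m l" and f = "?s k i * ?p i" and g = "?f k" and z = x and N = "2 * n", OF cd(1,2)] by (simp add: par_pidx)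
      moreover have "sgn_pow (e l) (?s k i) x = sg (e l * (e k + e i + 1)) (?s k i x)"
        using sgn_pow_ghom[where f = "?s k i", OF lift_S_ghom[OF ki z]] by (simp add: sg_def)
      ultimately show ?thesis
        using lift_T_U[OF x] by (simp add: neg1_simps)
    qed
    have "?P G' x = (\<Sum>k<n + m. \<Sum>i<n + m. ?P (?s k i * ?p i * ?f k) x + ?P (?s k i * ?p i * ?f k) x)"
      unfolding G'_def
      by (simp add: pd_sum_cd pd_add_cd cdt coeff_differentiable_sum coeff_differentiable_add)
    also have "\<dots> = (\<Sum>k<n + m. sg (e l * (e k + e l + 1)) (S k l x * pd n k f x) + sg (e l * (e k + e l + 1)) (S k l x * pd n k f x))"
      using l by (simp add: trm sum.distrib cong: sum.cong_simp)
    also have "\<dots> = (\<Sum>k<n + m. S l k x * pd n k f x + S l k x * pd n k f x)"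
    proof (intro sum.cong refl)
      fix k assume "k \<in> {..<n + m}"
      then have "S k l x = sg (e k * e l) (S l k x)" using S_sym[of k l x] l x by (simp add: sg_def)
      then have "sg (e l * (e k + e l + 1)) (S k l x * pd n k f x) = sg (e l * (e k + e l + 1) + e k * e l) (S l k x * pd n k f x)"
        by (simp only: neg1_simps)
      also have "\<dots> = sg 0 (S l k x * pd n k f x)" by (rule sg_cong) auto
      finally show "sg (e l * (e k + e l + 1)) (S k l x * pd n k f x) + sg (e l * (e k + e l + 1)) (S k l x * pd n k f x)
          = S l k x * pd n k f x + S l k x * pd n k f x" by (simp add: sg_def)
    qed
    finally have PG': "?P G' x = (\<Sum>k<n + m. S l k x * pd n k f x + S l k x * pd n k f x)" .
    \<comment> \<open>The formula for the first bracket holds on the whole momentum line through x,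
      hence it may be differentiated along that line.\<close>
    have "?P (sgn_pow (e l) ?G) x = ?P (sgn_pow (e l) G') x"
      by (rule pd_cong_line) (use GG' z cotangent_upd[OF z pidx_ge] in \<open>auto simp: sgn_pow_def\<close>)
    also have "\<dots> = (-1) ^ (e l * e l) * sgn_pow (e l) (?P G') x"
      using pd_sgn_pow[where k = "pidx n m l" and f = G' and z = x and N = "2 * n" and q = "e l", OF cdG'] by (simp add: par_pidx)
    also have "sgn_pow (e l) (?P G') x = sgn_pow (e l) (\<Sum>k<n + m. S l k * pd n k f + S l k * pd n k f) x"
      using PG' by (simp add: sgn_pow_def)
    also have "\<dots> = (\<Sum>k<n + m. sgn_pow (e l) (S l k) x * sgn_pow (e l) (pd n k f) x
        + sgn_pow (e l) (S l k) x * sgn_pow (e l) (pd n k f) x)"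
      by (simp add: sgn_pow_sum sgn_pow_add sgn_pow_times)
    finally have "(-1) ^ e l * ?P (sgn_pow (e l) ?G) x = (\<Sum>k<n + m.
        sg (e l) (sg (e l * e l) (sgn_pow (e l) (S l k) x * sgn_pow (e l) (pd n k f) x))
        + sg (e l) (sg (e l * e l) (sgn_pow (e l) (S l k) x * sgn_pow (e l) (pd n k f) x)))"
      by (simp add: neg1_simps)
    also have "\<dots> = (\<Sum>k<n + m. S l k x * pd n k (sgn_pow (e l) f) x + S l k x * pd n k (sgn_pow (e l) f) x)"
    proof (intro sum.cong refl)
      fix k assume "k \<in> {..<n + m}"
      then have k: "k < n + m" by simp
      have "sgn_pow (e l) (S l k) x = sg (e l * (e l + e k + 1)) (S l k x)"
        using sgn_pow_ghom[where f = "S l k" and x = x and p = "e l + e k + 1" and q = "e l"] S[OF l k] x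
        by (simp add: SF_hom_iff sg_def)
      then have "sg (e l) (sg (e l * e l) (sgn_pow (e l) (S l k) x * sgn_pow (e l) (pd n k f) x))
          = sg (e l + (e l * e l + e l * (e l + e k + 1))) (S l k x * sgn_pow (e l) (pd n k f) x)"
        by (simp only: neg1_simps)
      also have "\<dots> = sg (e l * e k) (S l k x * sgn_pow (e l) (pd n k f) x)" by (rule sg_cong) auto
      also have "\<dots> = S l k x * pd n k (sgn_pow (e l) f) x"
      proof -
        have "pd n k (sgn_pow (e l) f) x = sg (e l * e k) (sgn_pow (e l) (pd n k f) x)"
          unfolding sg_def
          by (rule pd_sgn_pow) (use f x SF_coeff smooth_fun_differentiable in \<open>unfold coeff_differentiable_def, blast\<close>)
        then show ?thesis by (simp only: neg1_simps)
      qed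
      finally show "sg (e l) (sg (e l * e l) (sgn_pow (e l) (S l k) x * sgn_pow (e l) (pd n k f) x))
        + sg (e l) (sg (e l * e l) (sgn_pow (e l) (S l k) x * sgn_pow (e l) (pd n k f) x))
        = S l k x * pd n k (sgn_pow (e l) f) x + S l k x * pd n k (sgn_pow (e l) f) x" by simp
    qed
    finally show ?thesis by (simp add: sum.distrib)
  qed
  have "derived_bracket n m S f g x
      = (\<Sum>l<n + m. (-1) ^ e l * pd (2 * n) (pidx n m l) (sgn_pow (e l) ?G) x * pd n l g x)"
    unfolding derived_bracket_def can_bracket_T_def[of n m ?G]
    using pd_pidx_lift_T[OF g z] lift_T_U[OF x] by (simp add: pd_xidx_lift_T mult.assoc)
  then show ?thesis
    by (simp add: main distrib_right sum_distrib_right sum.distrib cong: sum.cong_simp)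
qed

end

end

section \<open>The bracket on densities over a superdomain\<close>

lemma const_add: "const (r + s) = const r + const s"
  and const_mult: "const (r * s) = const r * const s"
  and const_0 [simp]: "const 0 = 0"
  and const_1 [simp]: "const 1 = 1"
  by (simp_all add: const_def fun_eq_iff gconst_add gconst_mult)

lemma const_commute: "const r * f = f * const r"
  by (rule ext) (simp only: const_def times_fun_apply gconst_commute[of r])

lemma const_apply: "const r x = gconst r"
  by (simp add: const_def)

lemma sgn_pow_0 [simp]: "sgn_pow k 0 = 0"
  by (simp add: sgn_pow_def fun_eq_iff)

lemma sgn_pow_sgn_pow [simp]: "sgn_pow q (sgn_pow q f) = f"
  by (simp add: sgn_pow_def fun_eq_iff)

lemma lookup_neg_one_power: "lk ((-1) ^ k * a) \<mu> = (-1) ^ k * lk a \<mu>"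
  by (cases "even k") auto

lemma lookup_single_0_times: "lk (Poly_Mapping.single 0 f * a) \<mu> = f * lk a \<mu>"
  unfolding mult_map_scale_conv_mult[symmetric] by (simp add: Poly_Mapping.map.rep_eq when_def)

lemma lookup_dens_sgn: "lk (dens_sgn a) \<mu> = sgn_pow 1 (lk a \<mu>)"
  unfolding dens_sgn_def by (simp add: Poly_Mapping.map.rep_eq when_def)

lemma keys_dens_sgn: "Poly_Mapping.keys (dens_sgn a) = Poly_Mapping.keys a"
proof -
  have "f = 0" if "sgn_pow 1 f = 0" for f
    using arg_cong[OF that, of "sgn_pow 1"] by (simp only: sgn_pow_sgn_pow sgn_pow_0)
  then have eq: "sgn_pow 1 f = 0 \<longleftrightarrow> f = 0" for f
    using sgn_pow_0[of 1] by (metis (full_types))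
  show ?thesis
    unfolding set_eq_iff in_keys_iff lookup_dens_sgn by (simp only: eq simp_thms)
qed

lemma density_sum_single: "a = (\<Sum>r\<in>Poly_Mapping.keys a. Poly_Mapping.single r (lk a r))"
proof (rule poly_mapping_eqI)
  fix k
  have "(\<Sum>r\<in>Poly_Mapping.keys a. lk a r when r = k) = lk a k"
    by (simp add: when_def in_keys_iff sum.delta)
  then show "lk a k = lk (\<Sum>r\<in>Poly_Mapping.keys a. Poly_Mapping.single r (lk a r)) k"
    by (simp add: lookup_sum lookup_single)
qed

text \<open>Constants as an operator, which can be moved through products without looping.\<close>

definition gscale :: "real \<Rightarrow> grassmann \<Rightarrow> grassmann" where
  "gscale r a = gconst r * a"

lemma gscale_commute: "gscale r (gscale s a) = gscale s (gscale r a)"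
  unfolding gscale_def by (metis gconst_commute mult.assoc)

lemma gscale_mult_right: "a * gscale r b = gscale r (a * b)"
  unfolding gscale_def by (metis gconst_commute mult.assoc)

lemma gscale_mult_left: "gscale r a * b = gscale r (a * b)"
  and gscale_add: "gscale r (a + b) = gscale r a + gscale r b"
  and sum_gscale: "(\<Sum>i\<in>X. gscale r (f i)) = gscale r (sum f X)"
  by (simp_all add: gscale_def mult.assoc distrib_left sum_distrib_left)

lemmas gscale_simps = gscale_def[symmetric] gscale_commute gscale_mult_right gscale_mult_left gscale_add sum_gscale

text \<open>\<theta> is an arbitrary odd function here, and \<gamma> is tied to A alone; the
  formulas in terms of a projective class enter later.\<close>

locale density_bracket = superdomain n U m for n U m +
  fixes S :: "nat \<Rightarrow> nat \<Rightarrow> superfun" and \<gamma> :: "nat \<Rightarrow> superfun" and \<theta> :: superfun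
    and A :: "nat \<Rightarrow> superfun"
  assumes SF_S: "\<And>i j. i < n + m \<Longrightarrow> j < n + m \<Longrightarrow> S i j \<in> SF_hom n m U (par n i + par n j + 1)"
    and sym_S: "\<And>i j x. i < n + m \<Longrightarrow> j < n + m \<Longrightarrow> x \<in> U \<Longrightarrow> S i j x = (-1) ^ (par n i * par n j) * S j i x"
    and SF_\<theta>: "\<theta> \<in> SF_hom n m U 1"
    and SF_\<gamma>: "\<And>i. i < n + m \<Longrightarrow> \<gamma> i \<in> SF_hom n m U (par n i + 1)"
    and SF_A: "\<And>i. i < n + m \<Longrightarrow> A i \<in> SF_hom n m U (par n i)"
    and \<gamma>_eq: "\<And>i x. i < n + m \<Longrightarrow> x \<in> U \<Longrightarrow> \<gamma> i x = - (\<Sum>j<n + m. S i j x * A j x)"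
begin

text \<open>Functions are normalised to vanish off the domain, so that equality over \<open>U\<close> becomes equality.\<close>

definition res :: "superfun \<Rightarrow> superfun" where
  "res f = (\<lambda>x. if x \<in> U then f x else 0)"

definition HR :: "nat \<Rightarrow> superfun set" where
  "HR p = {f \<in> SF_hom n m U p. \<forall>x. x \<notin> U \<longrightarrow> f x = 0}"

definition DR :: "nat \<Rightarrow> superfun \<Rightarrow> superfun" where
  "DR i f = res (pd n i f)"

lemma res_apply: "x \<in> U \<Longrightarrow> res f x = f x" "x \<notin> U \<Longrightarrow> res f x = 0"
  by (simp_all add: res_def)

lemma HR_res: "f \<in> SF_hom n m U p \<Longrightarrow> res f \<in> HR p"
  using SF_hom_eq_cong[of "res f" f m p] by (simp add: HR_def res_def)

lemma HR_SF_hom: "f \<in> HR p \<Longrightarrow> f \<in> SF_hom n m U p"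
  by (simp add: HR_def)

lemma HR_SF: "f \<in> HR p \<Longrightarrow> f \<in> SF n m U"
  by (auto simp: HR_def intro: SF_hom_SF)

lemma HR_outside: "f \<in> HR p \<Longrightarrow> x \<notin> U \<Longrightarrow> f x = 0"
  by (simp add: HR_def)

lemma HR_eqI:
  assumes "f \<in> HR p" "g \<in> HR q" "\<And>x. x \<in> U \<Longrightarrow> f x = g x"
  shows "f = g"
proof (rule ext)
  fix x show "f x = g x"
    using assms(3) HR_outside[OF assms(1)] HR_outside[OF assms(2)] by (cases "x \<in> U") auto
qed

lemma pd_res: "x \<in> U \<Longrightarrow> pd n i (res f) x = pd n i f x"
  by (rule pd_cong) (auto simp: res_apply)

lemma DR_apply: "x \<in> U \<Longrightarrow> DR i f x = pd n i f x"
  by (simp add: DR_def res_apply)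

section \<open>Functions over U as a model of the abstract calculus\<close>

sublocale super_derivations HR "n + m" "par n" DR "\<lambda>i. res (coord n i)" "res 1" const
proof
  show HRadd: "a + b \<in> HR p" if "a \<in> HR p" "b \<in> HR p" for a b p
    using that by (auto simp: HR_def SF_hom_add)
  show "- a \<in> HR p" if "a \<in> HR p" for a p
    using that by (auto simp: HR_def SF_hom_uminus)
  show "0 \<in> HR p" for p by (simp add: HR_def SF_hom_0)
  show HRmult: "a * b \<in> HR (p + q)" if "a \<in> HR p" "b \<in> HR q" for a b p q
    using that by (auto simp: HR_def SF_hom_times)
  show "HR p = HR q" if "even (p + q)" for p q
    using SF_hom_cong[OF that] by (simp add: HR_def)
  show "a * b = (-1) ^ (p * q) * (b * a)" if "a \<in> HR p" "b \<in> HR q" for a b p q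
  proof (rule ext)
    fix x show "(a * b) x = ((-1) ^ (p * q) * (b * a)) x"
      using that ghom_commute[of "a x" p "b x" q] by (cases "x \<in> U") (auto simp: HR_def SF_hom_iff)
  qed
  show HRc: "const r * a \<in> HR p" if "a \<in> HR p" for a p r
    using that by (auto simp: HR_def SF_hom_const_times)
  show "const r * a = a * const r" for r a by (rule const_commute)
  show "const (r + s) = const r + const s" "const (r * s) = const r * const s" for r s
    by (rule const_add const_mult)+
  show "const 0 = 0" "const 1 = 1" by simp_all
  show "res 1 \<in> HR 0" using HR_res[OF SF_hom_const[where m = m and r = 1]] by simp
  show "res 1 * a = a" if "a \<in> HR p" for a p
  proof (rule ext)
    fix x show "(res 1 * a) x = a x" using HR_outside[OF that] by (cases "x \<in> U") (auto simp: res_apply)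
  qed
  show "res (coord n i) \<in> HR (par n i)" if "i < n + m" for i
    by (rule HR_res[OF SF_hom_coord[OF that]])
  show HRD: "DR i a \<in> HR (p + par n i)" if "a \<in> HR p" for i a p
    unfolding DR_def by (rule HR_res[OF SF_hom_pd[OF HR_SF_hom[OF that]]])
  show "DR i (a + b) = DR i a + DR i b" if "a \<in> HR p" "b \<in> HR p" for i a b p
    by (rule HR_eqI[OF HRD[OF HRadd[OF that]] HRadd[OF HRD[OF that(1)] HRD[OF that(2)]]])
      (simp add: DR_apply pd_add[OF HR_SF[OF that(1)] HR_SF[OF that(2)]])
  show "DR i (const r * a) = const r * DR i a" if "a \<in> HR p" for i a p r
    by (rule HR_eqI[OF HRD[OF HRc[OF that]] HRc[OF HRD[OF that]]])
      (simp add: DR_apply pd_const_times[OF HR_SF[OF that]] const_apply)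
  show "DR i (a * b) = DR i a * b + (-1) ^ (par n i * p) * (a * DR i b)"
    if "a \<in> HR p" "b \<in> HR q" for i a b p q
  proof (rule ext)
    fix x show "DR i (a * b) x = (DR i a * b + (-1) ^ (par n i * p) * (a * DR i b)) x"
    proof (cases "x \<in> U")
      case True
      then have "sgn_pow (par n i) a x = (-1) ^ (par n i * p) * a x"
        using that(1) by (intro sgn_pow_ghom) (auto simp: HR_def SF_hom_iff)
      then show ?thesis
        using pd_times[OF HR_SF[OF that(1)] HR_SF[OF that(2)] True, of i] True
        by (simp add: DR_apply mult.assoc)
    qed (simp add: DR_def res_apply HR_outside[OF that(2)])
  qed
  show "DR i (DR j a) = (-1) ^ (par n i * par n j) * DR j (DR i a)" if "a \<in> HR p" for i j a p
  proof (rule ext)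
    fix x show "DR i (DR j a) x = ((-1) ^ (par n i * par n j) * DR j (DR i a)) x"
    proof (cases "x \<in> U")
      case True
      then show ?thesis
        using pd_commute[OF HR_SF[OF that] True, of i j] by (simp add: DR_apply DR_def pd_res res_apply)
    qed (simp add: DR_def res_apply)
  qed
  show "DR i (res (coord n j)) = (if i = j then res 1 else 0)" for i j
    by (rule ext) (auto simp: DR_def res_def pd_res[unfolded res_def] pd_coord_everywhere)
qed

sublocale super_connection HR "n + m" "par n" DR "\<lambda>i. res (coord n i)" "res 1" const
  "\<lambda>i j. res (S i j)" "\<lambda>i. res (A i)"
proof
  show "res (S i j) = (-1) ^ (par n i * par n j) * res (S j i)" if "i < n + m" "j < n + m" for i j
    by (rule ext) (use sym_S[OF that] in \<open>auto simp: res_def\<close>)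
  show "res (S i j) \<in> HR (par n i + par n j + 1)" if "i < n + m" "j < n + m" for i j
    by (rule HR_res[OF SF_S[OF that]])
qed (auto intro: HR_res SF_A)

definition W :: superfun where
  "W = (\<Sum>i<n + m. \<Sum>j<n + m. S i j * (A j * A i))"

definition \<Theta> :: superfun where
  "\<Theta> = res (\<theta> - W)"

lemma SF_W: "W \<in> SF_hom n m U 1"
  unfolding W_def
proof (intro SF_hom_sum)
  fix i j assume "i \<in> {..<n + m}" "j \<in> {..<n + m}"
  then have "S i j * (A j * A i) \<in> SF_hom n m U (par n i + par n j + 1 + (par n j + par n i))"
    by (intro SF_hom_times SF_S SF_A) auto
  moreover have "even (par n i + par n j + 1 + (par n j + par n i) + 1)" by auto
  ultimately show "S i j * (A j * A i) \<in> SF_hom n m U 1" using SF_hom_cong by blast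
qed

lemma H_\<Theta>: "\<Theta> \<in> HR 1"
  unfolding \<Theta>_def by (intro HR_res SF_hom_diff SF_\<theta> SF_W)

text \<open>The sign twist turns the biderivation into the bracket \<open>[a, b] = (-1)\<^bsup>a\<^esup> {a, b}\<close>.\<close>

definition K :: "real \<Rightarrow> superfun \<Rightarrow> real \<Rightarrow> superfun \<Rightarrow> superfun" where
  "K r \<phi> s \<psi> = dens_coeff_bracket n m S \<gamma> \<theta> r (sgn_pow 1 \<phi>) s \<psi>"

lemma pd_sgn_pow_hom:
  assumes "\<phi> \<in> SF_hom n m U p" "x \<in> U"
  shows "pd n i (sgn_pow q \<phi>) x = (-1) ^ (q * p) * pd n i \<phi> x"
proof -
  have "pd n i (sgn_pow q \<phi>) x = pd n i (const ((-1) ^ (q * p)) * \<phi>) x"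
  proof (rule pd_cong[OF _ assms(2)])
    fix y assume "y \<in> U"
    then have "sgn_pow q \<phi> y = (-1) ^ (q * p) * \<phi> y"
      using assms(1) by (intro sgn_pow_ghom) (auto simp: SF_hom_iff)
    then show "sgn_pow q \<phi> y = (const ((-1) ^ (q * p)) * \<phi>) y"
      by (cases "even (q * p)") (simp_all add: const_apply gconst_uminus)
  qed
  also have "\<dots> = gconst ((-1) ^ (q * p)) * pd n i \<phi> x"
    by (rule pd_const_times[OF SF_hom_SF[OF assms(1)] assms(2)])
  also have "\<dots> = (-1) ^ (q * p) * pd n i \<phi> x"
    by (cases "even (q * p)") (simp_all add: gconst_uminus)
  finally show ?thesis .
qed

text \<open>Carries the abstract results over to the concrete bracket. The four terms of
  \<open>dens_coeff_bracket\<close> match those of \<open>br_components\<close>; the square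
  \<open>W\<close> from the latter and \<Theta> add up to \<theta>.\<close>

lemma K_dbr:
  assumes \<phi>: "\<phi> \<in> SF_hom n m U p" and \<psi>: "\<psi> \<in> SF_hom n m U q" and x: "x \<in> U"
  shows "K r \<phi> s \<psi> x = dbr \<Theta> p r (res \<phi>) s (res \<psi>) x"
proof -
  let ?I = "{..<n + m}"
  have D: "DR i (res f) x = pd n i f x" for i f
    using x by (simp add: DR_apply pd_res)
  have first: "(\<Sum>i\<in>?I. \<Sum>j\<in>?I. S i j x * pd n j (sgn_pow (par n i) (sgn_pow 1 \<phi>)) x * pd n i \<psi> x)
      = (\<Sum>i\<in>?I. \<Sum>j\<in>?I. (-1) ^ ((par n i + 1) * p) * (S i j x * (pd n j \<phi> x * pd n i \<psi> x)))"
  proof (intro sum.cong refl)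
    fix i j
    have "sgn_pow (par n i) (sgn_pow 1 \<phi>) = sgn_pow (par n i + 1) \<phi>"
      by (cases "even (par n i)") (simp_all add: sgn_pow_def fun_eq_iff)
    then have "pd n j (sgn_pow (par n i) (sgn_pow 1 \<phi>)) x = (-1) ^ ((par n i + 1) * p) * pd n j \<phi> x"
      using pd_sgn_pow_hom[OF \<phi> x, of j "par n i + 1"] by simp
    then show "S i j x * pd n j (sgn_pow (par n i) (sgn_pow 1 \<phi>)) x * pd n i \<psi> x
        = (-1) ^ ((par n i + 1) * p) * (S i j x * (pd n j \<phi> x * pd n i \<psi> x))"
      by (simp add: neg1_simps)
  qed
  have gam: "(\<Sum>i\<in>?I. (- (\<Sum>j\<in>?I. S i j x * A j x)) * y i) = (\<Sum>i\<in>?I. \<gamma> i x * y i)" for y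
    using \<gamma>_eq x by (intro sum.cong refl) simp
  have "br p r (res \<phi>) s (res \<psi>) x
      = (\<Sum>i\<in>?I. \<Sum>j\<in>?I. (-1) ^ ((par n i + 1) * p) * (S i j x * (pd n j \<phi> x * pd n i \<psi> x)))
      + gconst r * (\<phi> x * (\<Sum>i\<in>?I. (- (\<Sum>j\<in>?I. S i j x * A j x)) * pd n i \<psi> x))
      + gconst s * ((-1) ^ p * ((\<Sum>i\<in>?I. (- (\<Sum>j\<in>?I. S i j x * A j x)) * pd n i \<phi> x) * \<psi> x))
      + gconst (r * s) * (\<phi> x * (W x * \<psi> x))"
    unfolding br_components[OF HR_res[OF \<phi>] HR_res[OF \<psi>]] W_def
    by (simp only: plus_fun_apply times_fun_apply uminus_apply sum_fun_apply neg_one_power_fun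
        const_apply D res_apply(1)[OF x])
  then have "dbr \<Theta> p r (res \<phi>) s (res \<psi>) x
      = (\<Sum>i\<in>?I. \<Sum>j\<in>?I. S i j x * pd n j (sgn_pow (par n i) (sgn_pow 1 \<phi>)) x * pd n i \<psi> x)
      + gconst r * (\<phi> x * (\<Sum>i\<in>?I. \<gamma> i x * pd n i \<psi> x))
      + gconst s * ((-1) ^ p * ((\<Sum>i\<in>?I. \<gamma> i x * pd n i \<phi> x) * \<psi> x))
      + gconst (r * s) * (\<phi> x * (\<theta> x * \<psi> x))"
    unfolding gam first[symmetric] dbr_def plus_fun_apply
    by (simp add: \<Theta>_def res_apply x const_apply left_diff_distrib right_diff_distrib)
  also have "(-1) ^ p * ((\<Sum>i\<in>?I. \<gamma> i x * pd n i \<phi> x) * \<psi> x) = (\<Sum>i\<in>?I. \<gamma> i x * pd n i (sgn_pow 1 \<phi>) x) * \<psi> x"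
    using pd_sgn_pow_hom[OF \<phi> x, of _ 1] by (simp add: neg1_simps sum_distrib_right)
  also have "(\<Sum>i\<in>?I. \<Sum>j\<in>?I. S i j x * pd n j (sgn_pow (par n i) (sgn_pow 1 \<phi>)) x * pd n i \<psi> x)
      + gconst r * (\<phi> x * (\<Sum>i\<in>?I. \<gamma> i x * pd n i \<psi> x))
      + gconst s * ((\<Sum>i\<in>?I. \<gamma> i x * pd n i (sgn_pow 1 \<phi>) x) * \<psi> x)
      + gconst (r * s) * (\<phi> x * (\<theta> x * \<psi> x)) = K r \<phi> s \<psi> x"
    unfolding K_def dens_coeff_bracket_def by (simp add: const_apply mult.assoc)
  finally show ?thesis ..
qed

lemma H_dbr: "f \<in> HR p \<Longrightarrow> g \<in> HR q \<Longrightarrow> dbr \<Theta> p r f s g \<in> HR (p + q + 1)"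
proof -
  assume f: "f \<in> HR p" and g: "g \<in> HR q"
  have "f * (\<Theta> * g) \<in> HR (p + q + 1)"
    using H_mult[OF f H_mult[OF H_\<Theta> g]] by (simp add: add_ac)
  then show ?thesis unfolding dbr_def by (intro H_add H_br H_c f g)
qed

lemma K_SF_hom:
  assumes \<phi>: "\<phi> \<in> SF_hom n m U p" and \<psi>: "\<psi> \<in> SF_hom n m U q"
  shows "K r \<phi> s \<psi> \<in> SF_hom n m U (p + q + 1)"
proof -
  have "K r \<phi> s \<psi> \<in> SF_hom n m U (p + q + 1) \<longleftrightarrow> dbr \<Theta> p r (res \<phi>) s (res \<psi>) \<in> SF_hom n m U (p + q + 1)"
    by (rule SF_hom_eq_cong) (rule K_dbr[OF assms])
  then show ?thesis using H_dbr[OF HR_res[OF \<phi>] HR_res[OF \<psi>]] by (simp add: HR_def)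
qed

lemma res_K:
  assumes \<phi>: "\<phi> \<in> SF_hom n m U p" and \<psi>: "\<psi> \<in> SF_hom n m U q"
  shows "res (K r \<phi> s \<psi>) = dbr \<Theta> p r (res \<phi>) s (res \<psi>)"
  by (rule HR_eqI[OF HR_res[OF K_SF_hom[OF assms]] H_dbr[OF HR_res[OF \<phi>] HR_res[OF \<psi>]]])
    (simp add: res_apply K_dbr[OF assms])

lemma dbr_anti:
  assumes f: "f \<in> HR p" and g: "g \<in> HR q"
  shows "dbr \<Theta> p r f s g = - ((-1) ^ ((p + 1) * (q + 1)) * dbr \<Theta> q s g r f)"
proof -
  have "g * (\<Theta> * f) = sg (q * (1 + p)) (\<Theta> * (f * g))"
    using commute[OF g H_mult[OF H_\<Theta> f]] by (simp add: sg_def mult.assoc)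
  also have "\<Theta> * (f * g) = sg (1 * p) (f * (\<Theta> * g))"
    using commute_left[OF H_\<Theta> f] by (simp add: sg_def)
  finally have "- sg ((p + 1) * (q + 1)) (g * (\<Theta> * f)) = sg (1 + ((p + 1) * (q + 1) + (q * (1 + p) + 1 * p))) (f * (\<Theta> * g))"
    by (simp only: sg_sg) (simp add: sg_def)
  also have "\<dots> = sg 0 (f * (\<Theta> * g))" by (rule sg_cong) auto
  finally have "f * (\<Theta> * g) = - ((-1) ^ ((p + 1) * (q + 1)) * (g * (\<Theta> * f)))" by (simp add: sg_def)
  then have "const (r * s) * (f * (\<Theta> * g)) = - ((-1) ^ ((p + 1) * (q + 1)) * (const (s * r) * (g * (\<Theta> * f))))"
    by (cases "even ((p + 1) * (q + 1))") (simp_all add: mult.commute[of s r] del: even_mult_iff)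
  then show ?thesis
    unfolding dbr_def br_anti[OF f g, of r s] by (simp only: distrib_left minus_add_distrib)
qed

lemma dbr_mult:
  assumes f: "f \<in> HR p" and a: "a \<in> HR q" and b: "b \<in> HR k"
  shows "dbr \<Theta> p r f (s + t) (a * b) = dbr \<Theta> p r f s a * b + (-1) ^ ((p + 1) * q) * (a * dbr \<Theta> p r f t b)"
proof -
  have "a * (f * (\<Theta> * b)) = sg (q * (p + 1)) (f * (\<Theta> * (a * b)))"
    using commute_left[OF a H_mult[OF f H_\<Theta>], of b] by (simp add: sg_def mult.assoc)
  then have "sg ((p + 1) * q) (a * (f * (\<Theta> * b))) = sg ((p + 1) * q + q * (p + 1)) (f * (\<Theta> * (a * b)))"
    by (simp only: sg_sg)
  also have "\<dots> = sg 0 (f * (\<Theta> * (a * b)))" by (rule sg_cong) auto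
  finally have "f * (\<Theta> * (a * b)) = sg ((p + 1) * q) (a * (f * (\<Theta> * b)))" by (simp add: sg_def)
  then show ?thesis
    unfolding dbr_def br_mult[OF f a b]
    by (simp add: ring_distribs neg1_simps c_simps distrib_left[of r s t])
qed

subsection \<open>Densities as sums of homogeneous terms\<close>

definition dbracket :: "density \<Rightarrow> density \<Rightarrow> density" where
  "dbracket a b = dens_biderivation n m S \<gamma> \<theta> (dens_sgn a) b"

lemma dbracket_sum:
  "dbracket a b = (\<Sum>r\<in>Poly_Mapping.keys a. \<Sum>s\<in>Poly_Mapping.keys b.
     Poly_Mapping.single (r + s) (K r (lk a r) s (lk b s)))"
  by (simp add: dbracket_def dens_biderivation_def keys_dens_sgn lookup_dens_sgn K_def)

lemma K_0_left [simp]: "K r 0 s \<psi> = 0"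
  and K_0_right [simp]: "K r \<phi> s 0 = 0"
  by (simp_all add: K_def dens_coeff_bracket_def)

text \<open>Index sets larger than the supports are allowed, so that the brackets of several
  densities can be compared over one common index set.\<close>

lemma lookup_dbracket:
  assumes "finite X" "Poly_Mapping.keys a \<subseteq> X" "finite Y" "Poly_Mapping.keys b \<subseteq> Y"
  shows "lk (dbracket a b) \<mu> = (\<Sum>r\<in>X. \<Sum>s\<in>Y. K r (lk a r) s (lk b s) when r + s = \<mu>)"
proof -
  have "lk (dbracket a b) \<mu> = (\<Sum>r\<in>Poly_Mapping.keys a. \<Sum>s\<in>Poly_Mapping.keys b. K r (lk a r) s (lk b s) when r + s = \<mu>)"
    by (simp add: dbracket_sum lookup_sum lookup_single)
  also have "\<dots> = (\<Sum>r\<in>X. \<Sum>s\<in>Poly_Mapping.keys b. K r (lk a r) s (lk b s) when r + s = \<mu>)"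
    by (rule sum.mono_neutral_left) (use assms in \<open>auto simp: in_keys_iff\<close>)
  also have "\<dots> = (\<Sum>r\<in>X. \<Sum>s\<in>Y. K r (lk a r) s (lk b s) when r + s = \<mu>)"
    by (intro sum.cong refl sum.mono_neutral_left) (use assms in \<open>auto simp: in_keys_iff\<close>)
  finally show ?thesis .
qed

lemma dbracket_single:
  "dbracket (Poly_Mapping.single r \<phi>) (Poly_Mapping.single s \<psi>) = Poly_Mapping.single (r + s) (K r \<phi> s \<psi>)"
  by (cases "\<phi> = 0"; cases "\<psi> = 0") (simp_all add: dbracket_sum)

lemma K_add_left:
  assumes "\<phi> \<in> SF n m U" "\<phi>' \<in> SF n m U" "x \<in> U"
  shows "K r (\<phi> + \<phi>') s \<psi> x = K r \<phi> s \<psi> x + K r \<phi>' s \<psi> x"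
proof -
  have sgn: "sgn_pow q (f + g) = sgn_pow q f + sgn_pow q g" for q f g
    by (rule ext) (simp add: sgn_pow_add)
  show ?thesis
    unfolding K_def dens_coeff_bracket_def sgn
    using assms by (simp add: pd_add[where m = m] SF_sgn_pow ring_distribs sum.distrib)
qed

lemma K_const_left:
  assumes "\<phi> \<in> SF n m U" "x \<in> U"
  shows "K r (const t * \<phi>) s \<psi> x = gconst t * K r \<phi> s \<psi> x"
proof -
  have sgn: "sgn_pow q (const t * f) = const t * sgn_pow q f" for q f
    by (rule ext) (simp add: sgn_pow_def const_apply ginv_times)
  show ?thesis
    unfolding K_def dens_coeff_bracket_def sgn
    using assms by (simp add: pd_const_times[where m = m] SF_sgn_pow const_apply gscale_simps mult.assoc)
qed

lemma K_add_right:
  assumes "\<psi> \<in> SF n m U" "\<psi>' \<in> SF n m U" "x \<in> U"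
  shows "K r \<phi> s (\<psi> + \<psi>') x = K r \<phi> s \<psi> x + K r \<phi> s \<psi>' x"
  unfolding K_def dens_coeff_bracket_def
  using assms by (simp add: pd_add[where m = m] ring_distribs sum.distrib)

lemma K_const_right:
  assumes "\<psi> \<in> SF n m U" "x \<in> U"
  shows "K r \<phi> s (const t * \<psi>) x = gconst t * K r \<phi> s \<psi> x"
  unfolding K_def dens_coeff_bracket_def
  using assms by (simp add: pd_const_times[where m = m] const_apply gscale_simps mult.assoc)

lemma lookup_dbracket_add_left:
  assumes "a \<in> dens n m U" "a' \<in> dens n m U" "x \<in> U"
  shows "lk (dbracket (a + a') b) \<mu> x = lk (dbracket a b) \<mu> x + lk (dbracket a' b) \<mu> x"
proof -
  let ?X = "Poly_Mapping.keys a \<union> Poly_Mapping.keys a'" and ?Y = "Poly_Mapping.keys b"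
  have "Poly_Mapping.keys (a + a') \<subseteq> ?X" by (rule keys_add)
  note L = lookup_dbracket[OF _ this _ order_refl, of b]
    lookup_dbracket[where X = ?X and a = a and b = b and Y = ?Y, OF _ Un_upper1 _ order_refl]
    lookup_dbracket[where X = ?X and a = a' and b = b and Y = ?Y, OF _ Un_upper2 _ order_refl]
  show ?thesis
    using assms by (simp add: L[simplified] lookup_add K_add_left dens_def when_def if_distrib[of "\<lambda>f. f x"]
        sum.distrib[symmetric] cong: if_cong) (intro sum.cong refl, auto)
qed

lemma lookup_dbracket_add_right:
  assumes "b \<in> dens n m U" "b' \<in> dens n m U" "x \<in> U"
  shows "lk (dbracket a (b + b')) \<mu> x = lk (dbracket a b) \<mu> x + lk (dbracket a b') \<mu> x"
proof -
  let ?Y = "Poly_Mapping.keys b \<union> Poly_Mapping.keys b'" and ?X = "Poly_Mapping.keys a"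
  have "Poly_Mapping.keys (b + b') \<subseteq> ?Y" by (rule keys_add)
  note L = lookup_dbracket[OF _ order_refl _ this, of a]
    lookup_dbracket[where X = ?X and a = a and b = b and Y = ?Y, OF _ order_refl _ Un_upper1]
    lookup_dbracket[where X = ?X and a = a and b = b' and Y = ?Y, OF _ order_refl _ Un_upper2]
  show ?thesis
    using assms by (simp add: L[simplified] lookup_add K_add_right dens_def when_def if_distrib[of "\<lambda>f. f x"]
        sum.distrib[symmetric] cong: if_cong) (intro sum.cong refl, auto)
qed

lemma lookup_dbracket_const_left:
  assumes "a \<in> dens n m U" "x \<in> U"
  shows "lk (dbracket (Poly_Mapping.single 0 (const t) * a) b) \<mu> x = gconst t * lk (dbracket a b) \<mu> x"
proof -
  have "Poly_Mapping.keys (Poly_Mapping.single 0 (const t) * a) \<subseteq> Poly_Mapping.keys a"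
    by (auto simp: in_keys_iff lookup_single_0_times)
  note L = lookup_dbracket[OF _ this _ order_refl, of b, simplified] lookup_dbracket[OF _ order_refl _ order_refl, of a b, simplified]
  show ?thesis
    using assms by (simp add: L lookup_single_0_times K_const_left dens_def when_def if_distrib[of "\<lambda>f. f x"]
        sum_distrib_left cong: if_cong) (intro sum.cong refl, auto)
qed

lemma lookup_dbracket_const_right:
  assumes "b \<in> dens n m U" "x \<in> U"
  shows "lk (dbracket a (Poly_Mapping.single 0 (const t) * b)) \<mu> x = gconst t * lk (dbracket a b) \<mu> x"
proof -
  have "Poly_Mapping.keys (Poly_Mapping.single 0 (const t) * b) \<subseteq> Poly_Mapping.keys b"
    by (auto simp: in_keys_iff lookup_single_0_times)
  note L = lookup_dbracket[OF _ order_refl _ this, of a, simplified] lookup_dbracket[OF _ order_refl _ order_refl, of a b, simplified]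
  show ?thesis
    using assms by (simp add: L lookup_single_0_times K_const_right dens_def when_def if_distrib[of "\<lambda>f. f x"]
        sum_distrib_left cong: if_cong) (intro sum.cong refl, auto)
qed

end

section \<open>Poisson identities for sums of densities\<close>

lemma sum3_rotate:
  "(\<Sum>s\<in>Y. \<Sum>t\<in>Z. \<Sum>r\<in>X. F r s t) = (\<Sum>r\<in>X. \<Sum>s\<in>Y. \<Sum>t\<in>Z. F r s t)"
proof -
  have "(\<Sum>s\<in>Y. \<Sum>t\<in>Z. \<Sum>r\<in>X. F r s t) = (\<Sum>s\<in>Y. \<Sum>r\<in>X. \<Sum>t\<in>Z. F r s t)"
    by (intro sum.cong refl sum.swap)
  also have "\<dots> = (\<Sum>r\<in>X. \<Sum>s\<in>Y. \<Sum>t\<in>Z. F r s t)" by (rule sum.swap)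
  finally show ?thesis .
qed

lemma when_apply: "((f when P) :: superfun) x = (f x when P)"
  by (simp add: when_def)

lemma SF_hom_subset:
  assumes "f \<in> SF_hom n m U p" "V \<subseteq> U"
  shows "f \<in> SF_hom n m V p"
  using assms smooth_fun_subset[of n U _ V] unfolding SF_hom_def SF_def by blast

lemma dens_homD: "a \<in> dens_hom n m U p \<Longrightarrow> lk a r \<in> SF_hom n m U p"
  by (simp add: dens_hom_def)

context density_bracket
begin

lemma dens_hom_single: "\<phi> \<in> SF_hom n m U p \<Longrightarrow> Poly_Mapping.single r \<phi> \<in> dens_hom n m U p"
  by (simp add: dens_hom_def lookup_single when_def SF_hom_0)

lemma dens_single: "\<phi> \<in> SF n m U \<Longrightarrow> Poly_Mapping.single r \<phi> \<in> dens n m U"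
  by (simp add: dens_def lookup_single when_def SF_0)

lemma dens_sum: "(\<And>i. i \<in> X \<Longrightarrow> y i \<in> dens n m U) \<Longrightarrow> sum y X \<in> dens n m U"
  by (simp add: dens_def lookup_sum SF_sum)

lemma lookup_dbracket_sum_right:
  "(\<And>i. i \<in> X \<Longrightarrow> y i \<in> dens n m U) \<Longrightarrow> x \<in> U \<Longrightarrow>
    lk (dbracket a (sum y X)) \<mu> x = (\<Sum>i\<in>X. lk (dbracket a (y i)) \<mu> x)"
proof (induction X rule: infinite_finite_induct)
  case (insert i X)
  have "lk (dbracket a (y i + sum y X)) \<mu> x = lk (dbracket a (y i)) \<mu> x + lk (dbracket a (sum y X)) \<mu> x"
    by (intro lookup_dbracket_add_right dens_sum insert.prems) auto
  moreover have "lk (dbracket a (sum y X)) \<mu> x = (\<Sum>i\<in>X. lk (dbracket a (y i)) \<mu> x)"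
    by (intro insert.IH insert.prems) auto
  ultimately show ?case using insert.hyps by simp
qed (simp_all add: dbracket_sum)

lemma lookup_dbracket_sum_left:
  "(\<And>i. i \<in> X \<Longrightarrow> y i \<in> dens n m U) \<Longrightarrow> x \<in> U \<Longrightarrow>
    lk (dbracket (sum y X) b) \<mu> x = (\<Sum>i\<in>X. lk (dbracket (y i) b) \<mu> x)"
proof (induction X rule: infinite_finite_induct)
  case (insert i X)
  have "lk (dbracket (y i + sum y X) b) \<mu> x = lk (dbracket (y i) b) \<mu> x + lk (dbracket (sum y X) b) \<mu> x"
    by (intro lookup_dbracket_add_left dens_sum insert.prems) auto
  moreover have "lk (dbracket (sum y X) b) \<mu> x = (\<Sum>i\<in>X. lk (dbracket (y i) b) \<mu> x)"
    by (intro insert.IH insert.prems) auto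
  ultimately show ?case using insert.hyps by simp
qed (simp_all add: dbracket_sum)

lemma lookup_dbracket_single_right:
  "lk (dbracket a (Poly_Mapping.single w \<eta>)) \<mu> = (\<Sum>r\<in>Poly_Mapping.keys a. K r (lk a r) w \<eta> when r + w = \<mu>)"
  using lookup_dbracket[of "Poly_Mapping.keys a" a "{w}" "Poly_Mapping.single w \<eta>" \<mu>] by simp

lemma lookup_dbracket_single_left:
  "lk (dbracket (Poly_Mapping.single w \<eta>) c) \<mu> = (\<Sum>t\<in>Poly_Mapping.keys c. K w \<eta> t (lk c t) when w + t = \<mu>)"
  using lookup_dbracket[of "{w}" "Poly_Mapping.single w \<eta>" "Poly_Mapping.keys c" c \<mu>] by simp

lemma lookup_dbracket_dbracket_right:
  assumes b: "b \<in> dens_hom n m U q" and c: "c \<in> dens_hom n m U k" and x: "x \<in> U"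
  shows "lk (dbracket a (dbracket b c)) \<mu> x
    = (\<Sum>r\<in>Poly_Mapping.keys a. \<Sum>s\<in>Poly_Mapping.keys b. \<Sum>t\<in>Poly_Mapping.keys c.
        K r (lk a r) (s + t) (K s (lk b s) t (lk c t)) x when r + (s + t) = \<mu>)"
proof -
  have mem: "Poly_Mapping.single (s + t) (K s (lk b s) t (lk c t)) \<in> dens n m U" for s t
    by (rule dens_single[OF SF_hom_SF[OF K_SF_hom[OF dens_homD[OF b] dens_homD[OF c]]]])
  have "lk (dbracket a (dbracket b c)) \<mu> x
      = (\<Sum>s\<in>Poly_Mapping.keys b. \<Sum>t\<in>Poly_Mapping.keys c.
          lk (dbracket a (Poly_Mapping.single (s + t) (K s (lk b s) t (lk c t)))) \<mu> x)"
    unfolding dbracket_sum[of b c] using mem x by (simp add: lookup_dbracket_sum_right dens_sum)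
  also have "\<dots> = (\<Sum>s\<in>Poly_Mapping.keys b. \<Sum>t\<in>Poly_Mapping.keys c. \<Sum>r\<in>Poly_Mapping.keys a.
        K r (lk a r) (s + t) (K s (lk b s) t (lk c t)) x when r + (s + t) = \<mu>)"
    unfolding lookup_dbracket_single_right by (simp add: when_apply)
  finally show ?thesis by (rule trans[OF _ sum3_rotate])
qed

lemma lookup_dbracket_dbracket_left:
  assumes a: "a \<in> dens_hom n m U p" and b: "b \<in> dens_hom n m U q" and x: "x \<in> U"
  shows "lk (dbracket (dbracket a b) c) \<mu> x
    = (\<Sum>r\<in>Poly_Mapping.keys a. \<Sum>s\<in>Poly_Mapping.keys b. \<Sum>t\<in>Poly_Mapping.keys c.
        K (r + s) (K r (lk a r) s (lk b s)) t (lk c t) x when r + (s + t) = \<mu>)"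
proof -
  have mem: "Poly_Mapping.single (r + s) (K r (lk a r) s (lk b s)) \<in> dens n m U" for r s
    by (rule dens_single[OF SF_hom_SF[OF K_SF_hom[OF dens_homD[OF a] dens_homD[OF b]]]])
  have "lk (dbracket (dbracket a b) c) \<mu> x
      = (\<Sum>r\<in>Poly_Mapping.keys a. \<Sum>s\<in>Poly_Mapping.keys b.
          lk (dbracket (Poly_Mapping.single (r + s) (K r (lk a r) s (lk b s))) c) \<mu> x)"
    unfolding dbracket_sum[of a b] using mem x by (simp add: lookup_dbracket_sum_left dens_sum)
  then show ?thesis
    unfolding lookup_dbracket_single_left by (simp add: when_apply add.assoc)
qed

lemma dens_eqI: "(\<And>\<mu> x. x \<in> U \<Longrightarrow> lk a \<mu> x = lk b \<mu> x) \<Longrightarrow> dens_eq U a b"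
  by (simp add: dens_eq_def eq_on_def)

lemma dens_eqD: "dens_eq U a b \<Longrightarrow> x \<in> U \<Longrightarrow> lk a \<mu> x = lk b \<mu> x"
  by (simp add: dens_eq_def eq_on_def)

lemma K_jacobi:
  assumes \<phi>: "\<phi> \<in> SF_hom n m U p" and \<psi>: "\<psi> \<in> SF_hom n m U q" and \<eta>: "\<eta> \<in> SF_hom n m U k" and x: "x \<in> U"
  shows "K r \<phi> (s + t) (K s \<psi> t \<eta>) x - (-1) ^ ((p + 1) * (q + 1)) * K s \<psi> (r + t) (K r \<phi> t \<eta>) x
      - K (r + s) (K r \<phi> s \<psi>) t \<eta> x
    = djac \<Theta> p r (res \<phi>) q s (res \<psi>) t (res \<eta>) x"
  unfolding djac_def K_dbr[OF \<phi> K_SF_hom[OF \<psi> \<eta>] x] K_dbr[OF \<psi> K_SF_hom[OF \<phi> \<eta>] x]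
    K_dbr[OF K_SF_hom[OF \<phi> \<psi>] \<eta> x] res_K[OF \<psi> \<eta>] res_K[OF \<phi> \<eta>] res_K[OF \<phi> \<psi>]
  by (simp only: minus_apply times_fun_apply neg_one_power_fun)

text \<open>Each identity is additive in every argument, so it is checked on terms of a single
  weight, where it is an identity for \<open>dbr\<close>. The Jacobi identity is the one that has to
  be supplied.\<close>

lemma dbracket_odd_poisson:
  assumes djac: "\<And>p q k f g h r s t. f \<in> HR p \<Longrightarrow> g \<in> HR q \<Longrightarrow> h \<in> HR k \<Longrightarrow> djac \<Theta> p r f q s g t h = 0"
  shows "odd_poisson (dens_eq U) (\<lambda>r. Poly_Mapping.single 0 (const r)) (dens n m U) (dens_hom n m U) dbracket"
  unfolding odd_poisson_def
proof (intro conjI ballI allI)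
  fix a b c and s t :: real assume a: "a \<in> dens n m U" and b: "b \<in> dens n m U" and c: "c \<in> dens n m U"
  let ?c = "\<lambda>r. Poly_Mapping.single 0 (const r)"
  have C: "?c r * a \<in> dens n m U" if "a \<in> dens n m U" for r a
    using that by (auto simp: dens_def lookup_single_0_times SF_times SF_const)
  show "dens_eq U (dbracket (?c s * a + ?c t * b) c) (?c s * dbracket a c + ?c t * dbracket b c)"
    by (rule dens_eqI)
      (simp add: lookup_dbracket_add_left[OF C[OF a] C[OF b]] lookup_dbracket_const_left[OF a]
        lookup_dbracket_const_left[OF b] lookup_add lookup_single_0_times const_apply)
  show "dens_eq U (dbracket c (?c s * a + ?c t * b)) (?c s * dbracket c a + ?c t * dbracket c b)"
    by (rule dens_eqI)
      (simp add: lookup_dbracket_add_right[OF C[OF a] C[OF b]] lookup_dbracket_const_right[OF a]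
        lookup_dbracket_const_right[OF b] lookup_add lookup_single_0_times const_apply)
next
  fix p q a b assume a: "a \<in> dens_hom n m U p" and b: "b \<in> dens_hom n m U q"
  have "(K r (lk a r) s (lk b s) when r + s = \<mu>) \<in> SF_hom n m U (p + q + 1)" for r s \<mu>
    using K_SF_hom[OF dens_homD[OF a] dens_homD[OF b], of r r s s] SF_hom_0[of m "p + q + 1"]
    by (cases "r + s = \<mu>") (simp_all only: when_simps simp_thms)
  then show "dbracket a b \<in> dens_hom n m U (p + q + 1)"
    by (simp add: dens_hom_def lookup_dbracket[OF _ order_refl _ order_refl] SF_hom_sum)
next
  fix p q a b assume a: "a \<in> dens_hom n m U p" and b: "b \<in> dens_hom n m U q"
  have "K r (lk a r) s (lk b s) x = - ((-1) ^ ((p + 1) * (q + 1)) * K s (lk b s) r (lk a r) x)"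
    if "x \<in> U" for r s x
    unfolding K_dbr[OF dens_homD[OF a] dens_homD[OF b] that] K_dbr[OF dens_homD[OF b] dens_homD[OF a] that]
      dbr_anti[OF HR_res[OF dens_homD[OF a]] HR_res[OF dens_homD[OF b]]]
    by (simp only: uminus_apply times_fun_apply neg_one_power_fun)
  then have *: "(K r (lk a r) s (lk b s) x when r + s = \<mu>)
      = - ((-1) ^ ((p + 1) * (q + 1)) * (K s (lk b s) r (lk a r) x when s + r = \<mu>))"
    if "x \<in> U" for r s x \<mu>
    using that by (cases "r + s = \<mu>") (auto simp: add.commute)
  show "dens_eq U (dbracket a b) (- ((-1) ^ ((p + 1) * (q + 1)) * dbracket b a))"
  proof (rule dens_eqI)
    fix \<mu> x assume x: "x \<in> U"
    have "lk (dbracket a b) \<mu> x = (\<Sum>r\<in>Poly_Mapping.keys a. \<Sum>s\<in>Poly_Mapping.keys b. K r (lk a r) s (lk b s) x when r + s = \<mu>)"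
      by (simp add: lookup_dbracket[OF _ order_refl _ order_refl] when_apply)
    also have "\<dots> = - ((-1) ^ ((p + 1) * (q + 1)) * (\<Sum>s\<in>Poly_Mapping.keys b. \<Sum>r\<in>Poly_Mapping.keys a.
        K s (lk b s) r (lk a r) x when s + r = \<mu>))"
      by (subst sum.swap) (simp only: *[OF x] sum_negf sum_distrib_left)
    also have "(\<Sum>s\<in>Poly_Mapping.keys b. \<Sum>r\<in>Poly_Mapping.keys a. K s (lk b s) r (lk a r) x when s + r = \<mu>) = lk (dbracket b a) \<mu> x"
      by (simp add: lookup_dbracket[OF _ order_refl _ order_refl] when_apply)
    finally show "lk (dbracket a b) \<mu> x = lk (- ((-1) ^ ((p + 1) * (q + 1)) * dbracket b a)) \<mu> x"
      by (simp only: lookup_uminus lookup_neg_one_power uminus_apply times_fun_apply neg_one_power_fun)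
  qed
next
  fix p q k a b c
  assume a: "a \<in> dens_hom n m U p" and b: "b \<in> dens_hom n m U q" and c: "c \<in> dens_hom n m U k"
  let ?\<sigma> = "(-1) ^ ((p + 1) * (q + 1))"
  have "K r (lk a r) (s + t) (K s (lk b s) t (lk c t)) x
      = K (r + s) (K r (lk a r) s (lk b s)) t (lk c t) x + ?\<sigma> * K s (lk b s) (r + t) (K r (lk a r) t (lk c t)) x"
    if "x \<in> U" for r s t x
  proof -
    have "djac \<Theta> p r (res (lk a r)) q s (res (lk b s)) t (res (lk c t)) x = 0"
      using djac[OF HR_res[OF dens_homD[OF a]] HR_res[OF dens_homD[OF b]] HR_res[OF dens_homD[OF c]]] by simp
    then show ?thesis
      unfolding K_jacobi[OF dens_homD[OF a] dens_homD[OF b] dens_homD[OF c] that, symmetric] diff_diff_eq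
      by (simp only: right_minus_eq add.commute)
  qed
  then have *: "(K r (lk a r) (s + t) (K s (lk b s) t (lk c t)) x when r + (s + t) = \<mu>)
      = (K (r + s) (K r (lk a r) s (lk b s)) t (lk c t) x when r + (s + t) = \<mu>)
      + ?\<sigma> * (K s (lk b s) (r + t) (K r (lk a r) t (lk c t)) x when s + (r + t) = \<mu>)"
    if "x \<in> U" for r s t x \<mu>
    using that by (cases "r + (s + t) = \<mu>") (auto simp: add.left_commute)
  show "dens_eq U (dbracket a (dbracket b c)) (dbracket (dbracket a b) c + ?\<sigma> * dbracket b (dbracket a c))"
  proof (rule dens_eqI)
    fix \<mu> x assume x: "x \<in> U"
    have "lk (dbracket b (dbracket a c)) \<mu> x
      = (\<Sum>r\<in>Poly_Mapping.keys a. \<Sum>s\<in>Poly_Mapping.keys b. \<Sum>t\<in>Poly_Mapping.keys c.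
          K s (lk b s) (r + t) (K r (lk a r) t (lk c t)) x when s + (r + t) = \<mu>)"
      by (subst lookup_dbracket_dbracket_right[OF a c x]) (rule sum.swap)
    then show "lk (dbracket a (dbracket b c)) \<mu> x = lk (dbracket (dbracket a b) c + ?\<sigma> * dbracket b (dbracket a c)) \<mu> x"
      by (simp only: lookup_add lookup_neg_one_power plus_fun_apply times_fun_apply neg_one_power_fun
          lookup_dbracket_dbracket_right[OF b c x] lookup_dbracket_dbracket_left[OF a b x] *[OF x]
          sum.distrib sum_distrib_left)
  qed
next
  fix p q k a b c
  assume a: "a \<in> dens_hom n m U p" and b: "b \<in> dens_hom n m U q" and c: "c \<in> dens_hom n m U k"
  let ?\<sigma> = "(-1) ^ ((p + 1) * q)"
  let ?S = "Poly_Mapping.single"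
  have *: "K r (lk a r) (s + t) (lk b s * lk c t) x
      = K r (lk a r) s (lk b s) x * lk c t x + ?\<sigma> * (lk b s x * K r (lk a r) t (lk c t) x)"
    if x: "x \<in> U" for r s t x
  proof -
    have "res (lk b s * lk c t) = res (lk b s) * res (lk c t)"
      by (simp add: res_def fun_eq_iff)
    then show ?thesis
      unfolding K_dbr[OF dens_homD[OF a] SF_hom_times[OF dens_homD[OF b] dens_homD[OF c]] x]
        K_dbr[OF dens_homD[OF a] dens_homD[OF b] x] K_dbr[OF dens_homD[OF a] dens_homD[OF c] x]
      using dbr_mult[OF HR_res[OF dens_homD[OF a, of r]] HR_res[OF dens_homD[OF b, of s]]
          HR_res[OF dens_homD[OF c, of t]], of r s t] x by (simp only: plus_fun_apply times_fun_apply neg_one_power_fun res_apply)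
  qed
  have bc: "b * c = (\<Sum>s\<in>Poly_Mapping.keys b. \<Sum>t\<in>Poly_Mapping.keys c. ?S (s + t) (lk b s * lk c t))"
    by (subst density_sum_single[of b], subst density_sum_single[of c]) (simp add: sum_product mult_single)
  have abc: "dbracket a b * c = (\<Sum>r\<in>Poly_Mapping.keys a. \<Sum>s\<in>Poly_Mapping.keys b. \<Sum>t\<in>Poly_Mapping.keys c.
      ?S (r + (s + t)) (K r (lk a r) s (lk b s) * lk c t))"
    by (subst density_sum_single[of c], simp only: dbracket_sum sum_distrib_right)
      (simp add: sum_distrib_left mult_single add.assoc)
  have bac: "b * dbracket a c = (\<Sum>r\<in>Poly_Mapping.keys a. \<Sum>s\<in>Poly_Mapping.keys b. \<Sum>t\<in>Poly_Mapping.keys c.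
      ?S (r + (s + t)) (lk b s * K r (lk a r) t (lk c t)))"
  proof -
    have "b * dbracket a c = (\<Sum>s\<in>Poly_Mapping.keys b. \<Sum>r\<in>Poly_Mapping.keys a. \<Sum>t\<in>Poly_Mapping.keys c.
      ?S (r + (s + t)) (lk b s * K r (lk a r) t (lk c t)))"
      by (subst density_sum_single[of b], simp only: dbracket_sum sum_distrib_right)
        (simp add: sum_distrib_left mult_single add.left_commute)
    also have "\<dots> = (\<Sum>r\<in>Poly_Mapping.keys a. \<Sum>s\<in>Poly_Mapping.keys b. \<Sum>t\<in>Poly_Mapping.keys c.
      ?S (r + (s + t)) (lk b s * K r (lk a r) t (lk c t)))" by (rule sum.swap)
    finally show ?thesis .
  qed
  show "dens_eq U (dbracket a (b * c)) (dbracket a b * c + ?\<sigma> * (b * dbracket a c))"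
  proof (rule dens_eqI)
    fix \<mu> x assume x: "x \<in> U"
    have mem: "?S (s + t) (lk b s * lk c t) \<in> dens n m U" for s t
      by (rule dens_single[OF SF_hom_SF[OF SF_hom_times[OF dens_homD[OF b] dens_homD[OF c]]]])
    have "lk (dbracket a (b * c)) \<mu> x = (\<Sum>s\<in>Poly_Mapping.keys b. \<Sum>t\<in>Poly_Mapping.keys c.
        lk (dbracket a (?S (s + t) (lk b s * lk c t))) \<mu> x)"
      unfolding bc using mem x by (simp add: lookup_dbracket_sum_right dens_sum)
    also have "\<dots> = (\<Sum>r\<in>Poly_Mapping.keys a. \<Sum>s\<in>Poly_Mapping.keys b. \<Sum>t\<in>Poly_Mapping.keys c.
        K r (lk a r) (s + t) (lk b s * lk c t) x when r + (s + t) = \<mu>)"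
      unfolding lookup_dbracket_single_right by (subst sum3_rotate[symmetric]) (simp add: when_apply)
    also have "\<dots> = (\<Sum>r\<in>Poly_Mapping.keys a. \<Sum>s\<in>Poly_Mapping.keys b. \<Sum>t\<in>Poly_Mapping.keys c.
        K r (lk a r) s (lk b s) x * lk c t x when r + (s + t) = \<mu>)
      + ?\<sigma> * (\<Sum>r\<in>Poly_Mapping.keys a. \<Sum>s\<in>Poly_Mapping.keys b. \<Sum>t\<in>Poly_Mapping.keys c.
        lk b s x * K r (lk a r) t (lk c t) x when r + (s + t) = \<mu>)"
      unfolding *[OF x] sum_distrib_left sum.distrib[symmetric]
      by (intro sum.cong refl) (simp add: when_def)
    finally show "lk (dbracket a (b * c)) \<mu> x = lk (dbracket a b * c + ?\<sigma> * (b * dbracket a c)) \<mu> x"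
      by (simp add: lookup_add lookup_neg_one_power abc bac lookup_sum lookup_single when_apply)
  qed
qed

lemma odd_poisson_djac:
  assumes P: "odd_poisson (dens_eq U) (\<lambda>r. Poly_Mapping.single 0 (const r)) (dens n m U) (dens_hom n m U) dbracket"
    and \<phi>: "\<phi> \<in> SF_hom n m U p" and \<psi>: "\<psi> \<in> SF_hom n m U q" and \<eta>: "\<eta> \<in> SF_hom n m U k"
  shows "djac \<Theta> p r (res \<phi>) q s (res \<psi>) t (res \<eta>) = 0"
proof (rule ext)
  fix x
  let ?S = "Poly_Mapping.single" and ?\<sigma> = "(-1) ^ ((p + 1) * (q + 1))"
  have "dens_eq U (dbracket (?S r \<phi>) (dbracket (?S s \<psi>) (?S t \<eta>)))
      (dbracket (dbracket (?S r \<phi>) (?S s \<psi>)) (?S t \<eta>) + ?\<sigma> * dbracket (?S s \<psi>) (dbracket (?S r \<phi>) (?S t \<eta>)))"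
    using P dens_hom_single[OF \<phi>, of r] dens_hom_single[OF \<psi>, of s] dens_hom_single[OF \<eta>, of t]
    unfolding odd_poisson_def by blast
  note * = dens_eqD[OF this, of x "r + (s + t)", unfolded dbracket_single lookup_add lookup_neg_one_power]
  show "djac \<Theta> p r (res \<phi>) q s (res \<psi>) t (res \<eta>) x = 0 x"
  proof (cases "x \<in> U")
    case True
    then have "K r \<phi> (s + t) (K s \<psi> t \<eta>) x
        = K (r + s) (K r \<phi> s \<psi>) t \<eta> x + ?\<sigma> * K s \<psi> (r + t) (K r \<phi> t \<eta>) x"
      using * by (simp add: add.assoc add.left_commute[of s r])
    then show ?thesis
      unfolding K_jacobi[OF \<phi> \<psi> \<eta> True, symmetric] by simp
  next
    case False
    note m = HR_res[OF \<phi>] HR_res[OF \<psi>] HR_res[OF \<eta>]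
    note d = HR_outside[OF H_dbr[OF m(1) H_dbr[OF m(2,3)]] False]
      HR_outside[OF H_dbr[OF m(2) H_dbr[OF m(1,3)]] False]
      HR_outside[OF H_dbr[OF H_dbr[OF m(1,2)] m(3)] False]
    show ?thesis
      unfolding djac_def by (simp only: minus_apply times_fun_apply d zero_fun_apply) simp
  qed
qed

text \<open>A nonzero coefficient of an odd function sits at a nonempty set of generators, and the
  derivative along any one of them exposes it.\<close>

lemma \<Theta>_eq_0:
  assumes "\<And>i. i < n + m \<Longrightarrow> DR i \<Theta> = 0"
  shows "\<Theta> = 0"
proof (rule HR_eqI[OF H_\<Theta> H_0], rule grassmann_eqI)
  fix x and I :: "nat set" assume x: "x \<in> U"
  show "coeff (\<Theta> x) I = coeff (0 x) I"
  proof (rule ccontr)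
    assume nz: "coeff (\<Theta> x) I \<noteq> coeff (0 x) I"
    have "odd (card I)" "I \<subseteq> {..<m}"
      using nz H_\<Theta> x SF_support[OF HR_SF[OF H_\<Theta>] x] by (auto simp: HR_def SF_hom_def)
    then obtain v where v: "v \<in> I" "v < m" by (metis all_not_in_conv card.empty even_zero lessThan_iff subsetD)
    have "gderiv v (\<Theta> x) = 0"
      using assms[of "n + v"] v x DR_apply[OF x, of "n + v" \<Theta>] by (simp add: pd_def)
    then have "coeff (gderiv v (\<Theta> x)) (I - {v}) = 0" by simp
    then show False using nz v by (simp add: insert_absorb)
  qed
qed

lemma curv_iff: "(\<forall>i<n + m. \<forall>j<n + m. curv i j = 0) \<longleftrightarrow>
    (\<forall>i<n + m. \<forall>j<n + m. \<forall>x\<in>U. pd n i (A j) x = (-1) ^ (par n i * par n j) * pd n j (A i) x)"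
proof -
  have "curv i j = 0 \<longleftrightarrow> (\<forall>x\<in>U. pd n i (A j) x = (-1) ^ (par n i * par n j) * pd n j (A i) x)" for i j
    unfolding curv_def
    by (auto simp: fun_eq_iff DR_def res_def pd_res[unfolded res_def] split: if_splits)
  then show ?thesis by simp
qed

theorem odd_poisson_iff:
  assumes T: "\<And>i k x. i < n + m \<Longrightarrow> k < n + m \<Longrightarrow> x \<in> U \<Longrightarrow> (\<Sum>j<n + m. T i j x * S j k x) = (if i = k then 1 else 0)"
    and J: "\<And>a b d. a < n + m \<Longrightarrow> b < n + m \<Longrightarrow> d < n + m \<Longrightarrow>
      jac (par n a) 0 (res (coord n a)) (par n b) 0 (res (coord n b)) 0 (res (coord n d)) = 0"
  shows "odd_poisson (dens_eq U) (\<lambda>r. Poly_Mapping.single 0 (const r)) (dens n m U) (dens_hom n m U) dbracket \<longleftrightarrow>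
    (\<forall>i<n + m. \<forall>j<n + m. \<forall>x\<in>U. pd n i (A j) x = (-1) ^ (par n i * par n j) * pd n j (A i) x) \<and>
    (\<forall>x\<in>U. \<theta> x = W x)" (is "?P \<longleftrightarrow> ?C \<and> ?D")
proof
  assume P: ?P
  have T': "(\<Sum>j<n + m. res (T i j) * res (S j k)) = (if i = k then res 1 else 0)" if "i < n + m" "k < n + m" for i k
  proof (rule ext)
    fix x show "(\<Sum>j<n + m. res (T i j) * res (S j k)) x = (if i = k then res 1 else 0) x"
      using T[OF that, of x] by (cases "x \<in> U") (simp_all add: res_apply)
  qed
  have one: "1 \<in> SF_hom n m U 0" using SF_hom_const[where m = m and r = 1] by simp
  note X = SF_hom_coord
  \<comment> \<open>With two arguments of weight 0 every product of weights in front of \<Theta> is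
    0, so \<open>djac\<close> and \<open>jac\<close> agree on these triples.\<close>
  have "jac (par n a) 0 (res (coord n a)) (par n b) 0 (res (coord n b)) 1 (res 1) = 0" if "a < n + m" "b < n + m" for a b
    using odd_poisson_djac[OF P X[OF that(1)] X[OF that(2)] one, of 0 0 1] by (simp add: djac_def jac_def)
  from curv_eq_0[OF T' J this] have flat: "curv i j = 0" if "i < n + m" "j < n + m" for i j
    using that by simp
  have "DR i \<Theta> = 0" if "i < n + m" for i
  proof (rule D_Theta_eq_0[OF H_\<Theta> T' _ _ that])
    fix a assume a: "a < n + m"
    show "jac (par n a) 0 (res (coord n a)) 0 1 (res 1) 1 (res 1) = 0"
      by (rule jac_eq_0[OF J flat H_x[OF a] H_u H_u])
    show "djac \<Theta> (par n a) 0 (res (coord n a)) 0 1 (res 1) 1 (res 1) = 0"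
      by (rule odd_poisson_djac[OF P X[OF a] one one])
  qed
  then have "\<Theta> = 0" by (rule \<Theta>_eq_0)
  then have "\<theta> x = W x" if "x \<in> U" for x
    using that by (auto simp: \<Theta>_def res_def fun_eq_iff split: if_splits)
  moreover have ?C using flat curv_iff by blast
  ultimately show "?C \<and> ?D" by blast
next
  assume CD: "?C \<and> ?D"
  then have flat: "curv i j = 0" if "i < n + m" "j < n + m" for i j
    using that curv_iff by blast
  have \<Theta>: "\<Theta> = 0" using CD by (auto simp: \<Theta>_def res_def fun_eq_iff)
  show ?P
  proof (rule dbracket_odd_poisson)
    fix p q k f g h and r s t :: real assume f: "f \<in> HR p" and g: "g \<in> HR q" and h: "h \<in> HR k"
    show "djac \<Theta> p r f q s g t h = 0"
      using jac_eq_0[OF J flat f g h, of r s t] by (simp add: \<Theta> djac_def jac_def dbr_Theta_0)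
  qed
qed

lemma br_add_left:
  assumes "f \<in> HR q" "f' \<in> HR q"
  shows "br p r (f + f') s g = br p r f s g + br p r f' s g"
  unfolding br_def ham_def using assms
  by (simp add: nab_add[OF _ assms] ring_distribs sum.distrib cong: sum.cong_simp)

text \<open>The given bracket is \<open>br + br\<close>, so its Jacobi identity says that four times
  the Jacobiator vanishes; real coefficients allow division by four.\<close>

lemma jac_coordinates:
  assumes P: "odd_poisson (eq_on U) const (SF n m U) (SF_hom n m U)
      (\<lambda>f g. derived_bracket n m S (sgn_pow 1 f) g)"
    and abd: "a < n + m" "b < n + m" "d < n + m"
  shows "jac (par n a) 0 (res (coord n a)) (par n b) 0 (res (coord n b)) 0 (res (coord n d)) = 0"
proof -
  define B where "B f g = derived_bracket n m S (sgn_pow 1 f) g" for f g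
  have B: "res (B f g) = br p 0 (res f) 0 (res g) + br p 0 (res f) 0 (res g)"
    if f: "f \<in> SF_hom n m U p" and g: "g \<in> SF_hom n m U q" for f g p q
  proof (rule ext)
    fix x
    show "res (B f g) x = (br p 0 (res f) 0 (res g) + br p 0 (res f) 0 (res g)) x"
    proof (cases "x \<in> U")
      case True
      have "B f g x = K 0 f 0 g x + K 0 f 0 g x"
        unfolding B_def using derived_bracket_eq[OF SF_S sym_S SF_sgn_pow[OF SF_hom_SF[OF f]] SF_hom_SF[OF g] True]
        by (simp add: K_def dens_coeff_bracket_def)
      then show ?thesis using True K_dbr[OF f g True, of 0 0] by (simp add: res_apply)
    next
      case False
      then show ?thesis using HR_outside[OF H_br[OF HR_res[OF f] HR_res[OF g]] False] by (simp add: res_apply)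
    qed
  qed
  have SF_B: "B f g \<in> SF_hom n m U (p + q + 1)" if "f \<in> SF_hom n m U p" "g \<in> SF_hom n m U q" for f g p q
    using P that unfolding odd_poisson_def B_def by blast
  note X = SF_hom_coord
  let ?x = "coord n"
  let ?\<sigma> = "(-1) ^ ((par n a + 1) * (par n b + 1))"
  have "eq_on U (B (?x a) (B (?x b) (?x d))) (B (B (?x a) (?x b)) (?x d) + ?\<sigma> * B (?x b) (B (?x a) (?x d)))"
    using P X[OF abd(1)] X[OF abd(2)] X[OF abd(3)] unfolding odd_poisson_def B_def by blast
  then have "res (B (?x a) (B (?x b) (?x d))) = res (B (B (?x a) (?x b)) (?x d)) + ?\<sigma> * res (B (?x b) (B (?x a) (?x d)))"
    by (auto simp: eq_on_def res_def fun_eq_iff)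
  moreover define y1 where "y1 = br (par n a) 0 (res (?x a)) 0 (br (par n b) 0 (res (?x b)) 0 (res (?x d)))"
  moreover define y2 where "y2 = br (par n a + par n b + 1) 0 (br (par n a) 0 (res (?x a)) 0 (res (?x b))) 0 (res (?x d))"
  moreover define y3 where "y3 = br (par n b) 0 (res (?x b)) 0 (br (par n a) 0 (res (?x a)) 0 (res (?x d)))"
  moreover note H = H_br[OF HR_res[OF X] HR_res[OF X]]
  have "res (B (?x a) (B (?x b) (?x d))) = y1 + y1 + (y1 + y1)"
    unfolding B[OF X[OF abd(1)] SF_B[OF X[OF abd(2)] X[OF abd(3)]]] B[OF X[OF abd(2)] X[OF abd(3)]] y1_def
      br_add_right[OF H[OF abd(2) abd(3)] H[OF abd(2) abd(3)]] ..
  moreover have "res (B (B (?x a) (?x b)) (?x d)) = y2 + y2 + (y2 + y2)"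
    unfolding B[OF SF_B[OF X[OF abd(1)] X[OF abd(2)]] X[OF abd(3)]] B[OF X[OF abd(1)] X[OF abd(2)]] y2_def
      br_add_left[OF H[OF abd(1) abd(2)] H[OF abd(1) abd(2)]] ..
  moreover have "res (B (?x b) (B (?x a) (?x d))) = y3 + y3 + (y3 + y3)"
    unfolding B[OF X[OF abd(2)] SF_B[OF X[OF abd(1)] X[OF abd(3)]]] B[OF X[OF abd(1)] X[OF abd(3)]] y3_def
      br_add_right[OF H[OF abd(1) abd(3)] H[OF abd(1) abd(3)]] ..
  moreover define w where "w = ?\<sigma> * y3"
  ultimately have eq: "y1 + y1 + (y1 + y1) = (y2 + y2 + (y2 + y2)) + (w + w + (w + w))"
    by (simp only: w_def distrib_left)
  define z where "z = y1 - w - y2"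
  have "z + z + (z + z) = (y1 + y1 + (y1 + y1)) - (w + w + (w + w)) - (y2 + y2 + (y2 + y2))"
    by (simp add: z_def)
  also have "\<dots> = 0" unfolding eq by simp
  finally have z4: "z + z + (z + z) = 0" .
  have "z = 0"
  proof (rule ext, rule grassmann_eqI)
    fix x I
    have "coeff ((z + z + (z + z)) x) I = 0" unfolding z4 by simp
    then show "coeff (z x) I = coeff (0 x) I" by simp
  qed
  then show ?thesis
    unfolding jac_def z_def w_def y1_def y2_def y3_def by simp
qed

end

section \<open>Local normal form and the theorem\<close>

context density_bracket
begin

text \<open>Forwards, a potential of A on a cube around the point is the logarithm of \<rho>.
  Backwards, \<gamma> is -S A as well as -S d log \<rho>; cancelling \<open>S\<close> gives A = d
  log \<rho> near the point, and such a form is closed.\<close>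

lemma closed_iff_local:
  assumes T: "\<And>i k x. i < n + m \<Longrightarrow> k < n + m \<Longrightarrow> x \<in> U \<Longrightarrow> (\<Sum>j<n + m. T i j x * S j k x) = (if i = k then 1 else 0)"
  shows "(\<forall>i<n + m. \<forall>j<n + m. \<forall>x\<in>U. pd n i (A j) x = (-1) ^ (par n i * par n j) * pd n j (A i) x) \<and>
      (\<forall>x\<in>U. \<theta> x = W x) \<longleftrightarrow>
    (\<forall>x\<in>U. \<exists>V \<rho>. openin (Euclidean_space n) V \<and> x \<in> V \<and> V \<subseteq> U \<and> volume_form n m V \<rho> \<and>
      (\<forall>i<n + m. \<forall>y\<in>V. \<gamma> i y = - (\<Sum>j<n + m. S i j y * pd n j (slog m \<rho>) y)) \<and>
      (\<forall>y\<in>V. \<theta> y = (\<Sum>i<n + m. \<Sum>j<n + m. S i j y * (pd n j (slog m \<rho>) y * pd n i (slog m \<rho>) y))))"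
    (is "?C \<and> ?D \<longleftrightarrow> ?L")
proof
  assume CD: "?C \<and> ?D"
  show ?L
  proof
    fix x assume x: "x \<in> U"
    obtain d where d: "d > 0" "cube n x d \<subseteq> U" using cube_in_U[OF x] .
    have A: "A i \<in> SF_hom n m (cube n x d) (par n i)" if "i < n + m" for i
      using SF_A[OF that] d(2) by (rule SF_hom_subset)
    interpret cube: euclidean_domain n "cube n x d" by unfold_locales (rule openin_cube)
    obtain \<sigma> where \<sigma>: "\<sigma> \<in> SF_hom n m (cube n x d) 0"
      "\<And>i y. i < n + m \<Longrightarrow> y \<in> cube n x d \<Longrightarrow> pd n i \<sigma> y = A i y"
      using super_poincare[where n = n and a = x and d = d and m = m and A = A] d A U_support[OF x] CD by blast
    obtain \<rho> where \<rho>: "volume_form n m (cube n x d) \<rho>" "\<And>y. y \<in> cube n x d \<Longrightarrow> slog m \<rho> y = \<sigma> y"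
      by (rule cube.exists_volume_form[OF \<sigma>(1)]) simp
    have pd: "pd n i (slog m \<rho>) y = A i y" if "i < n + m" "y \<in> cube n x d" for i y
      using cube.pd_cong[where f = "slog m \<rho>" and g = \<sigma> and i = i, OF \<rho>(2) that(2)] \<sigma>(2)[OF that] by simp
    have xc: "x \<in> cube n x d" using d(1) U_support[OF x] by (auto simp: cube_def)
    have \<gamma>': "\<gamma> i y = - (\<Sum>j<n + m. S i j y * pd n j (slog m \<rho>) y)" if "i < n + m" "y \<in> cube n x d" for i y
      using \<gamma>_eq[of i y] that d(2) by (simp add: pd subset_iff cong: sum.cong_simp)
    have \<theta>': "\<theta> y = (\<Sum>i<n + m. \<Sum>j<n + m. S i j y * (pd n j (slog m \<rho>) y * pd n i (slog m \<rho>) y))"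
      if "y \<in> cube n x d" for y
      using CD that d(2) by (simp add: pd W_def subset_iff cong: sum.cong_simp)
    show "\<exists>V \<rho>. openin (Euclidean_space n) V \<and> x \<in> V \<and> V \<subseteq> U \<and> volume_form n m V \<rho> \<and>
      (\<forall>i<n + m. \<forall>y\<in>V. \<gamma> i y = - (\<Sum>j<n + m. S i j y * pd n j (slog m \<rho>) y)) \<and>
      (\<forall>y\<in>V. \<theta> y = (\<Sum>i<n + m. \<Sum>j<n + m. S i j y * (pd n j (slog m \<rho>) y * pd n i (slog m \<rho>) y)))"
    proof (rule exI[of _ "cube n x d"], rule exI[of _ \<rho>], intro conjI)
      show "\<forall>i<n + m. \<forall>y\<in>cube n x d. \<gamma> i y = - (\<Sum>j<n + m. S i j y * pd n j (slog m \<rho>) y)"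
        using \<gamma>' by (simp only: Ball_def) iprover
      show "\<forall>y\<in>cube n x d. \<theta> y = (\<Sum>i<n + m. \<Sum>j<n + m. S i j y * (pd n j (slog m \<rho>) y * pd n i (slog m \<rho>) y))"
        by (rule ballI) (rule \<theta>')
    qed (fact openin_cube xc d(2) \<rho>(1))+
  qed
next
  assume L: ?L
  have "(\<forall>i<n + m. \<forall>j<n + m. pd n i (A j) x = (-1) ^ (par n i * par n j) * pd n j (A i) x) \<and> \<theta> x = W x"
    if x: "x \<in> U" for x
  proof -
    obtain V \<rho> where V: "openin (Euclidean_space n) V" "x \<in> V" "V \<subseteq> U" "volume_form n m V \<rho>"
      and \<gamma>0: "\<forall>i<n + m. \<forall>y\<in>V. \<gamma> i y = - (\<Sum>j<n + m. S i j y * pd n j (slog m \<rho>) y)"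
      and \<theta>0: "\<forall>y\<in>V. \<theta> y = (\<Sum>i<n + m. \<Sum>j<n + m. S i j y * (pd n j (slog m \<rho>) y * pd n i (slog m \<rho>) y))"
      using bspec[OF L x] by (elim exE conjE) (rule that)
    note \<gamma> = \<gamma>0[rule_format] and \<theta> = \<theta>0[rule_format]
    interpret V: euclidean_domain n V by unfold_locales (rule V(1))
    let ?\<sigma> = "slog m \<rho>"
    have \<sigma>: "?\<sigma> \<in> SF n m V" by (rule SF_hom_SF[OF V.SF_hom_slog[OF V(4)]])
    have A: "A k y = pd n k ?\<sigma> y" if k: "k < n + m" and y: "y \<in> V" for k y
    proof -
      have yU: "y \<in> U" using y V(3) by blast
      have expand: "(\<Sum>i<n + m. T k i y * (\<Sum>j<n + m. S i j y * z j)) = z k" for z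
      proof -
        have "(\<Sum>i<n + m. T k i y * (\<Sum>j<n + m. S i j y * z j)) = (\<Sum>j<n + m. (\<Sum>i<n + m. T k i y * S i j y) * z j)"
          by (simp add: sum_distrib_left sum_distrib_right mult.assoc, rule sum.swap)
        also have "\<dots> = (\<Sum>j<n + m. if j = k then z j else 0)"
          using T[OF k _ yU] by (intro sum.cong) auto
        finally show ?thesis using k by simp
      qed
      have "(\<Sum>j<n + m. S i j y * A j y) = (\<Sum>j<n + m. S i j y * pd n j ?\<sigma> y)" if "i < n + m" for i
        using \<gamma>[OF that y] \<gamma>_eq[OF that yU] by simp
      then have "(\<Sum>i<n + m. T k i y * (\<Sum>j<n + m. S i j y * A j y))
          = (\<Sum>i<n + m. T k i y * (\<Sum>j<n + m. S i j y * pd n j ?\<sigma> y))" by simp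
      then show ?thesis unfolding expand .
    qed
    have "pd n i (A j) x = (-1) ^ (par n i * par n j) * pd n j (A i) x" if "i < n + m" "j < n + m" for i j
      using V.pd_cong[where f = "A j" and i = i, OF A[OF that(2)] V(2)]
        V.pd_cong[where f = "A i" and i = j, OF A[OF that(1)] V(2)] V.pd_commute[OF \<sigma> V(2), of i j] by simp
    moreover have "\<theta> x = W x"
      using \<theta>[OF V(2)] A V(2) by (simp add: W_def cong: sum.cong_simp)
    ultimately show ?thesis by blast
  qed
  note pointwise = this
  show "?C \<and> ?D"
  proof (intro conjI allI impI ballI)
    fix i j x assume "i < n + m" "j < n + m" "x \<in> U"
    then show "pd n i (A j) x = (-1) ^ (par n i * par n j) * pd n j (A i) x"
      using conjunct1[OF pointwise] by blast
  next
    fix x assume "x \<in> U"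
    then show "\<theta> x = W x" by (rule conjunct2[OF pointwise])
  qed
qed

end

text \<open>Q stands for the contraction of \<open>S\<close> with \<open>proj_B\<close>, d for the
  divergence of S d log \<rho> and w for the square of d log \<rho>. The left side is the second
  displayed equation for n = m, the right side the value of \<theta>.\<close>

lemma half_eq_iff:
  fixes d Q w :: grassmann
  shows "Q = - d - gconst 2 * w \<longleftrightarrow> gconst (1 / 2) * (- d - Q) = w"
proof
  assume "Q = - d - gconst 2 * w"
  then show "gconst (1 / 2) * (- d - Q) = w" by (simp add: mult.assoc[symmetric] gconst_mult[symmetric])
next
  assume "gconst (1 / 2) * (- d - Q) = w"
  then have "gconst 2 * w = gconst 2 * (gconst (1 / 2) * (- d - Q))" by simp
  also have "\<dots> = - d - Q" unfolding mult.assoc[symmetric] gconst_mult[symmetric] by simp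
  finally show "Q = - d - gconst 2 * w" by simp
qed

lemma third_eq_iff:
  fixes a b s :: grassmann
  shows "b = - (a + gconst 3 * s) \<longleftrightarrow> gconst (1 / 3) * (a + b) = - s"
proof
  assume "b = - (a + gconst 3 * s)"
  then show "gconst (1 / 3) * (a + b) = - s" by (simp add: mult.assoc[symmetric] gconst_mult[symmetric])
next
  assume "gconst (1 / 3) * (a + b) = - s"
  then have "gconst 3 * - s = gconst 3 * (gconst (1 / 3) * (a + b))" by simp
  also have "\<dots> = a + b" unfolding mult.assoc[symmetric] gconst_mult[symmetric] by simp
  finally show "b = - (a + gconst 3 * s)" by (simp add: algebra_simps)
qed

text \<open>For n = m the first equation is the formula for \<gamma> solved for the contraction of
  \<open>S\<close> with the projective class. The second is the formula for \<theta> solved for the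
  contraction with \<open>proj_B\<close>, after \<gamma> has been eliminated.\<close>

lemma (in euclidean_domain) local_equations_iff:
  assumes nm: "n = m" and \<sigma>: "\<sigma> \<in> SF_hom n m U 0"
    and S: "\<And>i j. i < n + m \<Longrightarrow> j < n + m \<Longrightarrow> S i j \<in> SF n m U"
  shows "(\<forall>i<n + m. eq_on U (\<Sum>j<n + m. \<Sum>k<n + m. S j k * P i k j)
        (- ((\<Sum>j<n + m. pd n j (S j i)) + const ((real n - real m + 3) / (real n - real m + 1)) *
              (\<Sum>j<n + m. S i j * pd n j \<sigma>)))) \<and>
      eq_on U (\<Sum>i<n + m. \<Sum>j<n + m. S i j * proj_B n m P j i)
        (- (\<Sum>j<n + m. pd n j (\<Sum>i<n + m. S j i * pd n i \<sigma>)) -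
          const ((real n - real m + 2) / (real n - real m + 1)) *
            (\<Sum>i<n + m. \<Sum>j<n + m. (-1) ^ (par n i * par n j) * (S i j * pd n i \<sigma> * pd n j \<sigma>))) \<longleftrightarrow>
    (\<forall>i<n + m. \<forall>y\<in>U. dens_gamma n m S P i y = - (\<Sum>j<n + m. S i j y * pd n j \<sigma> y)) \<and>
    (\<forall>y\<in>U. dens_theta n m S P y = (\<Sum>i<n + m. \<Sum>j<n + m. S i j y * (pd n j \<sigma> y * pd n i \<sigma> y)))"
    (is "?E1 \<and> ?E2 \<longleftrightarrow> ?G \<and> ?T")
proof -
  have \<sigma>SF: "\<sigma> \<in> SF n m U" using \<sigma> by (rule SF_hom_SF)
  have coeffs: "(real n - real m + 3) / (real n - real m + 1) = 3" "(real n - real m + 2) / (real n - real m + 1) = 2"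
    "(real n - real m + 1) / (real n - real m + 3) = 1 / 3" "(real n - real m + 1) / (real n - real m + 2) = 1 / 2"
    using nm by auto
  have gamma: "dens_gamma n m S P i y = gconst (1 / 3) * ((\<Sum>j<n + m. pd n j (S j i) y) + (\<Sum>j<n + m. \<Sum>k<n + m. S j k y * P i k j y))" for i y
    unfolding dens_gamma_def coeffs by (simp add: const_def)
  have E1: "?E1 \<longleftrightarrow> ?G"
    unfolding coeffs gamma third_eq_iff[symmetric] by (simp add: eq_on_def const_def)
  have E2: "?E2 \<longleftrightarrow> ?T" if G: ?G
  proof -
    have "?E2 \<longleftrightarrow> (\<forall>y\<in>U. (\<Sum>i<n + m. \<Sum>j<n + m. S i j y * proj_B n m P j i y)
        = - (\<Sum>j<n + m. pd n j (\<Sum>i<n + m. S j i * pd n i \<sigma>) y)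
          - gconst 2 * (\<Sum>i<n + m. \<Sum>j<n + m. (-1) ^ (par n i * par n j) * (S i j y * pd n i \<sigma> y * pd n j \<sigma> y)))"
      unfolding coeffs by (simp add: eq_on_def const_def)
    also have "\<dots> \<longleftrightarrow> ?T"
    proof (rule ball_cong[OF refl])
      fix y assume y: "y \<in> U"
      \<comment> \<open>\<theta> contains the divergence of \<gamma>, so the first equation is what
        turns the definition of \<theta> into the second.\<close>
      have pd\<gamma>: "pd n k (dens_gamma n m S P k) y = - pd n k (\<Sum>i<n + m. S k i * pd n i \<sigma>) y" if k: "k < n + m" for k
      proof -
        let ?f = "\<Sum>i<n + m. S k i * pd n i \<sigma>"
        have f: "?f \<in> SF n m U" using k by (intro SF_sum SF_times S SF_pd \<sigma>SF) auto
        have "pd n k (dens_gamma n m S P k) y = pd n k (const (-1) * ?f) y"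
          using G k by (intro pd_cong[OF _ y]) (simp add: const_def gconst_uminus)
        then show ?thesis using pd_const_times[OF f y] by (simp add: gconst_uminus)
      qed
      have "dens_theta n m S P y = gconst (1 / 2) * (- (\<Sum>k<n + m. pd n k (\<Sum>i<n + m. S k i * pd n i \<sigma>) y)
          - (\<Sum>k<n + m. \<Sum>j<n + m. S k j y * proj_B n m P j k y))"
        unfolding dens_theta_def coeffs by (simp add: const_def pd\<gamma> sum_negf cong: sum.cong_simp)
      \<comment> \<open>The explicit sign is the one from exchanging the two derivatives of
        \<sigma>.\<close>
      moreover have "(\<Sum>i<n + m. \<Sum>j<n + m. (-1) ^ (par n i * par n j) * (S i j y * pd n i \<sigma> y * pd n j \<sigma> y))
          = (\<Sum>i<n + m. \<Sum>j<n + m. S i j y * (pd n j \<sigma> y * pd n i \<sigma> y))"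
      proof (intro sum.cong refl)
        fix i j
        have "pd n k \<sigma> y \<in> ghom (par n k)" for k
          using SF_hom_pd[OF \<sigma>, of k] y by (simp add: SF_hom_iff)
        then have "pd n i \<sigma> y * pd n j \<sigma> y = (-1) ^ (par n i * par n j) * (pd n j \<sigma> y * pd n i \<sigma> y)"
          by (intro ghom_commute)
        then show "(-1) ^ (par n i * par n j) * (S i j y * pd n i \<sigma> y * pd n j \<sigma> y) = S i j y * (pd n j \<sigma> y * pd n i \<sigma> y)"
          by (cases "even (par n i * par n j)") (simp_all add: mult.assoc)
      qed
      ultimately show "((\<Sum>i<n + m. \<Sum>j<n + m. S i j y * proj_B n m P j i y)
        = - (\<Sum>j<n + m. pd n j (\<Sum>i<n + m. S j i * pd n i \<sigma>) y)
          - gconst 2 * (\<Sum>i<n + m. \<Sum>j<n + m. (-1) ^ (par n i * par n j) * (S i j y * pd n i \<sigma> y * pd n j \<sigma> y)))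
        \<longleftrightarrow> dens_theta n m S P y = (\<Sum>i<n + m. \<Sum>j<n + m. S i j y * (pd n j \<sigma> y * pd n i \<sigma> y))"
        by (simp only: half_eq_iff)
    qed
    finally show ?thesis .
  qed
  show ?thesis using E1 E2 by blast
qed

text \<open>On bodies, \<open>S\<close> being odd leaves only the blocks between even and odd
  indices. The trace of s t over the even indices is n, that of t s over the odd indices is m, and
  both are the same double sum.\<close>

lemma nondegenerate_dimension:
  assumes S: "\<And>i j. i < n + m \<Longrightarrow> j < n + m \<Longrightarrow> S i j \<in> SF_hom n m U (par n i + par n j + 1)"
    and nd: "nondegenerate n m U S" and x: "x \<in> U"
  shows "n = m"
proof -
  obtain T where inv: "\<forall>i<n + m. \<forall>k<n + m.
             eq_on U (\<Sum>j<n + m. S i j * T j k) (const (if i = k then 1 else 0)) \<and>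
             eq_on U (\<Sum>j<n + m. T i j * S j k) (const (if i = k then 1 else 0))"
    using nd unfolding nondegenerate_def by (elim exE conjE) (rule that)
  have T: "(\<Sum>j<n + m. S i j x * T j k x) = gconst (if i = k then 1 else 0) \<and>
      (\<Sum>j<n + m. T i j x * S j k x) = gconst (if i = k then 1 else 0)"
    if "i < n + m" "k < n + m" for i k
    using inv[rule_format, OF that] x by (simp add: eq_on_def const_apply)
  define s where "s i j = coeff (S i j x) {}" for i j
  define t where "t i j = coeff (T i j x) {}" for i j
  have ST: "(\<Sum>j<n + m. s i j * t j k) = (if i = k then 1 else 0)"
    and TS: "(\<Sum>j<n + m. t i j * s j k) = (if i = k then 1 else 0)" if "i < n + m" "k < n + m" for i k
    using arg_cong[OF conjunct1[OF T[OF that]], of "\<lambda>z. coeff z {}"] arg_cong[OF conjunct2[OF T[OF that]], of "\<lambda>z. coeff z {}"]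
    by (simp_all add: s_def t_def coeff_times)
  have s0: "s i j = 0" if "i < n + m" "j < n + m" "par n i = par n j" for i j
  proof (rule ccontr)
    assume "s i j \<noteq> 0"
    then have "even (card ({} :: nat set) + (par n i + par n j + 1))"
      using S[OF that(1,2)] x unfolding SF_hom_def s_def by blast
    then show False using that(3) by simp
  qed
  have un: "{..<n + m} = {..<n} \<union> {n..<n + m}" "{..<n} \<inter> {n..<n + m} = {}" by auto
  have split: "(\<Sum>j<n + m. f j) = (\<Sum>j<n. f j) + (\<Sum>j\<in>{n..<n + m}. f j)" for f :: "nat \<Rightarrow> real"
    unfolding un(1) by (rule sum.union_disjoint) auto
  have "real n = (\<Sum>i<n. \<Sum>j<n + m. s i j * t j i)"
    using ST by simp
  also have "\<dots> = (\<Sum>i<n. \<Sum>j\<in>{n..<n + m}. s i j * t j i)"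
    unfolding split by (intro sum.cong refl) (simp add: s0 par_def)
  also have "\<dots> = (\<Sum>j\<in>{n..<n + m}. \<Sum>i<n. t j i * s i j)"
    by (subst sum.swap) (simp add: mult.commute)
  also have "\<dots> = (\<Sum>j\<in>{n..<n + m}. \<Sum>i<n + m. t j i * s i j)"
    unfolding split by (intro sum.cong refl) (simp add: s0 par_def)
  also have "\<dots> = real m"
    using TS by simp
  finally show ?thesis by simp
qed

section \<open>Parities of the bracket components and of the connection form\<close>

context euclidean_domain
begin

context
  fixes m :: nat and S :: "nat \<Rightarrow> nat \<Rightarrow> superfun" and P :: "nat \<Rightarrow> nat \<Rightarrow> nat \<Rightarrow> superfun"
  assumes S: "\<And>i j. i < n + m \<Longrightarrow> j < n + m \<Longrightarrow> S i j \<in> SF_hom n m U (par n i + par n j + 1)"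
    and P: "\<And>k i j. k < n + m \<Longrightarrow> i < n + m \<Longrightarrow> j < n + m \<Longrightarrow> P k i j \<in> SF_hom n m U (par n i + par n j + par n k)"
begin

lemma SF_hom_conv: "f \<in> SF_hom n m U p \<Longrightarrow> even (p + q) \<Longrightarrow> f \<in> SF_hom n m U q"
  using SF_hom_cong by blast

lemma SF_dens_gamma:
  assumes i: "i < n + m"
  shows "dens_gamma n m S P i \<in> SF_hom n m U (par n i + 1)"
  unfolding dens_gamma_def
proof (intro SF_hom_const_times SF_hom_add SF_hom_sum)
  fix j assume "j \<in> {..<n + m}"
  then have j: "j < n + m" by simp
  show "pd n j (S j i) \<in> SF_hom n m U (par n i + 1)"
    by (rule SF_hom_conv[OF SF_hom_pd[OF S[OF j i]]]) auto
  fix k assume "k \<in> {..<n + m}"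
  then have k: "k < n + m" by simp
  show "S j k * P i k j \<in> SF_hom n m U (par n i + 1)"
    by (rule SF_hom_conv[OF SF_hom_times[OF S[OF j k] P[OF i k j]]]) auto
qed

lemma SF_proj_B:
  assumes k: "k < n + m" and j: "j < n + m"
  shows "proj_B n m P k j \<in> SF_hom n m U (par n k + par n j)"
  unfolding proj_B_def
proof (intro SF_hom_const_times SF_hom_add SF_hom_sum SF_hom_neg_one_power)
  fix q assume "q \<in> {..<n + m}"
  then have q: "q < n + m" by simp
  show "pd n q (P q k j) \<in> SF_hom n m U (par n k + par n j)"
    by (rule SF_hom_conv[OF SF_hom_pd[OF P[OF q k j]]]) auto
  fix p assume "p \<in> {..<n + m}"
  then have p: "p < n + m" by simp
  show "P p q k * P q p j \<in> SF_hom n m U (par n k + par n j)"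
    by (rule SF_hom_conv[OF SF_hom_times[OF P[OF p q k] P[OF q p j]]]) auto
qed

lemma SF_dens_theta: "dens_theta n m S P \<in> SF_hom n m U 1"
  unfolding dens_theta_def
proof (intro SF_hom_const_times SF_hom_diff SF_hom_sum)
  fix k assume "k \<in> {..<n + m}"
  then have k: "k < n + m" by simp
  show "pd n k (dens_gamma n m S P k) \<in> SF_hom n m U 1"
    by (rule SF_hom_conv[OF SF_hom_pd[OF SF_dens_gamma[OF k]]]) auto
  fix j assume "j \<in> {..<n + m}"
  then have j: "j < n + m" by simp
  show "S k j * proj_B n m P j k \<in> SF_hom n m U 1"
    by (rule SF_hom_conv[OF SF_hom_times[OF S[OF k j] SF_proj_B[OF j k]]]) auto
qed

end

text \<open>The trace terms sit at i = k or j = k, where the two equal parities cancel modulo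
  2.\<close>

lemma SF_trace_free_part:
  assumes \<Gamma>: "\<And>i j k. i < n + m \<Longrightarrow> j < n + m \<Longrightarrow> k < n + m \<Longrightarrow> \<Gamma> k i j \<in> SF_hom n m U (par n i + par n j + par n k)"
    and k: "k < n + m" and j: "j < n + m" and i: "i < n + m"
  shows "trace_free_part n m \<Gamma> k j i \<in> SF_hom n m U (par n j + par n i + par n k)"
  unfolding trace_free_part_def
proof (intro SF_hom_diff SF_hom_const_times SF_hom_add)
  show "\<Gamma> k j i \<in> SF_hom n m U (par n j + par n i + par n k)" by (rule \<Gamma>[OF j i k])
  have tr: "(\<Sum>s<n + m. (-1) ^ q s * \<Gamma> s l s) \<in> SF_hom n m U (par n l)" if l: "l < n + m" for q l
  proof (intro SF_hom_sum SF_hom_neg_one_power)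
    fix s assume "s \<in> {..<n + m}"
    then have s: "s < n + m" by simp
    show "\<Gamma> s l s \<in> SF_hom n m U (par n l)"
      using \<Gamma>[OF l s s] SF_hom_cong[of "par n l + par n s + par n s" "par n l"] by auto
  qed
  show "(\<Sum>s<n + m. (-1) ^ par n s * \<Gamma> s j s) * const (if i = k then 1 else 0) \<in> SF_hom n m U (par n j + par n i + par n k)"
  proof (cases "i = k")
    case True
    then have "SF_hom n m U (par n j + par n i + par n k) = SF_hom n m U (par n j)" by (intro SF_hom_cong) auto
    then show ?thesis using tr[OF j, of "par n"] True by simp
  qed (simp add: SF_hom_0)
  show "(\<Sum>s<n + m. (-1) ^ (par n i * par n j + par n s) * \<Gamma> s i s) * const (if j = k then 1 else 0)
      \<in> SF_hom n m U (par n j + par n i + par n k)"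
  proof (cases "j = k")
    case True
    then have "SF_hom n m U (par n j + par n i + par n k) = SF_hom n m U (par n i)" by (intro SF_hom_cong) auto
    then show ?thesis using tr[OF i, of "\<lambda>s. par n i * par n j + par n s"] True by simp
  qed (simp add: SF_hom_0)
qed

text \<open>The inverse of a homogeneous matrix is homogeneous, because the grading involution maps it to an
  inverse up to signs.\<close>

lemma SF_hom_inverse_image:
  assumes S: "\<And>i j. i < n + m \<Longrightarrow> j < n + m \<Longrightarrow> S i j \<in> SF_hom n m U (par n i + par n j + 1)"
    and T: "\<And>i j. i < n + m \<Longrightarrow> j < n + m \<Longrightarrow> T i j \<in> SF n m U"
    and TS: "\<And>i k x. i < n + m \<Longrightarrow> k < n + m \<Longrightarrow> x \<in> U \<Longrightarrow> (\<Sum>j<n + m. T i j x * S j k x) = (if i = k then 1 else 0)"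
    and ST: "\<And>i k x. i < n + m \<Longrightarrow> k < n + m \<Longrightarrow> x \<in> U \<Longrightarrow> (\<Sum>j<n + m. S i j x * T j k x) = (if i = k then 1 else 0)"
    and \<gamma>: "\<And>i. i < n + m \<Longrightarrow> \<gamma> i \<in> SF_hom n m U (par n i + 1)"
  defines "A \<equiv> \<lambda>i. - (\<Sum>j<n + m. T i j * \<gamma> j)"
  shows "\<And>i. i < n + m \<Longrightarrow> A i \<in> SF_hom n m U (par n i)"
    and "\<And>i x. i < n + m \<Longrightarrow> x \<in> U \<Longrightarrow> \<gamma> i x = - (\<Sum>j<n + m. S i j x * A j x)"
proof -
  have ASF: "A i \<in> SF n m U" if "i < n + m" for i
    unfolding A_def using that by (intro SF_uminus SF_sum SF_times T SF_hom_SF[OF \<gamma>]) auto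
  show eq: "\<gamma> i x = - (\<Sum>j<n + m. S i j x * A j x)" if i: "i < n + m" and x: "x \<in> U" for i x
  proof -
    have "(\<Sum>j<n + m. S i j x * (\<Sum>k<n + m. T j k x * \<gamma> k x)) = (\<Sum>k<n + m. (\<Sum>j<n + m. S i j x * T j k x) * \<gamma> k x)"
      by (simp add: sum_distrib_left sum_distrib_right mult.assoc, rule sum.swap)
    also have "\<dots> = (\<Sum>k<n + m. if k = i then \<gamma> k x else 0)"
      using ST[OF i _ x] by (intro sum.cong) auto
    finally show ?thesis using i by (simp add: A_def sum_negf)
  qed
  show "A k \<in> SF_hom n m U (par n k)" if k: "k < n + m" for k
    unfolding SF_hom_iff
  proof (intro conjI ballI ASF k)
    fix x assume x: "x \<in> U"
    have "(\<Sum>j<n + m. S i j x * ((-1) ^ par n j * ginv (A j x))) = (\<Sum>j<n + m. S i j x * A j x)" if i: "i < n + m" for i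
    proof -
      have "S i j x * ((-1) ^ par n j * ginv (A j x)) = (-1) ^ (par n i + 1) * ginv (S i j x * A j x)" if j: "j < n + m" for j
      proof -
        have "ginv (S i j x) = sg (par n i + par n j + 1) (S i j x)"
          using S[OF i j] x ghom_ginv[of "S i j x" "par n i + par n j + 1"] by (simp add: SF_hom_iff sg_def)
        then have "(-1) ^ (par n i + 1) * ginv (S i j x * A j x) = sg (par n i + 1 + (par n i + par n j + 1)) (S i j x * ginv (A j x))"
          unfolding ginv_times by (simp only: neg1_simps add_ac)
        also have "\<dots> = sg (par n j) (S i j x * ginv (A j x))" by (rule sg_cong) auto
        finally show ?thesis by (simp only: neg1_simps)
      qed
      then have "(\<Sum>j<n + m. S i j x * ((-1) ^ par n j * ginv (A j x))) = (-1) ^ (par n i + 1) * ginv (\<Sum>j<n + m. S i j x * A j x)"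
        by (simp add: ginv_sum sum_distrib_left sum_negf cong: sum.cong_simp)
      also have "(\<Sum>j<n + m. S i j x * A j x) = - \<gamma> i x" using eq[OF i x] by simp
      also have "ginv (- \<gamma> i x) = (-1) ^ (par n i + 1) * - \<gamma> i x"
        using ghom_ginv[of "- \<gamma> i x" "par n i + 1"] \<gamma>[OF i] x ghom_uminus by (auto simp: SF_hom_iff)
      finally show ?thesis using eq[OF i x] by (simp add: neg1_collect)
    qed
    then have "(\<Sum>i<n + m. T k i x * (\<Sum>j<n + m. S i j x * ((-1) ^ par n j * ginv (A j x))))
        = (\<Sum>i<n + m. T k i x * (\<Sum>j<n + m. S i j x * A j x))" by simp
    moreover have "(\<Sum>i<n + m. T k i x * (\<Sum>j<n + m. S i j x * z j)) = z k" for z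
    proof -
      have "(\<Sum>i<n + m. T k i x * (\<Sum>j<n + m. S i j x * z j)) = (\<Sum>j<n + m. (\<Sum>i<n + m. T k i x * S i j x) * z j)"
        by (simp add: sum_distrib_left sum_distrib_right mult.assoc, rule sum.swap)
      also have "\<dots> = (\<Sum>j<n + m. if j = k then z j else 0)"
        using TS[OF k _ x] by (intro sum.cong) auto
      finally show ?thesis using k by simp
    qed
    ultimately have "(-1) ^ par n k * ginv (A k x) = A k x" by simp
    from arg_cong[OF this, of uminus] have "ginv (A k x) = (-1) ^ par n k * A k x"
      by (cases "even (par n k)") simp_all
    then show "A k x \<in> ghom (par n k)" by (rule ginv_ghom)
  qed
qed

end

text \<open>A chart is a homeomorphism onto an open set, so open neighbourhoods in the chart domain
  and in its image correspond; Q refers to the image alone.\<close>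

lemma chart_open_correspondence:
  assumes X: "openin X D" and hom: "homeomorphic_map (subtopology X D) (subtopology Y (f ` D)) f"
    and Y: "openin Y (f ` D)" and w: "w \<in> D"
  shows "(\<exists>V. openin X V \<and> w \<in> V \<and> V \<subseteq> D \<and> Q (f ` V)) \<longleftrightarrow>
    (\<exists>V. openin Y V \<and> f w \<in> V \<and> V \<subseteq> f ` D \<and> Q V)"
proof
  assume "\<exists>V. openin X V \<and> w \<in> V \<and> V \<subseteq> D \<and> Q (f ` V)"
  then obtain V where V: "openin X V" "w \<in> V" "V \<subseteq> D" "Q (f ` V)" by blast
  then have "openin (subtopology X D) V" using openin_open_subtopology[OF X] by blast
  then have "openin (subtopology Y (f ` D)) (f ` V)"
    using homeomorphic_imp_open_map[OF hom] by (auto simp: open_map_def)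
  then have "openin Y (f ` V)" using openin_open_subtopology[OF Y] by blast
  then show "\<exists>V. openin Y V \<and> f w \<in> V \<and> V \<subseteq> f ` D \<and> Q V" using V by blast
next
  assume "\<exists>V. openin Y V \<and> f w \<in> V \<and> V \<subseteq> f ` D \<and> Q V"
  then obtain V where V: "openin Y V" "f w \<in> V" "V \<subseteq> f ` D" "Q V" by blast
  let ?V = "{v \<in> D. f v \<in> V}"
  have "openin (subtopology Y (f ` D)) V" using openin_open_subtopology[OF Y] V by blast
  from openin_continuous_map_preimage[OF homeomorphic_imp_continuous_map[OF hom] this]
  have "openin (subtopology X D) ?V"
    using openin_subset[OF X] by (simp add: Int_absorb1)
  then have "openin X ?V" using openin_open_subtopology[OF X] by blast
  moreover have "f ` ?V = V" using V(3) by blast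
  ultimately show "\<exists>V. openin X V \<and> w \<in> V \<and> V \<subseteq> D \<and> Q (f ` V)"
    using V w by (intro exI[of _ ?V]) auto
qed

section \<open>The criterion over a single chart\<close>

lemma smooth_fun_empty: "smooth_fun n {} g"
  by (simp add: smooth_fun_def)

lemma ex_conj_regroup:
  assumes "\<And>V \<rho>. R V \<Longrightarrow> V \<subseteq> U \<Longrightarrow> Q V \<rho> \<longleftrightarrow> Q' V \<rho>"
  shows "(\<exists>V \<rho>. R V \<and> x \<in> V \<and> V \<subseteq> U \<and> Q V \<rho>) \<longleftrightarrow> (\<exists>V. R V \<and> x \<in> V \<and> V \<subseteq> U \<and> (\<exists>\<rho>. Q' V \<rho>))"
  using assms by blast

lemma chart_criterion:
  assumes U: "openin (Euclidean_space n) U"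
    and S: "\<And>i j. i < n + m \<Longrightarrow> j < n + m \<Longrightarrow> S i j \<in> SF_hom n m U (par n i + par n j + 1)"
    and S_sym: "\<And>i j x. i < n + m \<Longrightarrow> j < n + m \<Longrightarrow> x \<in> U \<Longrightarrow> S i j x = (-1) ^ (par n i * par n j) * S j i x"
    and P: "\<And>k i j. k < n + m \<Longrightarrow> i < n + m \<Longrightarrow> j < n + m \<Longrightarrow> P k i j \<in> SF_hom n m U (par n i + par n j + par n k)"
    and Poisson: "odd_poisson (eq_on U) const (SF n m U) (SF_hom n m U) (\<lambda>f g. derived_bracket n m S (sgn_pow 1 f) g)"
    and nd: "nondegenerate n m U S"
  shows "odd_poisson (dens_eq U) (\<lambda>r. Poly_Mapping.single 0 (const r)) (dens n m U) (dens_hom n m U)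
      (\<lambda>a b. canonical_bracket n m S P (dens_sgn a) b) \<longleftrightarrow>
    (\<forall>x\<in>U. \<exists>V. openin (Euclidean_space n) V \<and> x \<in> V \<and> V \<subseteq> U \<and> (\<exists>\<rho>. volume_form n m V \<rho> \<and>
      (\<forall>i<n + m. eq_on V (\<Sum>j<n + m. \<Sum>k<n + m. S j k * P i k j)
        (- ((\<Sum>j<n + m. pd n j (S j i)) + const ((real n - real m + 3) / (real n - real m + 1)) *
              (\<Sum>j<n + m. S i j * pd n j (slog m \<rho>))))) \<and>
      eq_on V (\<Sum>i<n + m. \<Sum>j<n + m. S i j * proj_B n m P j i)
        (- (\<Sum>j<n + m. pd n j (\<Sum>i<n + m. S j i * pd n i (slog m \<rho>))) -
          const ((real n - real m + 2) / (real n - real m + 1)) *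
            (\<Sum>i<n + m. \<Sum>j<n + m. (-1) ^ (par n i * par n j) *
              (S i j * pd n i (slog m \<rho>) * pd n j (slog m \<rho>))))))" (is "?L \<longleftrightarrow> ?R")
proof (cases "U = {}")
  case True
  \<comment> \<open>The equality n = m needs a point of the chart. Over an empty chart every
    equation holds vacuously, and so do both sides.\<close>
  have "SF_hom n m U p = UNIV" "SF n m U = UNIV" for p
    by (auto simp: True SF_hom_def SF_def smooth_fun_empty)
  then have "dens n m U = UNIV" "dens_hom n m U p = UNIV" "dens_eq U a b" for p a b
    by (auto simp: dens_def dens_hom_def dens_eq_def eq_on_def True)
  then show ?thesis using True by (simp add: odd_poisson_def)
next
  case False
  then have nm: "n = m" using nondegenerate_dimension[OF S nd] by blast
  interpret U: euclidean_domain n U by unfold_locales (rule U)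
  obtain T where T0: "\<forall>i<n + m. \<forall>j<n + m. T i j \<in> SF n m U"
    and inv: "\<forall>i<n + m. \<forall>k<n + m.
             eq_on U (\<Sum>j<n + m. S i j * T j k) (const (if i = k then 1 else 0)) \<and>
             eq_on U (\<Sum>j<n + m. T i j * S j k) (const (if i = k then 1 else 0))"
    using nd unfolding nondegenerate_def by (elim exE conjE) (rule that)
  have T: "T i j \<in> SF n m U" if "i < n + m" "j < n + m" for i j
    using T0 that by simp
  have ST: "(\<Sum>j<n + m. S i j x * T j k x) = (if i = k then 1 else 0)"
    and TS: "(\<Sum>j<n + m. T i j x * S j k x) = (if i = k then 1 else 0)"
    if "i < n + m" "k < n + m" "x \<in> U" for i k x
    using inv[rule_format, OF that(1,2)] that(3) by (auto simp: eq_on_def const_apply)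
  let ?\<gamma> = "dens_gamma n m S P" and ?\<theta> = "dens_theta n m S P"
  \<comment> \<open>Solves \<gamma> = -S A by means of the inverse matrix \<open>T\<close>.\<close>
  define A where "A i = - (\<Sum>j<n + m. T i j * ?\<gamma> j)" for i
  have \<gamma>: "?\<gamma> i \<in> SF_hom n m U (par n i + 1)" if "i < n + m" for i
    by (rule U.SF_dens_gamma[OF S P that])
  interpret density_bracket n U m S ?\<gamma> ?\<theta> A
  proof
    show "?\<theta> \<in> SF_hom n m U 1" by (rule U.SF_dens_theta[OF S P])
    show "A i \<in> SF_hom n m U (par n i)" if "i < n + m" for i
      unfolding A_def by (rule U.SF_hom_inverse_image(1)[OF S T TS ST \<gamma> that])
    show "?\<gamma> i x = - (\<Sum>j<n + m. S i j x * A j x)" if "i < n + m" "x \<in> U" for i x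
      unfolding A_def by (rule U.SF_hom_inverse_image(2)[OF S T TS ST \<gamma> that])
  qed (fact S S_sym \<gamma>)+
  have "?L \<longleftrightarrow> odd_poisson (dens_eq U) (\<lambda>r. Poly_Mapping.single 0 (const r)) (dens n m U) (dens_hom n m U) dbracket"
    by (simp add: canonical_bracket_def dbracket_def[abs_def])
  also have "\<dots> \<longleftrightarrow> (\<forall>x\<in>U. \<exists>V \<rho>. openin (Euclidean_space n) V \<and> x \<in> V \<and> V \<subseteq> U \<and> volume_form n m V \<rho> \<and>
      (\<forall>i<n + m. \<forall>y\<in>V. ?\<gamma> i y = - (\<Sum>j<n + m. S i j y * pd n j (slog m \<rho>) y)) \<and>
      (\<forall>y\<in>V. ?\<theta> y = (\<Sum>i<n + m. \<Sum>j<n + m. S i j y * (pd n j (slog m \<rho>) y * pd n i (slog m \<rho>) y))))"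
    by (rule trans[OF odd_poisson_iff[where T = T] closed_iff_local[where T = T]];
        (rule TS jac_coordinates[OF Poisson]; assumption))
  also have "\<dots> \<longleftrightarrow> ?R"
  proof (intro ball_cong refl)
    fix x assume "x \<in> U"
    have "(volume_form n m V \<rho> \<and>
      (\<forall>i<n + m. \<forall>y\<in>V. ?\<gamma> i y = - (\<Sum>j<n + m. S i j y * pd n j (slog m \<rho>) y)) \<and>
      (\<forall>y\<in>V. ?\<theta> y = (\<Sum>i<n + m. \<Sum>j<n + m. S i j y * (pd n j (slog m \<rho>) y * pd n i (slog m \<rho>) y)))) \<longleftrightarrow>
      (volume_form n m V \<rho> \<and>
      (\<forall>i<n + m. eq_on V (\<Sum>j<n + m. \<Sum>k<n + m. S j k * P i k j)
        (- ((\<Sum>j<n + m. pd n j (S j i)) + const ((real n - real m + 3) / (real n - real m + 1)) *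
              (\<Sum>j<n + m. S i j * pd n j (slog m \<rho>))))) \<and>
      eq_on V (\<Sum>i<n + m. \<Sum>j<n + m. S i j * proj_B n m P j i)
        (- (\<Sum>j<n + m. pd n j (\<Sum>i<n + m. S j i * pd n i (slog m \<rho>))) -
          const ((real n - real m + 2) / (real n - real m + 1)) *
            (\<Sum>i<n + m. \<Sum>j<n + m. (-1) ^ (par n i * par n j) *
              (S i j * pd n i (slog m \<rho>) * pd n j (slog m \<rho>)))))"
      if V: "openin (Euclidean_space n) V" "V \<subseteq> U" for V \<rho>
    proof (rule conj_cong[OF refl])
      assume \<rho>: "volume_form n m V \<rho>"
      interpret V: euclidean_domain n V by unfold_locales (rule V(1))
      have "S i j \<in> SF n m V" if "i < n + m" "j < n + m" for i j
        by (rule SF_hom_SF[OF SF_hom_subset[OF S[OF that] V(2)]])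
      from V.local_equations_iff[OF nm V.SF_hom_slog[OF \<rho>] this]
      show "((\<forall>i<n + m. \<forall>y\<in>V. ?\<gamma> i y = - (\<Sum>j<n + m. S i j y * pd n j (slog m \<rho>) y)) \<and>
        (\<forall>y\<in>V. ?\<theta> y = (\<Sum>i<n + m. \<Sum>j<n + m. S i j y * (pd n j (slog m \<rho>) y * pd n i (slog m \<rho>) y)))) \<longleftrightarrow>
        ((\<forall>i<n + m. eq_on V (\<Sum>j<n + m. \<Sum>k<n + m. S j k * P i k j)
        (- ((\<Sum>j<n + m. pd n j (S j i)) + const ((real n - real m + 3) / (real n - real m + 1)) *
              (\<Sum>j<n + m. S i j * pd n j (slog m \<rho>))))) \<and>
      eq_on V (\<Sum>i<n + m. \<Sum>j<n + m. S i j * proj_B n m P j i)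
        (- (\<Sum>j<n + m. pd n j (\<Sum>i<n + m. S j i * pd n i (slog m \<rho>))) -
          const ((real n - real m + 2) / (real n - real m + 1)) *
            (\<Sum>i<n + m. \<Sum>j<n + m. (-1) ^ (par n i * par n j) *
              (S i j * pd n i (slog m \<rho>) * pd n j (slog m \<rho>)))))"
        by (rule sym)
    qed
    then show "(\<exists>V \<rho>. openin (Euclidean_space n) V \<and> x \<in> V \<and> V \<subseteq> U \<and> volume_form n m V \<rho> \<and>
      (\<forall>i<n + m. \<forall>y\<in>V. ?\<gamma> i y = - (\<Sum>j<n + m. S i j y * pd n j (slog m \<rho>) y)) \<and>
      (\<forall>y\<in>V. ?\<theta> y = (\<Sum>i<n + m. \<Sum>j<n + m. S i j y * (pd n j (slog m \<rho>) y * pd n i (slog m \<rho>) y)))) \<longleftrightarrow>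
      (\<exists>V. openin (Euclidean_space n) V \<and> x \<in> V \<and> V \<subseteq> U \<and> (\<exists>\<rho>. volume_form n m V \<rho> \<and>
      (\<forall>i<n + m. eq_on V (\<Sum>j<n + m. \<Sum>k<n + m. S j k * P i k j)
        (- ((\<Sum>j<n + m. pd n j (S j i)) + const ((real n - real m + 3) / (real n - real m + 1)) *
              (\<Sum>j<n + m. S i j * pd n j (slog m \<rho>))))) \<and>
      eq_on V (\<Sum>i<n + m. \<Sum>j<n + m. S i j * proj_B n m P j i)
        (- (\<Sum>j<n + m. pd n j (\<Sum>i<n + m. S j i * pd n i (slog m \<rho>))) -
          const ((real n - real m + 2) / (real n - real m + 1)) *
            (\<Sum>i<n + m. \<Sum>j<n + m. (-1) ^ (par n i * par n j) *
              (S i j * pd n i (slog m \<rho>) * pd n j (slog m \<rho>))))))"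
      by (rule ex_conj_regroup)
  qed
  finally show ?thesis .
qed

theorem theorem4p5:
  fixes n m :: nat
    and M :: "('a, 'c) smfd"
    and S :: "'c \<Rightarrow> nat \<Rightarrow> nat \<Rightarrow> superfun"
    and P :: "'c \<Rightarrow> nat \<Rightarrow> nat \<Rightarrow> nat \<Rightarrow> superfun"
  assumes "supermanifold n m M"
    and "odd_symplectic n m M S"
    and "projective_class n m M P"
  shows "canonical_bracket_is_odd_poisson n m M S P \<longleftrightarrow>
    (\<forall>c\<in>charts M. \<forall>w\<in>cdom M c.
       \<exists>V \<rho>. openin (space M) V \<and> w \<in> V \<and> V \<subseteq> cdom M c \<and>
         volume_form n m (cmap M c ` V) \<rho> \<and>
         (\<forall>i<n + m. eq_on (cmap M c ` V)
            (\<Sum>j<n + m. \<Sum>k<n + m. S c j k * P c i k j)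
            (- ((\<Sum>j<n + m. pd n j (S c j i)) +
                const ((real n - real m + 3) / (real n - real m + 1)) *
                  (\<Sum>j<n + m. S c i j * pd n j (slog m \<rho>))))) \<and>
         eq_on (cmap M c ` V)
           (\<Sum>i<n + m. \<Sum>j<n + m. S c i j * proj_B n m (P c) j i)
           (- (\<Sum>j<n + m. pd n j (\<Sum>i<n + m. S c j i * pd n i (slog m \<rho>))) -
              const ((real n - real m + 2) / (real n - real m + 1)) *
                (\<Sum>i<n + m. \<Sum>j<n + m. (-1) ^ (par n i * par n j) *
                   (S c i j * pd n i (slog m \<rho>) * pd n j (slog m \<rho>)))))"
proof -
  let ?E = "\<lambda>c V \<rho>. (\<forall>i<n + m. eq_on V
            (\<Sum>j<n + m. \<Sum>k<n + m. S c j k * P c i k j)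
            (- ((\<Sum>j<n + m. pd n j (S c j i)) +
                const ((real n - real m + 3) / (real n - real m + 1)) *
                  (\<Sum>j<n + m. S c i j * pd n j (slog m \<rho>))))) \<and>
         eq_on V
           (\<Sum>i<n + m. \<Sum>j<n + m. S c i j * proj_B n m (P c) j i)
           (- (\<Sum>j<n + m. pd n j (\<Sum>i<n + m. S c j i * pd n i (slog m \<rho>))) -
              const ((real n - real m + 2) / (real n - real m + 1)) *
                (\<Sum>i<n + m. \<Sum>j<n + m. (-1) ^ (par n i * par n j) *
                   (S c i j * pd n i (slog m \<rho>) * pd n j (slog m \<rho>))))"
  have "odd_poisson (dens_eq (cimg M c)) (\<lambda>r. Poly_Mapping.single 0 (const r)) (dens n m (cimg M c))
      (dens_hom n m (cimg M c)) (\<lambda>a b. canonical_bracket n m (S c) (P c) (dens_sgn a) b) \<longleftrightarrow>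
    (\<forall>w\<in>cdom M c. \<exists>V \<rho>. openin (space M) V \<and> w \<in> V \<and> V \<subseteq> cdom M c \<and>
      volume_form n m (cmap M c ` V) \<rho> \<and> ?E c (cmap M c ` V) \<rho>)" if c: "c \<in> charts M" for c
  proof -
    have D: "openin (space M) (cdom M c)" and U: "openin (Euclidean_space n) (cimg M c)"
      and hom: "homeomorphic_map (subtopology (space M) (cdom M c))
        (subtopology (Euclidean_space n) (cimg M c)) (cmap M c)"
      using conjunct1[OF conjunct2[OF conjunct2[OF conjunct2[OF assms(1)[unfolded supermanifold_def]]]]] c
      by simp_all
    interpret euclidean_domain n "cimg M c" by unfold_locales (rule U)
    have SH: "S c i j \<in> SF_hom n m (cimg M c) (par n i + par n j + 1)"
      and sym: "eq_on (cimg M c) (S c i j) ((-1) ^ (par n i * par n j) * S c j i)"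
      if "i < n + m" "j < n + m" for i j
      using conjunct1[OF conjunct1[OF assms(2)[unfolded odd_symplectic_def], unfolded odd_master_hamiltonian_def]] c that
      by simp_all
    have symx: "S c i j x = (-1) ^ (par n i * par n j) * S c j i x"
      if "i < n + m" "j < n + m" "x \<in> cimg M c" for i j x
      using sym[OF that(1,2)] that(3) by (simp only: eq_on_def times_fun_apply neg_one_power_fun)
    have Poisson: "odd_poisson (eq_on (cimg M c)) const (SF n m (cimg M c)) (SF_hom n m (cimg M c))
        (\<lambda>f g. derived_bracket n m (S c) (sgn_pow 1 f) g)" and nd: "nondegenerate n m (cimg M c) (S c)"
      using conjunct2[OF assms(2)[unfolded odd_symplectic_def]] c by simp_all
    obtain \<Gamma> where conn: "symmetric_connection n m M \<Gamma>"
      and tf: "\<forall>c\<in>charts M. \<forall>k<n + m. \<forall>j<n + m. \<forall>i<n + m.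
        eq_on (cimg M c) (P c k j i) (trace_free_part n m (\<Gamma> c) k j i)"
      using assms(3) unfolding projective_class_def by (elim exE conjE) (rule that)
    have \<Gamma>: "\<Gamma> c k i j \<in> SF_hom n m (cimg M c) (par n i + par n j + par n k)"
      if "i < n + m" "j < n + m" "k < n + m" for i j k
      using conjunct1[OF conn[unfolded symmetric_connection_def]] c that by simp
    have PH: "P c k i j \<in> SF_hom n m (cimg M c) (par n i + par n j + par n k)"
      if "k < n + m" "i < n + m" "j < n + m" for k i j
    proof -
      have "P c k i j \<in> SF_hom n m (cimg M c) (par n i + par n j + par n k) \<longleftrightarrow>
        trace_free_part n m (\<Gamma> c) k i j \<in> SF_hom n m (cimg M c) (par n i + par n j + par n k)"
      proof (rule SF_hom_eq_cong)
        fix x assume "x \<in> cimg M c"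
        then show "P c k i j x = trace_free_part n m (\<Gamma> c) k i j x"
          using tf c \<open>k < n + m\<close> \<open>i < n + m\<close> \<open>j < n + m\<close> unfolding eq_on_def by blast
      qed
      moreover have "trace_free_part n m (\<Gamma> c) k i j \<in> SF_hom n m (cimg M c) (par n i + par n j + par n k)"
        using SF_trace_free_part[where \<Gamma> = "\<Gamma> c" and k = k and j = i and i = j] \<Gamma> that by simp
      ultimately show ?thesis
        by simp
    qed
    have "odd_poisson (dens_eq (cimg M c)) (\<lambda>r. Poly_Mapping.single 0 (const r)) (dens n m (cimg M c))
        (dens_hom n m (cimg M c)) (\<lambda>a b. canonical_bracket n m (S c) (P c) (dens_sgn a) b) \<longleftrightarrow>
      (\<forall>x\<in>cimg M c. \<exists>V. openin (Euclidean_space n) V \<and> x \<in> V \<and> V \<subseteq> cimg M c \<and>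
        (\<exists>\<rho>. volume_form n m V \<rho> \<and> ?E c V \<rho>))"
      by (rule chart_criterion[OF U SH symx PH Poisson nd])
    also have "\<dots> \<longleftrightarrow> (\<forall>w\<in>cdom M c. \<exists>V. openin (Euclidean_space n) V \<and> cmap M c w \<in> V \<and> V \<subseteq> cimg M c \<and>
        (\<exists>\<rho>. volume_form n m V \<rho> \<and> ?E c V \<rho>))"
      by (simp only: ball_simps)
    also have "\<dots> \<longleftrightarrow> (\<forall>w\<in>cdom M c. \<exists>V. openin (space M) V \<and> w \<in> V \<and> V \<subseteq> cdom M c \<and>
        (\<exists>\<rho>. volume_form n m (cmap M c ` V) \<rho> \<and> ?E c (cmap M c ` V) \<rho>))"
      by (intro ball_cong refl)
        (rule chart_open_correspondence[where Q = "\<lambda>V. \<exists>\<rho>. volume_form n m V \<rho> \<and> ?E c V \<rho>", OF D hom U, symmetric])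
    finally show ?thesis by (simp only: ex_simps)
  qed
  then show ?thesis
    unfolding canonical_bracket_is_odd_poisson_def by (simp only: cong: ball_cong)
qed

end
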